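(* Let $p\neq q$ be primes and $m,n\ge 1$ with $p^m>2$. Let $Q\in\mathcal{LSS}(p^m,q^n,\sigma_Q)$. If $\gamma_Q\leq\sigma_Q$ then $$\mathrm{Dis}(Q)\cong \mathbb{Z}_p^{m+k}\rtimes_\rho\mathbb{Z}_q^n$$ for some $0\le k\leq m$, where $\rho$ is a faithful action, and $\gamma_1(\mathrm{Dis}(Q))=\gamma_2(\mathrm{Dis}(Q))=\mathrm{Dis}_{\gamma_Q}$.
   Context: A quandle is a set $Q$ with a binary operation $*$ such that every $L_a:b\mapsto a*b$ is a bijection, $a*(b*c)=(a*b)*(a*c)$ and $a*a=a$. The displacement group is $\mathrm{Dis}(Q)=\langle L_aL_b^{-1}: a,b\in Q\rangle$; $Q$ is connected if $\mathrm{Dis}(Q)$ is transitive on $Q$. Congruences are equivalence relations compatible with $*$ and left division; $0_Q$ is equality, $1_Q=Q\times Q$. $Q$ is subdirectly irreducible if the intersection of all congruences $\neq 0_Q$ is $\ne 0_Q$. A subquandle is proper if it has more than one element and is not all of $Q$; a quandle with more than one element is strictly simple if it has no proper subquandles, and locally strictly simple (LSS) if all its proper subquandles are strictly simple. A quandle is abelian if $\mathrm{Dis}(Q)$ is abelian and acts semiregularly; a finite connected quandle is abelian iff it is isomorphic to $(A,* )$ with $A$ an abelian group, $a*b=a+f(b-a)$, $f\in\mathrm{Aut}(A)$. $\sigma_Q$ is the equivalence relation: $a\,\sigma_Q\,b$ iff $\mathrm{Dis}(Q)_a=\mathrm{Dis}(Q)_b$ (point stabilizers). $\gamma_Q$ is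 the smallest congruence of $Q$ with abelian factor. For primes $p,q$, $\mathcal{LSS}(p^m,q^n,\sigma_Q)$ denotes the class of finite connected non-abelian subdirectly irreducible LSS quandles having a unique congruence different from $0_Q,1_Q$ (this congruence is then $\gamma_Q$), with factor of size $q^n$ and blocks of size $p^m$, and with the given relation $\sigma_Q$. For a congruence $\alpha$, $\mathrm{Dis}_\alpha=\langle L_aL_b^{-1}: a\,\alpha\,b\rangle$. For a group $G$: $\gamma_1(G)=[G,G]$, $\gamma_2(G)=[G,\gamma_1(G)]$. *)

theory Defs
  imports
    "HOL-Computational_Algebra.Primes"
    "HOL-Algebra.Group_Action"
    "HOL-Algebra.Generated_Groups"
    "HOL-Algebra.Elementary_Groups"
    "HOL-Algebra.Product_Groups"
begin

section \<open>Quandles\<close>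

record 'a qstruct = "'a partial_object" +
  qop :: "['a, 'a] \<Rightarrow> 'a" (infixl \<open>\<triangleright>\<index>\<close> 70)

locale quandle =
  fixes Q :: "'a qstruct" (structure)
  assumes bij_left: "a \<in> carrier Q \<Longrightarrow> bij_betw (\<lambda>b. a \<triangleright> b) (carrier Q) (carrier Q)"
    and left_distrib: "\<lbrakk>a \<in> carrier Q; b \<in> carrier Q; c \<in> carrier Q\<rbrakk>
      \<Longrightarrow> a \<triangleright> (b \<triangleright> c) = (a \<triangleright> b) \<triangleright> (a \<triangleright> c)"
    and idem: "a \<in> carrier Q \<Longrightarrow> a \<triangleright> a = a"

definition ldiv :: "'a qstruct \<Rightarrow> 'a \<Rightarrow> 'a \<Rightarrow> 'a" where
  "ldiv Q a b = inv_into (carrier Q) (\<lambda>x. a \<triangleright>\<^bsub>Q\<^esub> x) b"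

text \<open>Restricted to the carrier so that it is an element of \<^const>\<open>BijGroup\<close>.\<close>

definition left_mult :: "'a qstruct \<Rightarrow> 'a \<Rightarrow> 'a \<Rightarrow> 'a" where
  "left_mult Q a = (\<lambda>b\<in>carrier Q. a \<triangleright>\<^bsub>Q\<^esub> b)"

definition more_than_one :: "'a set \<Rightarrow> bool" where
  "more_than_one S \<longleftrightarrow> (\<exists>x\<in>S. \<exists>y\<in>S. x \<noteq> y)"

subsection \<open>Displacement groups\<close>

definition displacements :: "'a qstruct \<Rightarrow> ('a \<times> 'a) set \<Rightarrow> ('a \<Rightarrow> 'a) set" where
  "displacements Q \<alpha> =
     {left_mult Q a \<otimes>\<^bsub>BijGroup (carrier Q)\<^esub> inv\<^bsub>BijGroup (carrier Q)\<^esub> left_mult Q b | a b. (a, b) \<in> \<alpha>}"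

definition Dis_rel :: "'a qstruct \<Rightarrow> ('a \<times> 'a) set \<Rightarrow> ('a \<Rightarrow> 'a) set" where
  "Dis_rel Q \<alpha> = generate (BijGroup (carrier Q)) (displacements Q \<alpha>)"

definition Dis :: "'a qstruct \<Rightarrow> ('a \<Rightarrow> 'a) monoid" where
  "Dis Q = (BijGroup (carrier Q))\<lparr>carrier := Dis_rel Q (carrier Q \<times> carrier Q)\<rparr>"

definition Dis_stab :: "'a qstruct \<Rightarrow> 'a \<Rightarrow> ('a \<Rightarrow> 'a) set" where
  "Dis_stab Q a = stabilizer (Dis Q) (\<lambda>g. g) a"

definition connected_quandle :: "'a qstruct \<Rightarrow> bool" where
  "connected_quandle Q \<longleftrightarrow> transitive_action (Dis Q) (carrier Q) (\<lambda>g. g)"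

definition abelian_quandle :: "'a qstruct \<Rightarrow> bool" where
  "abelian_quandle Q \<longleftrightarrow>
     comm_group (Dis Q) \<and> (\<forall>a\<in>carrier Q. Dis_stab Q a = {\<one>\<^bsub>Dis Q\<^esub>})"

definition sigma_rel :: "'a qstruct \<Rightarrow> ('a \<times> 'a) set" where
  "sigma_rel Q = {(a, b) \<in> carrier Q \<times> carrier Q. Dis_stab Q a = Dis_stab Q b}"

subsection \<open>Congruences and factors\<close>

definition congruence :: "'a qstruct \<Rightarrow> ('a \<times> 'a) set \<Rightarrow> bool" where
  "congruence Q \<alpha> \<longleftrightarrow> equiv (carrier Q) \<alpha> \<and>
     (\<forall>(a, b)\<in>\<alpha>. \<forall>(c, d)\<in>\<alpha>.
        (a \<triangleright>\<^bsub>Q\<^esub> c, b \<triangleright>\<^bsub>Q\<^esub> d) \<in> \<alpha> \<and> (ldiv Q a c, ldiv Q b d) \<in> \<alpha>)"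

definition zero_cong :: "'a qstruct \<Rightarrow> ('a \<times> 'a) set" where
  "zero_cong Q = Id_on (carrier Q)"

definition one_cong :: "'a qstruct \<Rightarrow> ('a \<times> 'a) set" where
  "one_cong Q = carrier Q \<times> carrier Q"

definition factor :: "'a qstruct \<Rightarrow> ('a \<times> 'a) set \<Rightarrow> 'a set qstruct" where
  "factor Q \<alpha> = \<lparr>carrier = carrier Q // \<alpha>,
     qop = (\<lambda>X Y. \<Union>a\<in>X. \<Union>b\<in>Y. \<alpha> `` {a \<triangleright>\<^bsub>Q\<^esub> b})\<rparr>"

definition gamma_cong :: "'a qstruct \<Rightarrow> ('a \<times> 'a) set" where
  "gamma_cong Q = (LEAST \<alpha>. congruence Q \<alpha> \<and> abelian_quandle (factor Q \<alpha>))"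

text \<open>The meet is taken in the congruence lattice, whose empty meet is the full relation; hence
  the intersection with \<^const>\<open>one_cong\<close>, which matters only for at most one element.\<close>

definition subdirectly_irreducible :: "'a qstruct \<Rightarrow> bool" where
  "subdirectly_irreducible Q \<longleftrightarrow>
     one_cong Q \<inter> \<Inter>{\<alpha>. congruence Q \<alpha> \<and> \<alpha> \<noteq> zero_cong Q} \<noteq> zero_cong Q"

subsection \<open>Locally strictly simple quandles\<close>

definition subquandle :: "'a set \<Rightarrow> 'a qstruct \<Rightarrow> bool" where
  "subquandle S Q \<longleftrightarrow> S \<subseteq> carrier Q \<and>
     (\<forall>a\<in>S. \<forall>b\<in>S. a \<triangleright>\<^bsub>Q\<^esub> b \<in> S \<and> ldiv Q a b \<in> S)"

definition proper_subquandle :: "'a set \<Rightarrow> 'a qstruct \<Rightarrow> bool" where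
  "proper_subquandle S Q \<longleftrightarrow> subquandle S Q \<and> more_than_one S \<and> S \<noteq> carrier Q"

definition strictly_simple :: "'a qstruct \<Rightarrow> bool" where
  "strictly_simple Q \<longleftrightarrow> more_than_one (carrier Q) \<and> (\<nexists>S. proper_subquandle S Q)"

definition locally_strictly_simple :: "'a qstruct \<Rightarrow> bool" where
  "locally_strictly_simple Q \<longleftrightarrow>
     (\<forall>S. proper_subquandle S Q \<longrightarrow> strictly_simple (Q\<lparr>carrier := S\<rparr>))"

text \<open>The class of \<open>LSS(P, N, \<sigma>)\<close> quandles; \<open>P\<close> is the size of the blocks and \<open>N\<close> the size of
  the factor of the unique nontrivial congruence.\<close>

definition LSS_class :: "nat \<Rightarrow> nat \<Rightarrow> ('a \<times> 'a) set \<Rightarrow> 'a qstruct set" where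
  "LSS_class P N \<sigma> = {Q.
     quandle Q \<and> finite (carrier Q) \<and> connected_quandle Q \<and> \<not> abelian_quandle Q \<and>
     subdirectly_irreducible Q \<and> locally_strictly_simple Q \<and>
     (\<exists>\<alpha>. {\<beta>. congruence Q \<beta> \<and> \<beta> \<noteq> zero_cong Q \<and> \<beta> \<noteq> one_cong Q} = {\<alpha>} \<and>
        card (carrier (factor Q \<alpha>)) = N \<and> (\<forall>X\<in>carrier Q // \<alpha>. card X = P)) \<and>
     sigma_rel Q = \<sigma>}"

section \<open>Groups\<close>

definition commutator_subgroup :: "('g, 'x) monoid_scheme \<Rightarrow> 'g set \<Rightarrow> 'g set \<Rightarrow> 'g set" where
  "commutator_subgroup G H K =
     generate G (\<Union>h\<in>H. \<Union>k\<in>K. {h \<otimes>\<^bsub>G\<^esub> k \<otimes>\<^bsub>G\<^esub> inv\<^bsub>G\<^esub> h \<otimes>\<^bsub>G\<^esub> inv\<^bsub>G\<^esub> k})"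

text \<open>Indexed so that \<open>lower_central G 1\<close> is the derived subgroup.\<close>

primrec lower_central :: "('g, 'x) monoid_scheme \<Rightarrow> nat \<Rightarrow> 'g set" where
  "lower_central G 0 = carrier G"
| "lower_central G (Suc i) = commutator_subgroup G (carrier G) (lower_central G i)"

definition elementary_abelian :: "nat \<Rightarrow> nat \<Rightarrow> (nat \<Rightarrow> int) monoid" where
  "elementary_abelian p r = product_group {..<r} (\<lambda>_. integer_mod_group p)"

definition semidirect_product ::
  "('n, 'x) monoid_scheme \<Rightarrow> ('h, 'y) monoid_scheme \<Rightarrow> ('h \<Rightarrow> 'n \<Rightarrow> 'n) \<Rightarrow> ('n \<times> 'h) monoid" where
  "semidirect_product N H \<rho> =
     \<lparr>carrier = carrier N \<times> carrier H,
      mult = (\<lambda>(x, g) (y, h). (x \<otimes>\<^bsub>N\<^esub> \<rho> g y, g \<otimes>\<^bsub>H\<^esub> h)),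
      one = (\<one>\<^bsub>N\<^esub>, \<one>\<^bsub>H\<^esub>)\<rparr>"

definition faithful_aut_action ::
  "('n, 'x) monoid_scheme \<Rightarrow> ('h, 'y) monoid_scheme \<Rightarrow> ('h \<Rightarrow> 'n \<Rightarrow> 'n) \<Rightarrow> bool" where
  "faithful_aut_action N H \<rho> \<longleftrightarrow> \<rho> \<in> hom H (AutoGroup N) \<and> inj_on \<rho> (carrier H)"

end

theory Submission
  imports Defs "HOL-Algebra.Multiplicative_Group" "HOL-Algebra.Sylow"
begin

text \<open>
  Write \<open>D\<close> for the displacement group, \<open>\<alpha>\<close> for the unique congruence strictly between \<open>0\<close> and
  \<open>1\<close>, and \<open>K \<le> D\<close> for the kernel of the action of \<open>D\<close> on the blocks of \<open>\<alpha>\<close>. The proof shows that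
  \<open>K\<close> is elementary abelian of exponent \<open>p\<close>, that \<open>D/K\<close> is elementary abelian of order \<open>q\<^sup>n\<close>, and
  that \<open>D\<close> therefore splits over \<open>K\<close>.

  Two principles do most of the work. First, if a subgroup of \<open>D\<close> is normalised by all left
  translations, then its orbits form a congruence (\<open>congruence_orb_rel\<close>); as there are only three
  congruences, such a subgroup is trivial, or has exactly the blocks of \<open>\<alpha>\<close> as orbits, or is transitive
  (\<open>orbits_trichotomy\<close>). Second, a subquandle inside a block is a point or the whole block, because a
  block is a proper subquandle and hence strictly simple (\<open>subquandle_of_block\<close>).

  The congruence \<open>\<gamma>\<close> is \<open>\<alpha>\<close> or \<open>1\<close>, since \<open>Q\<close> is not abelian. In both cases it follows from \<open>\<gamma> \<le> \<sigma>\<close>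
  that the stabiliser of a point fixes the whole block of that point and lies in \<open>K\<close>. Left
  translations are injective in their parameter: otherwise their kernel would be \<open>1\<close>, making \<open>D\<close>
  trivial, or \<open>\<alpha>\<close>, making any two points of a block a subquandle against \<open>p\<^sup>m > 2\<close>. Hence \<open>K\<close> is not trivial, so it is
  transitive on each block, and counting orbits gives \<open>|K : K\<^sub>a| = p\<^sup>m\<close> and \<open>|D : K| = q\<^sup>n\<close>.

  For a point \<open>a\<close>, the preimage in \<open>K\<close> of the centre of the \<open>p\<close>-group \<open>K/K\<^sub>a\<close> moves \<open>a\<close> through a
  subquandle of the block with more than one point, that is, through the whole block; so
  \<open>[K,K] \<le> K\<^sub>a\<close> for all \<open>a\<close> and \<open>K\<close> is abelian. The elements whose \<open>p\<close>-th power lies in \<open>K\<^sub>a\<close> are treated alike and give exponent \<open>p\<close>. For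
  \<open>D/K\<close> the same two choices of subgroups, now combined with the trichotomy of orbits, give
  commutativity and exponent \<open>q\<close>; in particular \<open>Q/\<alpha>\<close> is abelian and \<open>\<gamma> = \<alpha>\<close>. An element of \<open>K\<close>
  that fixes points of two different blocks fixes a subquandle properly larger than a block, hence
  everything; so \<open>K\<close> embeds into the product of two blocks and \<open>|K| \<le> p\<^sup>2\<^sup>m\<close>.

  A Sylow \<open>q\<close>-subgroup \<open>S\<close> is a complement of \<open>K\<close>. The centraliser of \<open>K\<close> in \<open>D\<close> is normalised by the
  left translations; it is not \<open>D\<close>, since then \<open>D = KS\<close> and \<open>Q\<close> would be abelian, and so it is \<open>K\<close>.
  This is the faithfulness of the action. Finally let \<open>\<gamma>\<^sub>1 = [D,D]\<close> and \<open>\<gamma>\<^sub>2 = [D,\<gamma>\<^sub>1]\<close>. The orbits of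
  \<open>\<gamma>\<^sub>1\<close> are the blocks, so the generators of \<open>Dis\<^sub>\<alpha>\<close> are the commutators \<open>[L\<^sub>a,g]\<close> with \<open>g \<in> \<gamma>\<^sub>1\<close>,
  which yields \<open>\<gamma>\<^sub>2 \<le> Dis\<^sub>\<alpha> \<le> \<gamma>\<^sub>1\<close>. Modulo \<open>\<gamma>\<^sub>2\<close> the commutator of an element of \<open>K\<close> and one of \<open>S\<close>
  commutes with the latter, so its order divides \<open>p\<close> and \<open>q\<close>; thus \<open>D/\<gamma>\<^sub>2\<close> is abelian and
  \<open>\<gamma>\<^sub>1 \<le> \<gamma>\<^sub>2\<close>.
\<close>

section \<open>Finite groups and their quotients\<close>

lemma (in group) cancel_inv_left: "a \<in> carrier G \<Longrightarrow> b \<in> carrier G \<Longrightarrow> inv a \<otimes> (a \<otimes> b) = b"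
  by (simp flip: m_assoc)

lemma (in group) cancel_left_inv: "a \<in> carrier G \<Longrightarrow> b \<in> carrier G \<Longrightarrow> a \<otimes> (inv a \<otimes> b) = b"
  by (simp flip: m_assoc)

lemmas (in group) group_normalize = m_assoc inv_mult_group cancel_inv_left cancel_left_inv

text \<open>Under conjugation the orbit of a noncentral element has a size divisible by \<open>p\<close>. If only
  \<open>\<one>\<close> were central, the group order would be \<open>1\<close> modulo \<open>p\<close>.\<close>

lemma (in group) p_group_has_central_element:
  assumes p: "prime p" and ord: "order G = p ^ m" and m: "m \<ge> 1"
  shows "\<exists>z\<in>carrier G. z \<noteq> \<one> \<and> (\<forall>x\<in>carrier G. z \<otimes> x = x \<otimes> z)"
proof (rule ccontr)
  assume none: "\<not> ?thesis"
  define \<phi> where "\<phi> = (\<lambda>g. \<lambda>h\<in>carrier G. g \<otimes> h \<otimes> inv g)"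
  interpret conj: group_action G "carrier G" \<phi>
    unfolding \<phi>_def by (rule action_by_conjugation)
  have fin: "finite (carrier G)"
    using ord p by (metis order_gt_0_iff_finite prime_gt_0_nat zero_less_power)
  have fin_orbits: "finite (orbits G (carrier G) \<phi>)"
    using fin unfolding orbits_def by auto
  have one_orbit: "orbit G \<phi> \<one> = {\<one>}"
    unfolding orbit_def \<phi>_def by (auto intro!: exI[of _ \<one>])
  have div: "p dvd card R" if "R \<in> orbits G (carrier G) \<phi> - {{\<one>}}" for R
  proof -
    from that obtain x where x: "x \<in> carrier G" and R: "R = orbit G \<phi> x"
      unfolding orbits_def by auto
    with that one_orbit have "x \<noteq> \<one>" by auto
    then obtain g where g: "g \<in> carrier G" "x \<otimes> g \<noteq> g \<otimes> x"
      using none x by blast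
    have "card R dvd p ^ m"
      using conj.orbit_stabilizer_theorem[OF x] ord R by (metis dvd_triv_left)
    then obtain i where i: "card R = p ^ i"
      using p by (auto simp: divides_primepow_nat)
    have "i \<noteq> 0"
    proof
      assume "i = 0"
      with i have "card R = 1" by simp
      moreover have "x \<in> R" using conj.orbit_refl[OF x] R by simp
      ultimately have "R = {x}" by (metis card_1_singletonE singletonD)
      moreover have "g \<otimes> x \<otimes> inv g \<in> R"
        unfolding R orbit_def \<phi>_def using g x by auto
      ultimately have "g \<otimes> x \<otimes> inv g = x" by simp
      then have "g \<otimes> x = x \<otimes> g"
        using g x by (metis inv_solve_right' m_closed)
      with g show False by simp
    qed
    with i show ?thesis by simp
  qed
  have "card (carrier G) = (\<Sum>R\<in>orbits G (carrier G) \<phi>. card R)"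
    using conj.disjoint_sum[OF fin, of "\<lambda>_. 1 :: nat"] by simp
  also have "\<dots> = card {\<one>} + (\<Sum>R\<in>orbits G (carrier G) \<phi> - {{\<one>}}. card R)"
    by (rule sum.remove[OF fin_orbits]) (use one_orbit in \<open>auto simp: orbits_def\<close>)
  finally have "p ^ m = 1 + (\<Sum>R\<in>orbits G (carrier G) \<phi> - {{\<one>}}. card R)"
    using ord by (simp add: order_def)
  moreover have "p dvd (\<Sum>R\<in>orbits G (carrier G) \<phi> - {{\<one>}}. card R)"
    by (rule dvd_sum) (use div in blast)
  moreover have "p dvd p ^ m" using m by simp
  ultimately have "p dvd 1" by (metis dvd_add_left_iff)
  with p show False by simp
qed

lemma (in group) p_group_has_element_of_prime_order:
  assumes p: "prime p" and ord: "order G = p ^ m" and m: "m \<ge> 1"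
  obtains z where "z \<in> carrier G" "z \<noteq> \<one>" "z [^] p = \<one>"
proof -
  obtain x where x: "x \<in> carrier G" "x \<noteq> \<one>"
    using p_group_has_central_element[OF assms] by metis
  then have "group.ord G x dvd p ^ m"
    using ord ord_dvd_group_order by metis
  then obtain i where i: "group.ord G x = p ^ i"
    using p by (auto simp: divides_primepow_nat)
  have "i \<noteq> 0" using i x ord_eq_1[of x] by (metis power_0)
  then obtain j where j: "i = Suc j" by (cases i) auto
  show thesis
  proof (rule that[of "x [^] (p ^ j)"])
    show "x [^] (p ^ j) \<in> carrier G" using x by simp
    show "(x [^] (p ^ j)) [^] p = \<one>"
      using x i j pow_ord_eq_1[of x] by (simp add: nat_pow_pow mult.commute)
    show "x [^] (p ^ j) \<noteq> \<one>"
    proof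
      assume "x [^] (p ^ j) = \<one>"
      then have "p ^ Suc j dvd p ^ j" using x i j pow_eq_id by metis
      with p show False using power_dvd_imp_le[of p "Suc j" j] prime_gt_1_nat by fastforce
    qed
  qed
qed

text \<open>Facts about \<open>G/N\<close> are phrased through representatives in \<open>G\<close>, because the elements of the
  permutation groups below are to be applied to points.\<close>

lemma (in group) p_quotient_has_central_element:
  assumes N: "N \<lhd> G" and p: "prime p" and ord: "order (G Mod N) = p ^ m" and m: "m \<ge> 1"
  obtains z where "z \<in> carrier G" "z \<notin> N"
    "\<And>x. x \<in> carrier G \<Longrightarrow> z \<otimes> x \<otimes> inv z \<otimes> inv x \<in> N"
proof -
  interpret N: normal N G by (rule N)
  interpret M: group "G Mod N" by (rule N.factorgroup_is_group)
  interpret h: group_hom G "G Mod N" "(#>) N"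
    by (unfold_locales) (rule N.r_coset_hom_Mod)
  have ker: "x \<in> N \<longleftrightarrow> N #> x = \<one>\<^bsub>G Mod N\<^esub>" if "x \<in> carrier G" for x
    using that coset_join1[OF _ that N.is_subgroup] coset_join2[OF that N.is_subgroup] N.subset
    by auto
  obtain Z where Z: "Z \<in> carrier (G Mod N)" "Z \<noteq> \<one>\<^bsub>G Mod N\<^esub>"
    "\<And>X. X \<in> carrier (G Mod N) \<Longrightarrow> Z \<otimes>\<^bsub>G Mod N\<^esub> X = X \<otimes>\<^bsub>G Mod N\<^esub> Z"
    using M.p_group_has_central_element[OF p ord m] by metis
  then obtain z where z: "z \<in> carrier G" "Z = N #> z"
    by (auto simp: carrier_FactGroup)
  show thesis
  proof (rule that[of z])
    show "z \<in> carrier G" "z \<notin> N" using z Z ker by auto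
    fix x assume x: "x \<in> carrier G"
    have c: "(N #> z) \<otimes>\<^bsub>G Mod N\<^esub> (N #> x) = (N #> x) \<otimes>\<^bsub>G Mod N\<^esub> (N #> z)"
      using Z(3)[of "N #> x"] z x by auto
    have "N #> (z \<otimes> x \<otimes> inv z \<otimes> inv x) = (N #> z) \<otimes>\<^bsub>G Mod N\<^esub> (N #> x)
        \<otimes>\<^bsub>G Mod N\<^esub> inv\<^bsub>G Mod N\<^esub> (N #> z) \<otimes>\<^bsub>G Mod N\<^esub> inv\<^bsub>G Mod N\<^esub> (N #> x)"
      using z(1) x by (simp add: h.hom_mult h.hom_inv del: mult_FactGroup)
    also have "\<dots> = \<one>\<^bsub>G Mod N\<^esub>"
      unfolding c using h.hom_closed[OF z(1)] h.hom_closed[OF x]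
      by (simp add: M.m_assoc del: mult_FactGroup one_FactGroup)
    finally show "z \<otimes> x \<otimes> inv z \<otimes> inv x \<in> N" using ker z x by simp
  qed
qed

lemma (in group) p_quotient_has_element_of_prime_order:
  assumes N: "N \<lhd> G" and p: "prime p" and ord: "order (G Mod N) = p ^ m" and m: "m \<ge> 1"
  obtains z where "z \<in> carrier G" "z \<notin> N" "z [^] p \<in> N"
proof -
  interpret N: normal N G by (rule N)
  interpret M: group "G Mod N" by (rule N.factorgroup_is_group)
  interpret h: group_hom G "G Mod N" "(#>) N"
    by (unfold_locales) (rule N.r_coset_hom_Mod)
  have ker: "x \<in> N \<longleftrightarrow> N #> x = \<one>\<^bsub>G Mod N\<^esub>" if "x \<in> carrier G" for x
    using that coset_join1[OF _ that N.is_subgroup] coset_join2[OF that N.is_subgroup] N.subset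
    by auto
  obtain Z where Z: "Z \<in> carrier (G Mod N)" "Z \<noteq> \<one>\<^bsub>G Mod N\<^esub>" "Z [^]\<^bsub>G Mod N\<^esub> p = \<one>\<^bsub>G Mod N\<^esub>"
    using M.p_group_has_element_of_prime_order[OF p ord m] by metis
  then obtain z where z: "z \<in> carrier G" "Z = N #> z"
    by (auto simp: carrier_FactGroup)
  with Z have "z [^] p \<in> N" "z \<notin> N"
    using ker h.hom_nat_pow by auto
  with z that show thesis by blast
qed

text \<open>If \<open>c = [x,y]\<close> commutes with \<open>y\<close>, then \<open>x y x\<^sup>-\<^sup>1 = c y\<close> is a product of commuting elements,
  and taking powers of both sides gives \<open>[x,y\<^sup>i] = c\<^sup>i\<close>.\<close>

lemma (in group) commutator_power:
  assumes "x \<in> carrier G" "y \<in> carrier G"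
    and c: "c = x \<otimes> y \<otimes> inv x \<otimes> inv y" and "c \<otimes> y = y \<otimes> c"
  shows "c [^] (i::nat) = x \<otimes> y [^] i \<otimes> inv x \<otimes> inv (y [^] i)"
proof -
  have cc: "c \<in> carrier G" using assms by auto
  have "x \<otimes> y \<otimes> inv x = c \<otimes> y" using assms by (simp add: m_assoc)
  moreover have "(x \<otimes> y \<otimes> inv x) [^] i = x \<otimes> y [^] i \<otimes> inv x"
  proof (induction i)
    case (Suc i)
    have "inv x \<otimes> (x \<otimes> (y \<otimes> inv x)) = y \<otimes> inv x"
      using assms by (metis inv_closed m_assoc m_closed l_inv l_one)
    with Suc show ?case using assms by (simp add: m_assoc)
  qed (use assms in auto)
  moreover have "(c \<otimes> y) [^] i = c [^] i \<otimes> y [^] i"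
    using assms cc by (intro pow_mult_distrib) auto
  ultimately have "c [^] i \<otimes> y [^] i = x \<otimes> y [^] i \<otimes> inv x" by simp
  then show ?thesis using assms cc by (metis inv_closed inv_solve_right m_closed nat_pow_closed)
qed

text \<open>The order of the element divides both exponents.\<close>

lemma (in group) coprime_exponents_trivial:
  assumes "x \<in> carrier G" "x [^] (a::nat) = \<one>" "x [^] (b::nat) = \<one>" "coprime a b"
  shows "x = \<one>"
proof -
  have "group.ord G x dvd a" "group.ord G x dvd b" using assms pow_eq_id by auto
  then have "group.ord G x = 1" using assms(4) by (meson coprime_common_divisor_nat is_unit_gcd dvd_1_iff_1 coprime_common_divisor)
  then show ?thesis using assms ord_eq_1 by auto
qed

text \<open>The images of \<open>x\<close> and \<open>y\<close> in \<open>G/N\<close> commute.\<close>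

lemma (in group) quotient_pow_mult_closed:
  assumes N: "N \<lhd> G" and x: "x \<in> carrier G" and y: "y \<in> carrier G"
    and comm: "x \<otimes> y \<otimes> inv x \<otimes> inv y \<in> N"
    and "x [^] (k::nat) \<in> N" "y [^] k \<in> N"
  shows "(x \<otimes> y) [^] k \<in> N"
proof -
  interpret N: normal N G by (rule N)
  interpret M: group "G Mod N" by (rule N.factorgroup_is_group)
  interpret h: group_hom G "G Mod N" "(#>) N"
    by (unfold_locales) (rule N.r_coset_hom_Mod)
  have ker: "z \<in> N \<longleftrightarrow> N #> z = \<one>\<^bsub>G Mod N\<^esub>" if "z \<in> carrier G" for z
    using that coset_join1[OF _ that N.is_subgroup] coset_join2[OF that N.is_subgroup] N.subset
    by auto
  have "x \<otimes> y = (x \<otimes> y \<otimes> inv x \<otimes> inv y) \<otimes> (y \<otimes> x)"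
    using x y by (simp add: group_normalize)
  then have "N #> (x \<otimes> y) = (N #> (x \<otimes> y \<otimes> inv x \<otimes> inv y)) \<otimes>\<^bsub>G Mod N\<^esub> (N #> (y \<otimes> x))"
    using h.hom_mult[of "x \<otimes> y \<otimes> inv x \<otimes> inv y" "y \<otimes> x"] x y by simp
  also have "N #> (x \<otimes> y \<otimes> inv x \<otimes> inv y) = \<one>\<^bsub>G Mod N\<^esub>"
    using ker[of "x \<otimes> y \<otimes> inv x \<otimes> inv y"] comm x y by (simp del: one_FactGroup)
  finally have "N #> (x \<otimes> y) = N #> (y \<otimes> x)"
    using M.l_one[OF h.hom_closed[of "y \<otimes> x"]] x y by simp
  then have c: "(N #> x) \<otimes>\<^bsub>G Mod N\<^esub> (N #> y) = (N #> y) \<otimes>\<^bsub>G Mod N\<^esub> (N #> x)"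
    using h.hom_mult[OF x y] h.hom_mult[OF y x] by (simp del: mult_FactGroup)
  have "N #> ((x \<otimes> y) [^] k) = ((N #> x) \<otimes>\<^bsub>G Mod N\<^esub> (N #> y)) [^]\<^bsub>G Mod N\<^esub> k"
    using h.hom_nat_pow[of "x \<otimes> y"] h.hom_mult[OF x y] x y by (simp del: mult_FactGroup)
  also have "\<dots> = (N #> x) [^]\<^bsub>G Mod N\<^esub> k \<otimes>\<^bsub>G Mod N\<^esub> (N #> y) [^]\<^bsub>G Mod N\<^esub> k"
    by (rule M.pow_mult_distrib[OF c]) (use h.hom_closed x y in auto)
  also have "\<dots> = (N #> (x [^] k)) \<otimes>\<^bsub>G Mod N\<^esub> (N #> (y [^] k))"
    using h.hom_nat_pow[OF x] h.hom_nat_pow[OF y] by (simp del: mult_FactGroup)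
  also have "\<dots> = \<one>\<^bsub>G Mod N\<^esub>"
    using ker[of "x [^] k"] ker[of "y [^] k"] assms by (simp del: mult_FactGroup one_FactGroup)
  finally show ?thesis using ker[of "(x \<otimes> y) [^] k"] x y by (simp del: one_FactGroup)
qed

lemma (in group) conj_pow:
  assumes "t \<in> carrier G" "x \<in> carrier G"
  shows "(t \<otimes> x \<otimes> inv t) [^] (k::nat) = t \<otimes> x [^] k \<otimes> inv t"
proof (induction k)
  case (Suc k)
  then show ?case using assms by (simp add: m_assoc cancel_inv_left)
qed (use assms in simp)

text \<open>In \<open>G/N\<close> the commutator \<open>c\<close> commutes with \<open>y\<close>, hence \<open>c\<^sup>b = [x,y\<^sup>b] = 1\<close> there. Together
  with \<open>c\<^sup>a = 1\<close> this leaves only \<open>c = 1\<close> in \<open>G/N\<close>.\<close>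

lemma (in group) coprime_commutator_mem:
  assumes N: "N \<lhd> G" and xy: "x \<in> carrier G" "y \<in> carrier G"
    and c: "c = x \<otimes> y \<otimes> inv x \<otimes> inv y" and cy: "y \<otimes> c \<otimes> inv y \<otimes> inv c \<in> N"
    and "c [^] (a::nat) = \<one>" "y [^] (b::nat) = \<one>" and ab: "coprime a b"
  shows "c \<in> N"
proof -
  interpret N: normal N G by (rule N)
  interpret M: group "G Mod N" by (rule N.factorgroup_is_group)
  interpret h: group_hom G "G Mod N" "(#>) N"
    by (unfold_locales) (rule N.r_coset_hom_Mod)
  have ker: "z \<in> N \<longleftrightarrow> N #> z = \<one>\<^bsub>G Mod N\<^esub>" if "z \<in> carrier G" for z
    using that coset_join1[OF _ that N.is_subgroup] coset_join2[OF that N.is_subgroup] N.subset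
    by auto
  note [simp del] = mult_FactGroup one_FactGroup
  have cG: "c \<in> carrier G" using c xy by simp
  let ?x = "N #> x" and ?y = "N #> y" and ?c = "N #> c"
  note cl = h.hom_closed[OF xy(1)] h.hom_closed[OF xy(2)] h.hom_closed[OF cG]
  have c': "?c = ?x \<otimes>\<^bsub>G Mod N\<^esub> ?y \<otimes>\<^bsub>G Mod N\<^esub> inv\<^bsub>G Mod N\<^esub> ?x \<otimes>\<^bsub>G Mod N\<^esub> inv\<^bsub>G Mod N\<^esub> ?y"
    unfolding c using xy by (simp add: h.hom_mult h.hom_inv)
  have "?c \<otimes>\<^bsub>G Mod N\<^esub> ?y = ?y \<otimes>\<^bsub>G Mod N\<^esub> ?c"
  proof -
    have "y \<otimes> c = (y \<otimes> c \<otimes> inv y \<otimes> inv c) \<otimes> (c \<otimes> y)" using xy cG by (simp add: group_normalize)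
    then have "N #> (y \<otimes> c) = (N #> (y \<otimes> c \<otimes> inv y \<otimes> inv c)) \<otimes>\<^bsub>G Mod N\<^esub> (N #> (c \<otimes> y))"
      using h.hom_mult[of "y \<otimes> c \<otimes> inv y \<otimes> inv c" "c \<otimes> y"] xy cG by simp
    also have "\<dots> = N #> (c \<otimes> y)"
      using ker[of "y \<otimes> c \<otimes> inv y \<otimes> inv c"] cy xy cG M.l_one[OF h.hom_closed[of "c \<otimes> y"]] by simp
    finally show ?thesis using h.hom_mult[OF xy(2) cG] h.hom_mult[OF cG xy(2)] by simp
  qed
  then have "?c [^]\<^bsub>G Mod N\<^esub> b = ?x \<otimes>\<^bsub>G Mod N\<^esub> ?y [^]\<^bsub>G Mod N\<^esub> b \<otimes>\<^bsub>G Mod N\<^esub> inv\<^bsub>G Mod N\<^esub> ?x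
      \<otimes>\<^bsub>G Mod N\<^esub> inv\<^bsub>G Mod N\<^esub> (?y [^]\<^bsub>G Mod N\<^esub> b)"
    using M.commutator_power[OF cl(1,2) c'] by blast
  also have "?y [^]\<^bsub>G Mod N\<^esub> b = \<one>\<^bsub>G Mod N\<^esub>"
    using h.hom_nat_pow[OF xy(2), of b] assms(7) h.hom_one by simp
  finally have "?c [^]\<^bsub>G Mod N\<^esub> b = \<one>\<^bsub>G Mod N\<^esub>" using cl by simp
  moreover have "?c [^]\<^bsub>G Mod N\<^esub> a = \<one>\<^bsub>G Mod N\<^esub>"
    using h.hom_nat_pow[OF cG, of a] assms(6) h.hom_one by simp
  ultimately have "?c = \<one>\<^bsub>G Mod N\<^esub>" using M.coprime_exponents_trivial[OF cl(3)] ab by blast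
  then show ?thesis using ker[OF cG] by simp
qed

section \<open>Elementary abelian groups and internal semidirect products\<close>

lemma group_elementary_abelian [simp]: "group (elementary_abelian p r)"
  unfolding elementary_abelian_def by simp

lemma card_elementary_abelian:
  assumes "p > 0" shows "card (carrier (elementary_abelian p r)) = p ^ r"
  using assms unfolding elementary_abelian_def
  by (simp add: carrier_integer_mod_group card_PiE)

lemma (in group) int_pow_mod_exponent:
  assumes "x \<in> carrier G" "x [^] (p::nat) = \<one>"
  shows "x [^] (k mod int p) = x [^] (k::int)"
proof -
  have "x [^] (int p * (k div int p)) = \<one>"
    using assms by (simp add: int_pow_int flip: int_pow_pow)
  then have "x [^] (int p * (k div int p) + k mod int p) = x [^] (k mod int p)"
    using assms by (simp only: int_pow_mult[OF assms(1)]) simp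
  then show ?thesis by simp
qed

text \<open>A linearly independent family is extended by an element \<open>x\<close> outside its span \<open>H\<close>. The new
  family is independent: if \<open>x\<^sup>k \<in> H\<close> with \<open>0 < k < p\<close>, then \<open>k\<close> is invertible modulo \<open>p\<close>, so \<open>x \<in> H\<close>.\<close>

lemma (in comm_group) elementary_abelian_embedding_extends:
  assumes p: "prime p" and exponent: "\<And>x. x \<in> carrier G \<Longrightarrow> x [^] p = \<one>"
    and f: "f \<in> hom (elementary_abelian p r) G"
    and inj: "inj_on f (carrier (elementary_abelian p r))"
    and not_onto: "f ` carrier (elementary_abelian p r) \<noteq> carrier G"
  shows "\<exists>g \<in> hom (elementary_abelian p (Suc r)) G. inj_on g (carrier (elementary_abelian p (Suc r)))"
proof -
  have p0: "p > 0" using p prime_gt_0_nat by auto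
  interpret f: group_hom "elementary_abelian p r" G f
    by (intro group_hom.intro group_hom_axioms.intro group_elementary_abelian group_axioms f)
  define H where "H = f ` carrier (elementary_abelian p r)"
  have H: "subgroup H G" unfolding H_def by (rule f.img_is_subgroup)
  obtain x where x: "x \<in> carrier G" "x \<notin> H"
    using subgroup.subset[OF H] not_onto unfolding H_def by auto
  have xk: "k = 0" if "x [^] k \<in> H" "0 \<le> k" "k < int p" for k :: int
  proof (rule ccontr)
    assume "k \<noteq> 0"
    then have "\<not> int p dvd k" using that zdvd_not_zless by auto
    then have "coprime (int p) k" using p by (simp add: prime_imp_coprime)
    then obtain u v where uv: "u * int p + v * k = 1"
      using bezout_int by (metis coprime_imp_gcd_eq_1)
    have "x = x [^] (u * int p + v * k)" unfolding uv using x by simp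
    also have "\<dots> = (x [^] int p) [^] u \<otimes> (x [^] k) [^] v"
      using x by (simp only: int_pow_mult int_pow_pow mult.commute)
    also have "x [^] int p = \<one>" using exponent x by (simp add: int_pow_int)
    finally have "x = (x [^] k) [^] v" using x by simp
    with that(1) have "x \<in> H" using subgroup_int_pow_closed[OF H] by metis
    with x show False by simp
  qed
  define g where "g = (\<lambda>v :: nat \<Rightarrow> int. f (restrict v {..<r}) \<otimes> x [^] v r)"
  have res: "restrict v {..<r} \<in> carrier (elementary_abelian p r)"
    if "v \<in> carrier (elementary_abelian p (Suc r))" for v
    using that unfolding elementary_abelian_def by (auto simp: PiE_iff)
  have "g \<in> hom (elementary_abelian p (Suc r)) G"
  proof (rule homI)
    fix v w assume v: "v \<in> carrier (elementary_abelian p (Suc r))"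
      and w: "w \<in> carrier (elementary_abelian p (Suc r))"
    have 1: "restrict (v \<otimes>\<^bsub>elementary_abelian p (Suc r)\<^esub> w) {..<r} =
        restrict v {..<r} \<otimes>\<^bsub>elementary_abelian p r\<^esub> restrict w {..<r}"
      unfolding elementary_abelian_def by auto
    have 2: "(v \<otimes>\<^bsub>elementary_abelian p (Suc r)\<^esub> w) r = (v r + w r) mod int p"
      unfolding elementary_abelian_def by auto
    have 3: "x [^] ((v r + w r) mod int p) = x [^] v r \<otimes> x [^] w r"
      using int_pow_mod_exponent[OF x(1) exponent[OF x(1)]] int_pow_mult[OF x(1)] by simp
    show "g (v \<otimes>\<^bsub>elementary_abelian p (Suc r)\<^esub> w) = g v \<otimes> g w"
      unfolding g_def 1 2 3 f.hom_mult[OF res[OF v] res[OF w]]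
      using f.hom_closed[OF res[OF v]] f.hom_closed[OF res[OF w]] x(1)
      by (simp add: m_ac)
  next
    fix v assume v: "v \<in> carrier (elementary_abelian p (Suc r))"
    show "g v \<in> carrier G"
      unfolding g_def using f.hom_closed[OF res[OF v]] x(1) by simp
  qed
  then interpret g: group_hom "elementary_abelian p (Suc r)" G g
    by (intro group_hom.intro group_hom_axioms.intro group_elementary_abelian group_axioms)
  have "v = \<one>\<^bsub>elementary_abelian p (Suc r)\<^esub>"
    if v: "v \<in> carrier (elementary_abelian p (Suc r))" and gv: "g v = \<one>" for v
  proof -
    let ?v = "restrict v {..<r}"
    have "f ?v \<in> H" unfolding H_def using res[OF v] by blast
    moreover have "x [^] v r = inv (f ?v)"
      using gv x(1) f.hom_closed[OF res[OF v]] unfolding g_def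
      by (metis int_pow_closed inv_equality inv_inv m_comm)
    ultimately have "x [^] v r \<in> H" using subgroup.m_inv_closed[OF H] by simp
    moreover have "0 \<le> v r" "v r < int p"
      using v p0 unfolding elementary_abelian_def by (auto simp: PiE_iff carrier_integer_mod_group)
    ultimately have vr: "v r = 0" using xk by blast
    then have "f ?v = \<one>" using gv f.hom_closed[OF res[OF v]] unfolding g_def by simp
    then have "?v = \<one>\<^bsub>elementary_abelian p r\<^esub>"
      using inj f.inj_on_one_iff res[OF v] by blast
    then have "v i = 0" if "i < r" for i
      using that unfolding elementary_abelian_def by (simp add: fun_eq_iff) (metis restrict_apply' lessThan_iff)
    with vr have "v i = 0" if "i < Suc r" for i using that by (cases "i = r") auto
    then show ?thesis
      using v unfolding elementary_abelian_def
      by (intro ext) (auto simp: PiE_iff extensional_def)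
  qed
  then have "inj_on g (carrier (elementary_abelian p (Suc r)))"
    using g.inj_on_one_iff by blast
  with g.homh show ?thesis by blast
qed

text \<open>An embedding of maximal rank, which exists because the order bounds the rank, cannot be
  extended and is therefore onto.\<close>

lemma (in comm_group) elementary_abelian_classification:
  assumes p: "prime p" and exponent: "\<And>x. x \<in> carrier G \<Longrightarrow> x [^] p = \<one>"
    and fin: "finite (carrier G)"
  obtains r f where "order G = p ^ r" "f \<in> iso (elementary_abelian p r) G"
proof -
  define embeds where "embeds r \<longleftrightarrow> (\<exists>f \<in> hom (elementary_abelian p r) G.
      inj_on f (carrier (elementary_abelian p r)))" for r
  have p1: "p > 1" using p prime_gt_1_nat by auto
  have bound: "r \<le> order G" if "embeds r" for r
  proof -
    from that obtain f where f: "f \<in> hom (elementary_abelian p r) G"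
      "inj_on f (carrier (elementary_abelian p r))" unfolding embeds_def by auto
    have "p ^ r \<le> card (carrier G)"
      using card_inj_on_le[OF f(2) _ fin] hom_carrier[OF f(1)] card_elementary_abelian[of p r] p1
      by simp
    moreover have "r < p ^ r" by (rule power_gt_expt) (use p1 in simp)
    ultimately show ?thesis unfolding order_def by linarith
  qed
  have "embeds 0"
    unfolding embeds_def
    by (rule bexI[of _ "\<lambda>_. \<one>"]) (auto simp: elementary_abelian_def hom_def)
  then obtain r where r: "embeds r" "\<not> embeds (Suc r)"
    by (metis bound not_less_eq_eq order.refl nat_induct)
  then obtain f where f: "f \<in> hom (elementary_abelian p r) G"
      "inj_on f (carrier (elementary_abelian p r))" unfolding embeds_def by auto
  have "f ` carrier (elementary_abelian p r) = carrier G"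
    using elementary_abelian_embedding_extends[OF p exponent f] r(2) unfolding embeds_def by blast
  with f have iso: "f \<in> iso (elementary_abelian p r) G"
    unfolding iso_def bij_betw_def by auto
  then have "order G = p ^ r"
    using card_elementary_abelian[of p r] p1 bij_betw_same_card unfolding iso_def order_def
    by fastforce
  with iso show thesis by (rule that[rotated])
qed

text \<open>The action is conjugation of \<open>K\<close> by \<open>S\<close>, transported along \<open>\<phi>\<close> and \<open>\<psi>\<close>; its kernel
  consists of the elements of \<open>S\<close> that centralise \<open>K\<close>.\<close>

lemma (in group) internal_semidirect_product:
  assumes E: "group E" and F: "group F"
    and K: "K \<lhd> G" and S: "subgroup S G"
    and \<phi>: "\<phi> \<in> iso E (G\<lparr>carrier := K\<rparr>)" and \<psi>: "\<psi> \<in> iso F (G\<lparr>carrier := S\<rparr>)"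
    and trivial_Int: "K \<inter> S = {\<one>}"
    and KS: "\<And>g. g \<in> carrier G \<Longrightarrow> \<exists>k\<in>K. \<exists>s\<in>S. g = k \<otimes> s"
    and faithful: "\<And>s. s \<in> S \<Longrightarrow> (\<And>k. k \<in> K \<Longrightarrow> s \<otimes> k = k \<otimes> s) \<Longrightarrow> s = \<one>"
  shows "\<exists>\<rho>. faithful_aut_action E F \<rho> \<and> G \<cong> semidirect_product E F \<rho>"
proof -
  interpret E: group E by (rule E)
  interpret F: group F by (rule F)
  interpret K: normal K G by (rule K)
  interpret S: subgroup S G by (rule S)
  have \<phi>_hom: "\<phi> (x \<otimes>\<^bsub>E\<^esub> y) = \<phi> x \<otimes> \<phi> y" if "x \<in> carrier E" "y \<in> carrier E" for x y
    using \<phi> that by (auto simp: iso_def hom_def)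
  have \<psi>_hom: "\<psi> (x \<otimes>\<^bsub>F\<^esub> y) = \<psi> x \<otimes> \<psi> y" if "x \<in> carrier F" "y \<in> carrier F" for x y
    using \<psi> that by (auto simp: iso_def hom_def)
  have \<phi>_bij: "bij_betw \<phi> (carrier E) K" and \<psi>_bij: "bij_betw \<psi> (carrier F) S"
    using \<phi> \<psi> by (auto simp: iso_def)
  have \<phi>K: "\<phi> x \<in> K" if "x \<in> carrier E" for x using \<phi>_bij that by (auto simp: bij_betw_def)
  have \<psi>S: "\<psi> x \<in> S" if "x \<in> carrier F" for x using \<psi>_bij that by (auto simp: bij_betw_def)
  define \<phi>' where "\<phi>' = inv_into (carrier E) \<phi>"
  have \<phi>': "\<phi>' k \<in> carrier E" "\<phi> (\<phi>' k) = k" if "k \<in> K" for k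
    using \<phi>_bij that unfolding \<phi>'_def by (auto simp: bij_betw_def inv_into_into f_inv_into_f)
  have \<phi>_eqI: "x = y" if "\<phi> x = \<phi> y" "x \<in> carrier E" "y \<in> carrier E" for x y
    using \<phi>_bij that by (auto simp: bij_betw_def inj_on_def)
  have \<psi>_eqI: "x = y" if "\<psi> x = \<psi> y" "x \<in> carrier F" "y \<in> carrier F" for x y
    using \<psi>_bij that by (auto simp: bij_betw_def inj_on_def)
  have conjK: "s \<otimes> k \<otimes> inv s \<in> K" if "s \<in> S" "k \<in> K" for s k
    using K.inv_op_closed2 that S.subset by blast
  define \<rho> where "\<rho> = (\<lambda>h. \<lambda>x\<in>carrier E. \<phi>' (\<psi> h \<otimes> \<phi> x \<otimes> inv \<psi> h))"
  have \<rho>: "\<rho> h x \<in> carrier E" "\<phi> (\<rho> h x) = \<psi> h \<otimes> \<phi> x \<otimes> inv \<psi> h"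
    if "h \<in> carrier F" "x \<in> carrier E" for h x
    using \<phi>' conjK \<phi>K \<psi>S that unfolding \<rho>_def by auto
  have cG [simp]: "\<phi> x \<in> carrier G" if "x \<in> carrier E" for x using \<phi>K that K.subset by blast
  have cG' [simp]: "\<psi> x \<in> carrier G" if "x \<in> carrier F" for x using \<psi>S that S.subset by blast
  have \<psi>_one: "\<psi> \<one>\<^bsub>F\<^esub> = \<one>"
    using \<psi>_hom[of "\<one>\<^bsub>F\<^esub>" "\<one>\<^bsub>F\<^esub>"] cG'[of "\<one>\<^bsub>F\<^esub>"] by (simp add: r_cancel_one')
  have inv_cancel: "inv a \<otimes> (a \<otimes> b) = b" if "a \<in> carrier G" "b \<in> carrier G" for a b
    using that by (simp flip: m_assoc)
  have \<rho>_mult: "\<rho> (g \<otimes>\<^bsub>F\<^esub> h) x = \<rho> g (\<rho> h x)"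
    if "g \<in> carrier F" "h \<in> carrier F" "x \<in> carrier E" for g h x
    by (rule \<phi>_eqI) (use that in \<open>simp_all add: \<rho> \<psi>_hom inv_mult_group m_assoc\<close>)
  have \<rho>_one: "\<rho> \<one>\<^bsub>F\<^esub> x = x" if "x \<in> carrier E" for x
    by (rule \<phi>_eqI) (use that in \<open>simp_all add: \<rho> \<psi>_one\<close>)
  have \<rho>_Bij: "\<rho> h \<in> Bij (carrier E)" if h: "h \<in> carrier F" for h
  proof -
    have "bij_betw (\<rho> h) (carrier E) (carrier E)"
      by (rule bij_betwI[of _ _ _ "\<rho> (inv\<^bsub>F\<^esub> h)"])
        (use h in \<open>auto simp: \<rho>_one \<rho> simp flip: \<rho>_mult\<close>)
    then show ?thesis by (auto simp: Bij_def \<rho>_def)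
  qed
  have \<rho>_hom: "\<rho> h \<in> hom E E" if h: "h \<in> carrier F" for h
  proof (rule homI)
    fix x y assume xy: "x \<in> carrier E" "y \<in> carrier E"
    show "\<rho> h (x \<otimes>\<^bsub>E\<^esub> y) = \<rho> h x \<otimes>\<^bsub>E\<^esub> \<rho> h y"
      by (rule \<phi>_eqI) (use h xy in \<open>simp_all add: \<rho> \<phi>_hom m_assoc inv_cancel\<close>)
  qed (use \<rho> h in auto)
  have aut: "\<rho> \<in> hom F (AutoGroup E)"
  proof (rule homI)
    fix g h assume gh: "g \<in> carrier F" "h \<in> carrier F"
    have "\<rho> (g \<otimes>\<^bsub>F\<^esub> h) = compose (carrier E) (\<rho> g) (\<rho> h)"
      using gh \<rho>_mult unfolding compose_def by (auto simp: fun_eq_iff) (simp add: \<rho>_def)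
    then show "\<rho> (g \<otimes>\<^bsub>F\<^esub> h) = \<rho> g \<otimes>\<^bsub>AutoGroup E\<^esub> \<rho> h"
      using gh \<rho>_Bij by (simp add: AutoGroup_def BijGroup_def)
  qed (use \<rho>_Bij \<rho>_hom in \<open>auto simp: AutoGroup_def auto_def\<close>)
  have "inj_on \<rho> (carrier F)"
  proof -
    interpret \<rho>: group_hom F "AutoGroup E" \<rho>
      by (intro group_hom.intro group_hom_axioms.intro F E.AutoGroup aut)
    have "h = \<one>\<^bsub>F\<^esub>" if h: "h \<in> carrier F" and triv: "\<rho> h = \<one>\<^bsub>AutoGroup E\<^esub>" for h
    proof (rule \<psi>_eqI)
      have "\<psi> h = \<one>"
      proof (rule faithful[OF \<psi>S[OF h]])
        fix k assume k: "k \<in> K"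
        have "\<rho> h (\<phi>' k) = \<phi>' k"
          using triv \<phi>'[OF k] by (simp add: AutoGroup_def BijGroup_def)
        then have "\<psi> h \<otimes> k \<otimes> inv \<psi> h = k"
          using \<rho>(2)[OF h \<phi>'(1)[OF k]] \<phi>'(2)[OF k] by simp
        then show "\<psi> h \<otimes> k = k \<otimes> \<psi> h"
          using h k K.subset by (metis cG' inv_solve_right' m_closed subsetD)
      qed
      with \<psi>_one show "\<psi> h = \<psi> \<one>\<^bsub>F\<^esub>" by simp
    qed (use h in auto)
    then show ?thesis using \<rho>.inj_on_one_iff by blast
  qed
  with aut have "faithful_aut_action E F \<rho>" unfolding faithful_aut_action_def by blast
  moreover
  let ?P = "semidirect_product E F \<rho>"
  define \<theta> where "\<theta> = (\<lambda>(x, h). \<phi> x \<otimes> \<psi> h)"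
  have carr: "carrier ?P = carrier E \<times> carrier F" by (simp add: semidirect_product_def)
  have \<theta>_hom: "\<theta> \<in> hom ?P G"
    by (rule homI) (auto simp: \<theta>_def semidirect_product_def \<phi>_hom \<psi>_hom \<rho> m_assoc inv_cancel)
  have inj: "inj_on \<theta> (carrier ?P)"
  proof (rule inj_onI, clarsimp simp: carr \<theta>_def)
    fix x g y h assume xy: "x \<in> carrier E" "y \<in> carrier E" and gh: "g \<in> carrier F" "h \<in> carrier F"
      and eq: "\<phi> x \<otimes> \<psi> g = \<phi> y \<otimes> \<psi> h"
    have "inv \<phi> y \<otimes> \<phi> x = \<psi> h \<otimes> inv \<psi> g"
    proof -
      have "inv \<phi> y \<otimes> (\<phi> x \<otimes> \<psi> g) \<otimes> inv \<psi> g = inv \<phi> y \<otimes> (\<phi> y \<otimes> \<psi> h) \<otimes> inv \<psi> g"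
        using eq by simp
      then show ?thesis using xy gh by (simp add: m_assoc inv_cancel)
    qed
    moreover have "inv \<phi> y \<otimes> \<phi> x \<in> K" using \<phi>K xy by auto
    moreover have "\<psi> h \<otimes> inv \<psi> g \<in> S" using \<psi>S gh by auto
    ultimately have "inv \<phi> y \<otimes> \<phi> x = \<one>" "\<psi> h \<otimes> inv \<psi> g = \<one>" using trivial_Int by auto
    then have "\<phi> x = \<phi> y" "\<psi> g = \<psi> h"
      using xy gh by (metis cG inv_closed inv_equality inv_inv, metis cG' inv_closed inv_equality inv_inv)
    then show "x = y \<and> g = h" using \<phi>_eqI \<psi>_eqI xy gh by blast
  qed
  have surj: "\<theta> ` carrier ?P = carrier G"
  proof
    show "\<theta> ` carrier ?P \<subseteq> carrier G" using \<theta>_hom by (rule hom_carrier)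
    show "carrier G \<subseteq> \<theta> ` carrier ?P"
    proof
      fix g assume "g \<in> carrier G"
      then obtain k s where ks: "k \<in> K" "s \<in> S" "g = k \<otimes> s" using KS by blast
      then obtain x h where "x \<in> carrier E" "h \<in> carrier F" "k = \<phi> x" "s = \<psi> h"
        using \<phi>_bij \<psi>_bij by (auto simp: bij_betw_def)
      with ks show "g \<in> \<theta> ` carrier ?P" by (auto simp: carr \<theta>_def intro!: image_eqI[of _ _ "(x, h)"])
    qed
  qed
  let ?\<eta> = "inv_into (carrier ?P) \<theta>"
  have mult_closed: "u \<otimes>\<^bsub>?P\<^esub> v \<in> carrier ?P" if "u \<in> carrier ?P" "v \<in> carrier ?P" for u v
    using that by (auto simp: semidirect_product_def \<rho>)
  have \<eta>: "?\<eta> g \<in> carrier ?P" "\<theta> (?\<eta> g) = g" if "g \<in> carrier G" for g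
    using that surj by (auto simp: inv_into_into f_inv_into_f)
  have "?\<eta> \<in> iso G ?P"
  proof (rule isoI)
    show "?\<eta> \<in> hom G ?P"
    proof (rule homI)
      fix g h assume gh: "g \<in> carrier G" "h \<in> carrier G"
      have "\<theta> (?\<eta> (g \<otimes> h)) = \<theta> (?\<eta> g \<otimes>\<^bsub>?P\<^esub> ?\<eta> h)"
        using hom_mult[OF \<theta>_hom \<eta>(1)[OF gh(1)] \<eta>(1)[OF gh(2)]] \<eta> gh by simp
      then show "?\<eta> (g \<otimes> h) = ?\<eta> g \<otimes>\<^bsub>?P\<^esub> ?\<eta> h"
        using inj_onD[OF inj] \<eta>(1) gh mult_closed by (meson m_closed)
    qed (use \<eta> in auto)
    show "bij_betw ?\<eta> (carrier G) (carrier ?P)"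
      by (rule bij_betw_inv_into) (use inj surj in \<open>simp add: bij_betw_def\<close>)
  qed
  then have "G \<cong> ?P" by (rule is_isoI)
  ultimately show ?thesis by blast
qed

section \<open>Left translations, automorphisms and displacement groups\<close>

context quandle begin

abbreviation Perm :: "('a \<Rightarrow> 'a) monoid" where "Perm \<equiv> BijGroup (carrier Q)"
abbreviation perm_mult (infixl "\<cdot>" 70) where "g \<cdot> h \<equiv> g \<otimes>\<^bsub>Perm\<^esub> h"
abbreviation perm_inv ("\<iota>") where "\<iota> g \<equiv> inv\<^bsub>Perm\<^esub> g"
abbreviation L where "L a \<equiv> left_mult Q a"
abbreviation D where "D \<equiv> Dis_rel Q (carrier Q \<times> carrier Q)"

lemma group_Perm: "group Perm" by (rule group_BijGroup)

end

sublocale quandle \<subseteq> perm: group "BijGroup (carrier Q)" by (rule group_BijGroup)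

context quandle begin

lemma perm_apply_closed [simp]: "g \<in> carrier Perm \<Longrightarrow> x \<in> carrier Q \<Longrightarrow> g x \<in> carrier Q"
  by (auto simp: BijGroup_def Bij_def bij_betw_def)

lemma perm_mult_apply [simp]:
  "g \<in> carrier Perm \<Longrightarrow> h \<in> carrier Perm \<Longrightarrow> x \<in> carrier Q \<Longrightarrow> (g \<cdot> h) x = g (h x)"
  by (auto simp: BijGroup_def compose_def)

lemma perm_one_apply [simp]: "x \<in> carrier Q \<Longrightarrow> \<one>\<^bsub>Perm\<^esub> x = x"
  by (auto simp: BijGroup_def)

lemma perm_inv_apply [simp]:
  assumes "g \<in> carrier Perm" "x \<in> carrier Q"
  shows "g (\<iota> g x) = x" "\<iota> g (g x) = x"
  using assms perm_mult_apply[of g "\<iota> g" x] perm_mult_apply[of "\<iota> g" g x] by simp_all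

lemma perm_eqI:
  assumes "g \<in> carrier Perm" "h \<in> carrier Perm" "\<And>x. x \<in> carrier Q \<Longrightarrow> g x = h x"
  shows "g = h"
  using assms by (auto simp: BijGroup_def Bij_def intro: extensionalityI)

lemma L_closed [simp]: "a \<in> carrier Q \<Longrightarrow> L a \<in> carrier Perm"
  using bij_left[of a] by (auto simp: BijGroup_def Bij_def left_mult_def cong: bij_betw_cong)

lemma L_apply [simp]: "x \<in> carrier Q \<Longrightarrow> L a x = a \<triangleright> x"
  by (simp add: left_mult_def)

lemma op_closed [simp]: "a \<in> carrier Q \<Longrightarrow> b \<in> carrier Q \<Longrightarrow> a \<triangleright> b \<in> carrier Q"
  using perm_apply_closed[OF L_closed] by fastforce

lemma L_inv_apply [simp]:
  assumes "a \<in> carrier Q" "b \<in> carrier Q"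
  shows "a \<triangleright> \<iota> (L a) b = b" "\<iota> (L a) (a \<triangleright> b) = b"
  using perm_inv_apply[OF L_closed[OF assms(1)] assms(2)] L_apply[of "\<iota> (L a) b" a] L_apply[of b a] assms
  by (metis L_closed perm.inv_closed perm_apply_closed)+

lemma ldiv_eq [simp]:
  assumes "a \<in> carrier Q" "b \<in> carrier Q"
  shows "ldiv Q a b = \<iota> (L a) b"
proof -
  have inj: "inj_on (\<lambda>x. a \<triangleright> x) (carrier Q)" using bij_left[OF assms(1)] by (simp add: bij_betw_def)
  show ?thesis unfolding ldiv_def
    using inv_into_f_f[OF inj, of "\<iota> (L a) b"] assms by simp
qed

definition Aut where
  "Aut = {g \<in> carrier Perm. \<forall>a\<in>carrier Q. \<forall>b\<in>carrier Q. g (a \<triangleright> b) = g a \<triangleright> g b}"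

lemma Aut_closed: "g \<in> Aut \<Longrightarrow> g \<in> carrier Perm" by (simp add: Aut_def)

lemma Aut_op: "g \<in> Aut \<Longrightarrow> a \<in> carrier Q \<Longrightarrow> b \<in> carrier Q \<Longrightarrow> g (a \<triangleright> b) = g a \<triangleright> g b"
  by (simp add: Aut_def)

text \<open>Automorphisms conjugate left translations to left translations. All later normality
  arguments rest on this identity.\<close>

lemma L_Aut: assumes "g \<in> Aut" "a \<in> carrier Q" shows "L (g a) = g \<cdot> L a \<cdot> \<iota> g"
  using assms Aut_closed[OF assms(1)] by (intro perm_eqI) (auto simp: Aut_op)

lemma subgroup_Aut: "subgroup Aut Perm"
proof (rule perm.subgroupI)
  show "Aut \<noteq> {}" by (auto simp: Aut_def intro!: exI[of _ "\<one>\<^bsub>Perm\<^esub>"])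
  fix g assume g: "g \<in> Aut"
  have "\<iota> g (a \<triangleright> b) = \<iota> g a \<triangleright> \<iota> g b" if "a \<in> carrier Q" "b \<in> carrier Q" for a b
  proof -
    have "g (\<iota> g a \<triangleright> \<iota> g b) = a \<triangleright> b"
      using that Aut_op[OF g] Aut_closed[OF g] by simp
    then show ?thesis using that perm_inv_apply(2)[OF Aut_closed[OF g]] Aut_closed[OF g]
      by (metis op_closed perm.inv_closed perm_apply_closed)
  qed
  then show "\<iota> g \<in> Aut" using Aut_closed[OF g] by (simp add: Aut_def)
next
  fix g h assume "g \<in> Aut" "h \<in> Aut"
  then show "g \<cdot> h \<in> Aut" unfolding Aut_def by simp
next
  show "Aut \<subseteq> carrier Perm" unfolding Aut_def by blast
qed

lemma L_in_Aut: "a \<in> carrier Q \<Longrightarrow> L a \<in> Aut"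
  unfolding Aut_def by (clarsimp) (rule left_distrib)

lemma displacements_subset:
  assumes "subgroup H Perm" "\<And>a. a \<in> carrier Q \<Longrightarrow> L a \<in> H" "\<alpha> \<subseteq> carrier Q \<times> carrier Q"
  shows "displacements Q \<alpha> \<subseteq> H"
proof
  fix g assume "g \<in> displacements Q \<alpha>"
  then obtain a b where g: "g = L a \<cdot> \<iota> (L b)" and ab: "(a, b) \<in> \<alpha>"
    by (auto simp: displacements_def)
  with assms(3) have "a \<in> carrier Q" "b \<in> carrier Q" by auto
  then show "g \<in> H"
    unfolding g by (intro subgroup.m_closed[OF assms(1)] subgroup.m_inv_closed[OF assms(1)] assms(2))
qed

lemma Dis_rel_subset:
  assumes "subgroup H Perm" "\<And>a. a \<in> carrier Q \<Longrightarrow> L a \<in> H" "\<alpha> \<subseteq> carrier Q \<times> carrier Q"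
  shows "Dis_rel Q \<alpha> \<subseteq> H"
  unfolding Dis_rel_def by (rule perm.generate_subgroup_incl[OF displacements_subset[OF assms] assms(1)])

lemma displacements_closed:
  "\<alpha> \<subseteq> carrier Q \<times> carrier Q \<Longrightarrow> displacements Q \<alpha> \<subseteq> carrier Perm"
  by (rule displacements_subset[OF perm.subgroup_self]) auto

lemma subgroup_Dis_rel: "\<alpha> \<subseteq> carrier Q \<times> carrier Q \<Longrightarrow> subgroup (Dis_rel Q \<alpha>) Perm"
  unfolding Dis_rel_def by (rule perm.generate_is_subgroup[OF displacements_closed])

lemma subgroup_D: "subgroup D Perm" by (rule subgroup_Dis_rel) simp

lemma D_subset_Aut: "D \<subseteq> Aut"
  by (rule Dis_rel_subset[OF subgroup_Aut L_in_Aut]) auto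

lemma D_closed: "g \<in> D \<Longrightarrow> g \<in> carrier Perm" using D_subset_Aut Aut_closed by blast

text \<open>Being normalised by left translations is stronger than being normal in \<open>D\<close>
  (\<open>L_invariant_normalized\<close>) and is what makes the orbits a congruence. Both conjugations are
  included so that infinite subgroups need no separate treatment.\<close>

definition L_invariant where
  "L_invariant X \<longleftrightarrow> subgroup X Perm \<and> (\<forall>a\<in>carrier Q. \<forall>g\<in>X.
     L a \<cdot> g \<cdot> \<iota> (L a) \<in> X \<and> \<iota> (L a) \<cdot> g \<cdot> L a \<in> X)"

lemma L_invariant_subgroup: "L_invariant X \<Longrightarrow> subgroup X Perm"
  by (simp add: L_invariant_def)

lemma L_invariant_generate:
  assumes S: "S \<subseteq> carrier Perm"
    and conj: "\<And>a g. a \<in> carrier Q \<Longrightarrow> g \<in> S \<Longrightarrow> L a \<cdot> g \<cdot> \<iota> (L a) \<in> S"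
              "\<And>a g. a \<in> carrier Q \<Longrightarrow> g \<in> S \<Longrightarrow> \<iota> (L a) \<cdot> g \<cdot> L a \<in> S"
  shows "L_invariant (generate Perm S)"
proof -
  have sub: "subgroup (generate Perm S) Perm" by (rule perm.generate_is_subgroup[OF S])
  have *: "t \<cdot> g \<cdot> \<iota> t \<in> generate Perm S"
    if t: "t \<in> carrier Perm" and tS: "\<And>g. g \<in> S \<Longrightarrow> t \<cdot> g \<cdot> \<iota> t \<in> S" and g: "g \<in> generate Perm S" for t g
    using g
  proof (induction rule: generate.induct)
    case one
    then show ?case using t generate.one[of Perm S] by simp
  next
    case (incl h)
    then show ?case using tS by (auto intro: generate.incl)
  next
    case (inv h)
    then have "h \<in> carrier Perm" using S by auto
    then have "t \<cdot> \<iota> h \<cdot> \<iota> t = \<iota> (t \<cdot> h \<cdot> \<iota> t)" using t by (simp add: perm.group_normalize)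
    then show ?case using tS inv by (auto intro: generate.inv)
  next
    case (eng h k)
    then have "h \<in> carrier Perm" "k \<in> carrier Perm" using perm.generate_in_carrier[OF S] by auto
    then have "t \<cdot> (h \<cdot> k) \<cdot> \<iota> t = (t \<cdot> h \<cdot> \<iota> t) \<cdot> (t \<cdot> k \<cdot> \<iota> t)"
      using t by (simp add: perm.group_normalize)
    then show ?case using eng by (auto intro: generate.eng)
  qed
  show ?thesis unfolding L_invariant_def
  proof (intro conjI ballI sub)
    fix a g assume a: "a \<in> carrier Q" and g: "g \<in> generate Perm S"
    show "L a \<cdot> g \<cdot> \<iota> (L a) \<in> generate Perm S"
      by (rule *[OF L_closed[OF a] conj(1)[OF a] g])
    have "\<iota> (L a) \<cdot> g \<cdot> \<iota> (\<iota> (L a)) \<in> generate Perm S"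
      by (rule *[OF _ _ g]) (use conj(2)[OF a] a in simp_all)
    then show "\<iota> (L a) \<cdot> g \<cdot> L a \<in> generate Perm S" using a by simp
  qed
qed

text \<open>The normaliser of \<open>X\<close> is a group containing all left translations, hence it contains \<open>D\<close>.\<close>

lemma L_invariant_normalized:
  assumes X: "L_invariant X" and d: "d \<in> D" and g: "g \<in> X"
  shows "d \<cdot> g \<cdot> \<iota> d \<in> X"
proof -
  have XP: "g \<in> carrier Perm" if "g \<in> X" for g
    using that subgroup.subset[OF L_invariant_subgroup[OF X]] by auto
  define H where "H = {h \<in> carrier Perm. \<forall>g\<in>X. h \<cdot> g \<cdot> \<iota> h \<in> X \<and> \<iota> h \<cdot> g \<cdot> h \<in> X}"
  have "subgroup H Perm"
  proof (rule perm.subgroupI)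
    show "H \<noteq> {}" using XP by (auto simp: H_def intro!: exI[of _ "\<one>\<^bsub>Perm\<^esub>"])
  next
    fix h k assume h: "h \<in> H" and k: "k \<in> H"
    have "h \<cdot> k \<cdot> g \<cdot> \<iota> (h \<cdot> k) \<in> X \<and> \<iota> (h \<cdot> k) \<cdot> g \<cdot> (h \<cdot> k) \<in> X" if g: "g \<in> X" for g
    proof -
      have "h \<cdot> k \<cdot> g \<cdot> \<iota> (h \<cdot> k) = h \<cdot> (k \<cdot> g \<cdot> \<iota> k) \<cdot> \<iota> h"
        "\<iota> (h \<cdot> k) \<cdot> g \<cdot> (h \<cdot> k) = \<iota> k \<cdot> (\<iota> h \<cdot> g \<cdot> h) \<cdot> k"
        using h k XP[OF g] by (auto simp: H_def perm.group_normalize)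
      then show ?thesis using h k g by (auto simp: H_def)
    qed
    then show "h \<cdot> k \<in> H" using h k by (auto simp: H_def)
  qed (auto simp: H_def)
  moreover have "L a \<in> H" if "a \<in> carrier Q" for a
    using X that by (auto simp: H_def L_invariant_def)
  ultimately have "D \<subseteq> H" by (intro Dis_rel_subset) auto
  then show ?thesis using d g by (auto simp: H_def)
qed

lemma L_invariant_Dis_rel:
  assumes \<alpha>: "congruence Q \<alpha>"
  shows "L_invariant (Dis_rel Q \<alpha>)"
proof -
  have sub: "\<alpha> \<subseteq> carrier Q \<times> carrier Q" and rfl: "\<And>a. a \<in> carrier Q \<Longrightarrow> (a, a) \<in> \<alpha>"
    using \<alpha> by (auto simp: congruence_def equiv_def refl_on_def)
  show ?thesis unfolding Dis_rel_def
  proof (rule L_invariant_generate[OF displacements_closed[OF sub]])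
    fix a g assume a: "a \<in> carrier Q" and g: "g \<in> displacements Q \<alpha>"
    then obtain b c where bc: "(b, c) \<in> \<alpha>" "g = L b \<cdot> \<iota> (L c)" by (auto simp: displacements_def)
    then have bcQ: "b \<in> carrier Q" "c \<in> carrier Q" using sub by auto
    have "(a \<triangleright> b, a \<triangleright> c) \<in> \<alpha>" and 1: "(ldiv Q a b, ldiv Q a c) \<in> \<alpha>"
      using \<alpha> rfl[OF a] bc(1) by (auto simp: congruence_def)
    moreover have "L a \<cdot> g \<cdot> \<iota> (L a) = L (a \<triangleright> b) \<cdot> \<iota> (L (a \<triangleright> c))"
      using L_Aut[OF L_in_Aut[OF a] bcQ(1)] L_Aut[OF L_in_Aut[OF a] bcQ(2)] a bcQ
      by (simp add: bc perm.group_normalize)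
    ultimately show "L a \<cdot> g \<cdot> \<iota> (L a) \<in> displacements Q \<alpha>" by (auto simp: displacements_def)
    have aut: "\<iota> (L a) \<in> Aut" using subgroup.m_inv_closed[OF subgroup_Aut L_in_Aut[OF a]] .
    have "\<iota> (L a) \<cdot> g \<cdot> L a = L (ldiv Q a b) \<cdot> \<iota> (L (ldiv Q a c))"
      using L_Aut[OF aut bcQ(1)] L_Aut[OF aut bcQ(2)] a bcQ
      by (simp add: bc perm.group_normalize)
    with 1 show "\<iota> (L a) \<cdot> g \<cdot> L a \<in> displacements Q \<alpha>" by (auto simp: displacements_def)
  qed
qed

lemma congruence_one: "congruence Q (one_cong Q)"
  by (auto simp: congruence_def one_cong_def equiv_def refl_on_def sym_def trans_def)

lemma L_invariant_D: "L_invariant D"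
  using L_invariant_Dis_rel[OF congruence_one] by (simp add: one_cong_def)

definition orb_rel where
  "orb_rel X = {(x, y). x \<in> carrier Q \<and> (\<exists>g\<in>X. y = g x)}"

text \<open>For \<open>b = g a\<close> and \<open>d = h c\<close> one has \<open>L\<^sub>b = g L\<^sub>a g\<^sup>-\<^sup>1\<close>, so \<open>b \<triangleright> d\<close> arises from \<open>a \<triangleright> c\<close> by
  \<open>g (L\<^sub>a g\<^sup>-\<^sup>1 h L\<^sub>a\<^sup>-\<^sup>1) \<in> X\<close>, and similarly for left division.\<close>

lemma congruence_orb_rel:
  assumes X: "L_invariant X" and aut: "X \<subseteq> Aut"
  shows "congruence Q (orb_rel X)"
proof -
  interpret X: subgroup X Perm by (rule L_invariant_subgroup[OF X])
  have XP: "g \<in> carrier Perm" if "g \<in> X" for g using that X.subset by auto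
  have "equiv (carrier Q) (orb_rel X)"
  proof (intro equivI)
    show "refl_on (carrier Q) (orb_rel X)"
      by (auto simp: refl_on_def orb_rel_def intro!: bexI[of _ "\<one>\<^bsub>Perm\<^esub>"])
    show "sym (orb_rel X)"
      by (rule symI) (auto simp: orb_rel_def XP intro!: bexI[of _ "\<iota> _"])
    show "trans (orb_rel X)"
    proof (rule transI)
      fix x y z assume "(x, y) \<in> orb_rel X" "(y, z) \<in> orb_rel X"
      then obtain g h where "g \<in> X" "h \<in> X" "y = g x" "z = h y" "x \<in> carrier Q" by (auto simp: orb_rel_def)
      then show "(x, z) \<in> orb_rel X" by (auto simp: orb_rel_def XP intro!: bexI[of _ "h \<cdot> g"])
    qed
  qed (auto simp: orb_rel_def XP)
  moreover have "(a \<triangleright> c, b \<triangleright> d) \<in> orb_rel X \<and> (ldiv Q a c, ldiv Q b d) \<in> orb_rel X"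
    if ab: "(a, b) \<in> orb_rel X" and cd: "(c, d) \<in> orb_rel X" for a b c d
  proof -
    obtain g h where g: "g \<in> X" "b = g a" and h: "h \<in> X" "d = h c"
      and a: "a \<in> carrier Q" and c: "c \<in> carrier Q"
      using ab cd by (auto simp: orb_rel_def)
    have gh: "\<iota> g \<cdot> h \<in> X" using g h by simp
    have P: "g \<in> carrier Perm" "h \<in> carrier Perm" using g h XP by auto
    have Lb: "L b = g \<cdot> L a \<cdot> \<iota> g" using L_Aut aut g a by blast
    have bQ: "b \<in> carrier Q" "d \<in> carrier Q" using g h a c P by auto
    have "b \<triangleright> d = (g \<cdot> (L a \<cdot> (\<iota> g \<cdot> h) \<cdot> \<iota> (L a))) (a \<triangleright> c)"
    proof -
      have "b \<triangleright> d = L b d" using bQ by simp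
      also have "\<dots> = g (a \<triangleright> \<iota> g (h c))" unfolding Lb h using P a c by simp
      finally show ?thesis using P a c by simp
    qed
    moreover have "g \<cdot> (L a \<cdot> (\<iota> g \<cdot> h) \<cdot> \<iota> (L a)) \<in> X"
      using X gh a g by (auto simp: L_invariant_def)
    ultimately have 1: "(a \<triangleright> c, b \<triangleright> d) \<in> orb_rel X" using a c by (auto simp: orb_rel_def)
    have "\<iota> (L b) d = (g \<cdot> (\<iota> (L a) \<cdot> (\<iota> g \<cdot> h) \<cdot> L a)) (\<iota> (L a) c)"
      unfolding Lb h using P a c by (simp add: perm.inv_mult_group)
    moreover have "g \<cdot> (\<iota> (L a) \<cdot> (\<iota> g \<cdot> h) \<cdot> L a) \<in> X"
      using X gh a g by (auto simp: L_invariant_def)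
    ultimately have "(\<iota> (L a) c, \<iota> (L b) d) \<in> orb_rel X" using a c by (auto simp: orb_rel_def)
    with 1 show ?thesis using a c bQ by simp
  qed
  ultimately show ?thesis unfolding congruence_def by blast
qed

definition Dis_kernel where
  "Dis_kernel \<alpha> = {g \<in> D. \<forall>x\<in>carrier Q. (x, g x) \<in> \<alpha>}"

lemma congruenceD:
  assumes "congruence Q \<alpha>"
  shows "\<And>a b. (a, b) \<in> \<alpha> \<Longrightarrow> a \<in> carrier Q" "\<And>a b. (a, b) \<in> \<alpha> \<Longrightarrow> b \<in> carrier Q"
    "\<And>a. a \<in> carrier Q \<Longrightarrow> (a, a) \<in> \<alpha>" "\<And>a b. (a, b) \<in> \<alpha> \<Longrightarrow> (b, a) \<in> \<alpha>"
    "\<And>a b c. (a, b) \<in> \<alpha> \<Longrightarrow> (b, c) \<in> \<alpha> \<Longrightarrow> (a, c) \<in> \<alpha>"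
    "\<And>a b c d. (a, b) \<in> \<alpha> \<Longrightarrow> (c, d) \<in> \<alpha> \<Longrightarrow> (a \<triangleright> c, b \<triangleright> d) \<in> \<alpha>"
    "\<And>a b c d. (a, b) \<in> \<alpha> \<Longrightarrow> (c, d) \<in> \<alpha> \<Longrightarrow> (\<iota> (L a) c, \<iota> (L b) d) \<in> \<alpha>"
proof -
  have eq: "equiv (carrier Q) \<alpha>" using assms by (simp add: congruence_def)
  show Q: "\<And>a b. (a, b) \<in> \<alpha> \<Longrightarrow> a \<in> carrier Q" "\<And>a b. (a, b) \<in> \<alpha> \<Longrightarrow> b \<in> carrier Q"
    using eq by (auto simp: equiv_def)
  show "\<And>a. a \<in> carrier Q \<Longrightarrow> (a, a) \<in> \<alpha>" "\<And>a b. (a, b) \<in> \<alpha> \<Longrightarrow> (b, a) \<in> \<alpha>"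
    "\<And>a b c. (a, b) \<in> \<alpha> \<Longrightarrow> (b, c) \<in> \<alpha> \<Longrightarrow> (a, c) \<in> \<alpha>"
    using eq by (auto simp: equiv_def refl_on_def dest: symD transD)
  show "\<And>a b c d. (a, b) \<in> \<alpha> \<Longrightarrow> (c, d) \<in> \<alpha> \<Longrightarrow> (a \<triangleright> c, b \<triangleright> d) \<in> \<alpha>"
    using assms by (auto simp: congruence_def)
  have "\<And>a b c d. (a, b) \<in> \<alpha> \<Longrightarrow> (c, d) \<in> \<alpha> \<Longrightarrow> (ldiv Q a c, ldiv Q b d) \<in> \<alpha>"
    using assms by (auto simp: congruence_def)
  then show "\<And>a b c d. (a, b) \<in> \<alpha> \<Longrightarrow> (c, d) \<in> \<alpha> \<Longrightarrow> (\<iota> (L a) c, \<iota> (L b) d) \<in> \<alpha>"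
    using Q by (metis ldiv_eq)
qed

lemma L_congruence_iff:
  assumes "congruence Q \<alpha>" "a \<in> carrier Q" "x \<in> carrier Q" "y \<in> carrier Q"
  shows "(a \<triangleright> x, a \<triangleright> y) \<in> \<alpha> \<longleftrightarrow> (x, y) \<in> \<alpha>"
  using congruenceD(3,6,7)[OF assms(1)] assms(2-4)
  by (metis L_inv_apply(2))

definition relation_automorphisms where
  "relation_automorphisms \<alpha> = {g \<in> carrier Perm. \<forall>x\<in>carrier Q. \<forall>y\<in>carrier Q. (g x, g y) \<in> \<alpha> \<longleftrightarrow> (x, y) \<in> \<alpha>}"

lemma subgroup_relation_automorphisms: "subgroup (relation_automorphisms \<alpha>) Perm"
proof (rule perm.subgroupI)
  show "relation_automorphisms \<alpha> \<noteq> {}" by (auto simp: relation_automorphisms_def intro!: exI[of _ "\<one>\<^bsub>Perm\<^esub>"])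
  fix g assume g: "g \<in> relation_automorphisms \<alpha>"
  then have P: "g \<in> carrier Perm"
    and iff: "\<And>x y. x \<in> carrier Q \<Longrightarrow> y \<in> carrier Q \<Longrightarrow> (g x, g y) \<in> \<alpha> \<longleftrightarrow> (x, y) \<in> \<alpha>"
    by (auto simp: relation_automorphisms_def)
  have "(\<iota> g x, \<iota> g y) \<in> \<alpha> \<longleftrightarrow> (x, y) \<in> \<alpha>" if "x \<in> carrier Q" "y \<in> carrier Q" for x y
    using that P iff[of "\<iota> g x" "\<iota> g y"] by simp
  then show "\<iota> g \<in> relation_automorphisms \<alpha>" using g by (auto simp: relation_automorphisms_def)
qed (auto simp: relation_automorphisms_def)

lemma L_in_relation_automorphisms: "congruence Q \<alpha> \<Longrightarrow> a \<in> carrier Q \<Longrightarrow> L a \<in> relation_automorphisms \<alpha>"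
  unfolding relation_automorphisms_def using L_congruence_iff by simp

lemma D_subset_relation_automorphisms: "congruence Q \<alpha> \<Longrightarrow> D \<subseteq> relation_automorphisms \<alpha>"
  by (intro Dis_rel_subset subgroup_relation_automorphisms L_in_relation_automorphisms) auto

lemma L_invariant_Dis_kernel:
  assumes \<alpha>: "congruence Q \<alpha>"
  shows "L_invariant (Dis_kernel \<alpha>)"
proof -
  note c = congruenceD[OF \<alpha>]
  interpret D: subgroup D Perm by (rule subgroup_D)
  have "subgroup (Dis_kernel \<alpha>) Perm"
  proof (rule perm.subgroupI)
    have "\<one>\<^bsub>Perm\<^esub> \<in> Dis_kernel \<alpha>" using D.one_closed c(3) by (simp add: Dis_kernel_def)
    then show "Dis_kernel \<alpha> \<noteq> {}" by blast
  next
    fix g assume g: "g \<in> Dis_kernel \<alpha>"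
    then have gD: "g \<in> D" and P: "g \<in> carrier Perm" using D_closed by (simp_all add: Dis_kernel_def)
    have "(x, \<iota> g x) \<in> \<alpha>" if x: "x \<in> carrier Q" for x
    proof (rule c(4))
      have "(\<iota> g x, g (\<iota> g x)) \<in> \<alpha>" using g P x by (simp add: Dis_kernel_def del: perm_inv_apply)
      then show "(\<iota> g x, x) \<in> \<alpha>" using P x by simp
    qed
    then show "\<iota> g \<in> Dis_kernel \<alpha>" using gD by (simp add: Dis_kernel_def)
  next
    fix g h assume gh: "g \<in> Dis_kernel \<alpha>" "h \<in> Dis_kernel \<alpha>"
    then have ghD: "g \<in> D" "h \<in> D" and P: "g \<in> carrier Perm" "h \<in> carrier Perm"
      using D_closed by (simp_all add: Dis_kernel_def)
    have "(x, (g \<cdot> h) x) \<in> \<alpha>" if x: "x \<in> carrier Q" for x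
    proof -
      have "(x, h x) \<in> \<alpha>" "(h x, g (h x)) \<in> \<alpha>" using gh x P by (simp_all add: Dis_kernel_def)
      then have "(x, g (h x)) \<in> \<alpha>" by (rule c(5))
      then show ?thesis using x P by simp
    qed
    then show "g \<cdot> h \<in> Dis_kernel \<alpha>" using ghD by (simp add: Dis_kernel_def)
  next
    show "Dis_kernel \<alpha> \<subseteq> carrier Perm" using D_closed by (auto simp: Dis_kernel_def)
  qed
  moreover have "L a \<cdot> g \<cdot> \<iota> (L a) \<in> Dis_kernel \<alpha> \<and> \<iota> (L a) \<cdot> g \<cdot> L a \<in> Dis_kernel \<alpha>"
    if a: "a \<in> carrier Q" and g: "g \<in> Dis_kernel \<alpha>" for a g
  proof -
    have gD: "g \<in> D" and gP: "g \<in> carrier Perm" and gx: "\<And>x. x \<in> carrier Q \<Longrightarrow> (x, g x) \<in> \<alpha>"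
      using g D_closed by (auto simp: Dis_kernel_def)
    have "L a \<cdot> g \<cdot> \<iota> (L a) \<in> D" "\<iota> (L a) \<cdot> g \<cdot> L a \<in> D"
      using L_invariant_D a gD by (auto simp: L_invariant_def)
    moreover have "(x, (L a \<cdot> g \<cdot> \<iota> (L a)) x) \<in> \<alpha>" if x: "x \<in> carrier Q" for x
      using c(6)[OF c(3)[OF a] gx[of "\<iota> (L a) x"]] a x gP by simp
    moreover have "(x, (\<iota> (L a) \<cdot> g \<cdot> L a) x) \<in> \<alpha>" if x: "x \<in> carrier Q" for x
      using c(7)[OF c(3)[OF a] gx[of "a \<triangleright> x"]] a x gP by simp
    ultimately show ?thesis by (auto simp: Dis_kernel_def)
  qed
  ultimately show ?thesis by (auto simp: L_invariant_def)
qed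

text \<open>With \<open>y = L\<^sub>b\<^sup>-\<^sup>1 x\<close>, the displacement \<open>L\<^sub>a L\<^sub>b\<^sup>-\<^sup>1\<close> moves \<open>x = b \<triangleright> y\<close> to \<open>a \<triangleright> y\<close>, which is
  related to \<open>x\<close> whenever \<open>a\<close> and \<open>b\<close> are.\<close>

lemma Dis_rel_subset_kernel:
  assumes \<alpha>: "congruence Q \<alpha>"
  shows "Dis_rel Q \<alpha> \<subseteq> Dis_kernel \<alpha>"
proof -
  note c = congruenceD[OF \<alpha>]
  have sub: "\<alpha> \<subseteq> carrier Q \<times> carrier Q" using c(1,2) by auto
  have "displacements Q \<alpha> \<subseteq> Dis_kernel \<alpha>"
  proof
    fix g assume g: "g \<in> displacements Q \<alpha>"
    then obtain a b where ab: "(a, b) \<in> \<alpha>" "g = L a \<cdot> \<iota> (L b)" by (auto simp: displacements_def)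
    then have Q: "a \<in> carrier Q" "b \<in> carrier Q" using c(1,2) by blast+
    have "g \<in> D"
      unfolding Dis_rel_def by (rule generate.incl) (use ab Q in \<open>auto simp: displacements_def\<close>)
    moreover have "(x, g x) \<in> \<alpha>" if x: "x \<in> carrier Q" for x
      using c(6)[OF c(4)[OF ab(1)] c(3)[of "\<iota> (L b) x"]] Q x
      by (simp add: ab)
    ultimately show "g \<in> Dis_kernel \<alpha>" by (auto simp: Dis_kernel_def)
  qed
  then show ?thesis
    unfolding Dis_rel_def
    by (rule perm.generate_subgroup_incl) (rule L_invariant_subgroup[OF L_invariant_Dis_kernel[OF \<alpha>]])
qed

end

section \<open>Abelian factors\<close>

context quandle begin

text \<open>The permutation of the blocks induced by \<open>g\<close>. For a bijection that preserves \<open>\<alpha>\<close> in both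
  directions the image of a block is already a block; taking its closure under \<open>\<alpha>\<close> spares the proof
  of that.\<close>

definition factor_perm where
  "factor_perm \<alpha> g = (\<lambda>X\<in>carrier Q // \<alpha>. \<alpha> `` (g ` X))"

lemma factor_perm_apply:
  assumes \<alpha>: "congruence Q \<alpha>" and g: "g \<in> relation_automorphisms \<alpha>" and x: "x \<in> carrier Q"
  shows "factor_perm \<alpha> g (\<alpha> `` {x}) = \<alpha> `` {g x}"
proof -
  note c = congruenceD[OF \<alpha>]
  have "\<alpha> `` (g ` (\<alpha> `` {x})) = \<alpha> `` {g x}"
  proof (intro equalityI subsetI)
    fix y assume "y \<in> \<alpha> `` (g ` (\<alpha> `` {x}))"
    then obtain z where z: "(x, z) \<in> \<alpha>" "(g z, y) \<in> \<alpha>" by auto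
    then have "(g x, g z) \<in> \<alpha>" using g x c(2) unfolding relation_automorphisms_def by blast
    then show "y \<in> \<alpha> `` {g x}" using c(5) z by blast
  next
    fix y assume "y \<in> \<alpha> `` {g x}"
    then show "y \<in> \<alpha> `` (g ` (\<alpha> `` {x}))" using c(3)[OF x] by auto
  qed
  then show ?thesis using x by (simp add: factor_perm_def quotientI)
qed

lemma class_eq_iff:
  assumes \<alpha>: "congruence Q \<alpha>" and "x \<in> carrier Q" "y \<in> carrier Q"
  shows "\<alpha> `` {x} = \<alpha> `` {y} \<longleftrightarrow> (x, y) \<in> \<alpha>"
proof -
  have "equiv (carrier Q) \<alpha>" using \<alpha> by (simp add: congruence_def)
  then show ?thesis using assms(2,3) by (rule eq_equiv_class_iff)
qed

lemma factor_perm_Bij: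
  assumes \<alpha>: "congruence Q \<alpha>" and g: "g \<in> relation_automorphisms \<alpha>"
  shows "factor_perm \<alpha> g \<in> Bij (carrier Q // \<alpha>)"
proof -
  have gi: "\<iota> g \<in> relation_automorphisms \<alpha>" using g subgroup.m_inv_closed[OF subgroup_relation_automorphisms] by blast
  have P: "g \<in> carrier Perm" using g by (simp add: relation_automorphisms_def)
  have "bij_betw (factor_perm \<alpha> g) (carrier Q // \<alpha>) (carrier Q // \<alpha>)"
  proof (rule bij_betwI[of _ _ _ "factor_perm \<alpha> (\<iota> g)"])
    show "factor_perm \<alpha> g \<in> carrier Q // \<alpha> \<rightarrow> carrier Q // \<alpha>"
      using factor_perm_apply[OF \<alpha> g] P by (auto elim!: quotientE intro!: quotientI)
    show "factor_perm \<alpha> (\<iota> g) \<in> carrier Q // \<alpha> \<rightarrow> carrier Q // \<alpha>"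
      using factor_perm_apply[OF \<alpha> gi] P by (auto elim!: quotientE intro!: quotientI)
    show "factor_perm \<alpha> (\<iota> g) (factor_perm \<alpha> g X) = X" if "X \<in> carrier Q // \<alpha>" for X
      using that P factor_perm_apply[OF \<alpha> g] factor_perm_apply[OF \<alpha> gi] by (auto elim!: quotientE)
    show "factor_perm \<alpha> g (factor_perm \<alpha> (\<iota> g) X) = X" if "X \<in> carrier Q // \<alpha>" for X
      using that P factor_perm_apply[OF \<alpha> g] factor_perm_apply[OF \<alpha> gi] by (auto elim!: quotientE)
  qed
  then show ?thesis by (simp add: Bij_def factor_perm_def)
qed

lemma factor_perm_group_hom:
  assumes \<alpha>: "congruence Q \<alpha>"
  shows "group_hom (Perm\<lparr>carrier := relation_automorphisms \<alpha>\<rparr>) (BijGroup (carrier Q // \<alpha>)) (factor_perm \<alpha>)"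
proof (intro group_hom.intro group_hom_axioms.intro group_BijGroup
    perm.subgroup_imp_group[OF subgroup_relation_automorphisms] homI)
  fix g assume "g \<in> carrier (Perm\<lparr>carrier := relation_automorphisms \<alpha>\<rparr>)"
  then show "factor_perm \<alpha> g \<in> carrier (BijGroup (carrier Q // \<alpha>))"
    using factor_perm_Bij[OF \<alpha>] by (simp add: BijGroup_def)
next
  fix g h assume "g \<in> carrier (Perm\<lparr>carrier := relation_automorphisms \<alpha>\<rparr>)" "h \<in> carrier (Perm\<lparr>carrier := relation_automorphisms \<alpha>\<rparr>)"
  then have gh: "g \<in> relation_automorphisms \<alpha>" "h \<in> relation_automorphisms \<alpha>" by auto
  then have P: "g \<in> carrier Perm" "h \<in> carrier Perm" by (auto simp: relation_automorphisms_def)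
  have gh': "g \<cdot> h \<in> relation_automorphisms \<alpha>" using gh subgroup.m_closed[OF subgroup_relation_automorphisms] by blast
  have "factor_perm \<alpha> (g \<cdot> h) = compose (carrier Q // \<alpha>) (factor_perm \<alpha> g) (factor_perm \<alpha> h)"
  proof (rule extensionalityI)
    fix X assume "X \<in> carrier Q // \<alpha>"
    then obtain x where x: "x \<in> carrier Q" "X = \<alpha> `` {x}" by (auto elim: quotientE)
    then show "factor_perm \<alpha> (g \<cdot> h) X = compose (carrier Q // \<alpha>) (factor_perm \<alpha> g) (factor_perm \<alpha> h) X"
      using P factor_perm_apply[OF \<alpha>] gh gh' by (simp add: compose_eq quotientI)
  qed (auto simp: factor_perm_def compose_def)
  then show "factor_perm \<alpha> (g \<otimes>\<^bsub>Perm\<lparr>carrier := relation_automorphisms \<alpha>\<rparr>\<^esub> h) =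
      factor_perm \<alpha> g \<otimes>\<^bsub>BijGroup (carrier Q // \<alpha>)\<^esub> factor_perm \<alpha> h"
    using factor_perm_Bij[OF \<alpha>] gh by (simp add: BijGroup_def)
qed

lemma carrier_factor: "carrier (factor Q \<alpha>) = carrier Q // \<alpha>"
  by (simp add: factor_def)

lemma left_mult_factor:
  assumes \<alpha>: "congruence Q \<alpha>" and a: "a \<in> carrier Q"
  shows "left_mult (factor Q \<alpha>) (\<alpha> `` {a}) = factor_perm \<alpha> (L a)"
proof (rule extensionalityI[of _ "carrier Q // \<alpha>"])
  note c = congruenceD[OF \<alpha>]
  fix X assume "X \<in> carrier Q // \<alpha>"
  then obtain x where x: "x \<in> carrier Q" "X = \<alpha> `` {x}" by (auto elim: quotientE)
  have "(\<Union>b\<in>\<alpha> `` {a}. \<Union>d\<in>\<alpha> `` {x}. \<alpha> `` {b \<triangleright> d}) = \<alpha> `` {a \<triangleright> x}"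
  proof (intro equalityI subsetI)
    fix y assume "y \<in> (\<Union>b\<in>\<alpha> `` {a}. \<Union>d\<in>\<alpha> `` {x}. \<alpha> `` {b \<triangleright> d})"
    then obtain b d where bd: "(a, b) \<in> \<alpha>" "(x, d) \<in> \<alpha>" and y: "(b \<triangleright> d, y) \<in> \<alpha>" by auto
    from c(5)[OF c(6)[OF bd] y] show "y \<in> \<alpha> `` {a \<triangleright> x}" by simp
  next
    fix y assume "y \<in> \<alpha> `` {a \<triangleright> x}"
    then show "y \<in> (\<Union>b\<in>\<alpha> `` {a}. \<Union>d\<in>\<alpha> `` {x}. \<alpha> `` {b \<triangleright> d})"
      using c(3)[OF a] c(3)[OF x(1)] by blast
  qed
  then show "left_mult (factor Q \<alpha>) (\<alpha> `` {a}) X = factor_perm \<alpha> (L a) X"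
    using factor_perm_apply[OF \<alpha> L_in_relation_automorphisms[OF \<alpha> a] x(1)] x
    by (simp add: left_mult_def factor_def quotientI)
qed (auto simp: left_mult_def factor_perm_def factor_def)

text \<open>Inducing permutations on blocks is a homomorphism that takes \<open>L\<^sub>a\<close> to the left translation by
  the block of \<open>a\<close>, so it takes generators to generators.\<close>

lemma Dis_factor:
  assumes \<alpha>: "congruence Q \<alpha>"
  shows "Dis_rel (factor Q \<alpha>) (carrier (factor Q \<alpha>) \<times> carrier (factor Q \<alpha>)) = factor_perm \<alpha> ` D"
proof -
  let ?F = "factor Q \<alpha>" and ?B = "BijGroup (carrier Q // \<alpha>)" and ?C = "Perm\<lparr>carrier := relation_automorphisms \<alpha>\<rparr>"
  interpret h: group_hom ?C ?B "factor_perm \<alpha>"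
    by (rule factor_perm_group_hom[OF \<alpha>])
  let ?S = "displacements Q (carrier Q \<times> carrier Q)"
  have S: "?S \<subseteq> relation_automorphisms \<alpha>"
    by (rule displacements_subset[OF subgroup_relation_automorphisms L_in_relation_automorphisms[OF \<alpha>]]) auto
  have inv: "inv\<^bsub>?C\<^esub> g = \<iota> g" if "g \<in> relation_automorphisms \<alpha>" for g
    using perm.m_inv_consistent[OF subgroup_relation_automorphisms that] .
  have disp: "factor_perm \<alpha> (L a \<cdot> \<iota> (L b)) =
      left_mult ?F (\<alpha> `` {a}) \<otimes>\<^bsub>?B\<^esub> inv\<^bsub>?B\<^esub> left_mult ?F (\<alpha> `` {b})"
    if ab: "a \<in> carrier Q" "b \<in> carrier Q" for a b
  proof -
    note LC = L_in_relation_automorphisms[OF \<alpha> ab(1)] L_in_relation_automorphisms[OF \<alpha> ab(2)]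
    have "factor_perm \<alpha> (L a \<otimes>\<^bsub>?C\<^esub> inv\<^bsub>?C\<^esub> L b) =
        factor_perm \<alpha> (L a) \<otimes>\<^bsub>?B\<^esub> factor_perm \<alpha> (inv\<^bsub>?C\<^esub> L b)"
      by (rule h.hom_mult) (use LC inv subgroup.m_inv_closed[OF subgroup_relation_automorphisms] in auto)
    also have "factor_perm \<alpha> (inv\<^bsub>?C\<^esub> L b) = inv\<^bsub>?B\<^esub> factor_perm \<alpha> (L b)"
      by (rule h.hom_inv) (use LC in auto)
    finally show ?thesis using ab LC inv by (simp add: left_mult_factor[OF \<alpha>])
  qed
  have "displacements ?F (carrier ?F \<times> carrier ?F) = factor_perm \<alpha> ` ?S"
  proof (intro equalityI subsetI)
    fix t assume "t \<in> displacements ?F (carrier ?F \<times> carrier ?F)"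
    then obtain X Y where XY: "X \<in> carrier Q // \<alpha>" "Y \<in> carrier Q // \<alpha>"
      and t: "t = left_mult ?F X \<otimes>\<^bsub>?B\<^esub> inv\<^bsub>?B\<^esub> left_mult ?F Y"
      by (auto simp: displacements_def carrier_factor)
    from XY obtain a b where ab: "a \<in> carrier Q" "b \<in> carrier Q" "X = \<alpha> `` {a}" "Y = \<alpha> `` {b}"
      by (auto elim!: quotientE)
    have "t = factor_perm \<alpha> (L a \<cdot> \<iota> (L b))" using disp[OF ab(1,2)] t ab by simp
    moreover have "L a \<cdot> \<iota> (L b) \<in> ?S" using ab unfolding displacements_def by blast
    ultimately show "t \<in> factor_perm \<alpha> ` ?S" by blast
  next
    fix t assume "t \<in> factor_perm \<alpha> ` ?S"
    then obtain a b where ab: "a \<in> carrier Q" "b \<in> carrier Q" and t: "t = factor_perm \<alpha> (L a \<cdot> \<iota> (L b))"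
      unfolding displacements_def by blast
    have "(\<alpha> `` {a}, \<alpha> `` {b}) \<in> carrier ?F \<times> carrier ?F"
      unfolding carrier_factor by (intro SigmaI quotientI ab)
    then show "t \<in> displacements ?F (carrier ?F \<times> carrier ?F)"
      unfolding displacements_def mem_Collect_eq
      using t[unfolded disp[OF ab]] by (intro exI[of _ "\<alpha> `` {a}"] exI[of _ "\<alpha> `` {b}"]) (simp add: carrier_factor)
  qed
  then have "Dis_rel ?F (carrier ?F \<times> carrier ?F) = generate ?B (factor_perm \<alpha> ` ?S)"
    unfolding Dis_rel_def by (simp add: carrier_factor)
  also have "\<dots> = factor_perm \<alpha> ` generate ?C ?S"
    by (rule h.generate_img) (use S in simp)
  also have "generate ?C ?S = D"
    unfolding Dis_rel_def by (rule perm.generate_consistent[OF S subgroup_relation_automorphisms])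
  finally show ?thesis .
qed

lemma factor_perm_eq_iff:
  assumes \<alpha>: "congruence Q \<alpha>" and g: "g \<in> relation_automorphisms \<alpha>" and h: "h \<in> relation_automorphisms \<alpha>"
  shows "factor_perm \<alpha> g = factor_perm \<alpha> h \<longleftrightarrow> (\<forall>x\<in>carrier Q. (g x, h x) \<in> \<alpha>)"
proof
  have P: "g \<in> carrier Perm" "h \<in> carrier Perm" using g h by (auto simp: relation_automorphisms_def)
  {
    assume eq: "factor_perm \<alpha> g = factor_perm \<alpha> h"
    show "\<forall>x\<in>carrier Q. (g x, h x) \<in> \<alpha>"
    proof
      fix x assume x: "x \<in> carrier Q"
      have "\<alpha> `` {g x} = \<alpha> `` {h x}"
        using factor_perm_apply[OF \<alpha> g x] factor_perm_apply[OF \<alpha> h x] eq by simp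
      then show "(g x, h x) \<in> \<alpha>" using class_eq_iff[OF \<alpha>] x P by simp
    qed
  next
    assume eq: "\<forall>x\<in>carrier Q. (g x, h x) \<in> \<alpha>"
    show "factor_perm \<alpha> g = factor_perm \<alpha> h"
    proof (rule extensionalityI[of _ "carrier Q // \<alpha>"])
      fix X assume "X \<in> carrier Q // \<alpha>"
      then obtain x where x: "x \<in> carrier Q" "X = \<alpha> `` {x}" by (auto elim: quotientE)
      then have "\<alpha> `` {g x} = \<alpha> `` {h x}" using class_eq_iff[OF \<alpha>] eq P by simp
      then show "factor_perm \<alpha> g X = factor_perm \<alpha> h X"
        using factor_perm_apply[OF \<alpha> g x(1)] factor_perm_apply[OF \<alpha> h x(1)] x by simp
    qed (auto simp: factor_perm_def)
  }
qed

text \<open>This reads off abelianness of a factor inside \<open>D\<close>. It is applied to all three congruences of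
  the quandles considered below.\<close>

lemma abelian_factor_iff:
  assumes \<alpha>: "congruence Q \<alpha>"
  shows "abelian_quandle (factor Q \<alpha>) \<longleftrightarrow>
     (\<forall>g\<in>D. \<forall>h\<in>D. \<forall>x\<in>carrier Q. ((g \<cdot> h) x, (h \<cdot> g) x) \<in> \<alpha>) \<and>
     (\<forall>g\<in>D. \<forall>x\<in>carrier Q. (x, g x) \<in> \<alpha> \<longrightarrow> g \<in> Dis_kernel \<alpha>)"
proof -
  let ?F = "factor Q \<alpha>" and ?B = "BijGroup (carrier Q // \<alpha>)" and ?C = "Perm\<lparr>carrier := relation_automorphisms \<alpha>\<rparr>"
  let ?f = "factor_perm \<alpha>"
  interpret h: group_hom ?C ?B ?f
    by (rule factor_perm_group_hom[OF \<alpha>])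
  interpret C: subgroup "relation_automorphisms \<alpha>" Perm by (rule subgroup_relation_automorphisms)
  note c = congruenceD[OF \<alpha>]
  have DC: "g \<in> relation_automorphisms \<alpha>" if "g \<in> D" for g using that D_subset_relation_automorphisms[OF \<alpha>] by blast
  have carrier_DF: "carrier (Dis ?F) = ?f ` D"
    unfolding Dis_def by (simp add: Dis_factor[OF \<alpha>])
  have DC_sub: "subgroup D ?C"
    by (rule perm.subgroup_incl[OF subgroup_D subgroup_relation_automorphisms D_subset_relation_automorphisms[OF \<alpha>]])
  have DF: "Dis ?F = ?B\<lparr>carrier := ?f ` D\<rparr>"
    unfolding Dis_def Dis_factor[OF \<alpha>] by (simp add: carrier_factor)
  have "group (Dis ?F)"
    unfolding DF by (rule h.H.subgroup_imp_group[OF h.subgroup_img_is_subgroup[OF DC_sub]])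
  have fmult: "?f g \<otimes>\<^bsub>Dis ?F\<^esub> ?f h = ?f (g \<cdot> h)" if "g \<in> D" "h \<in> D" for g h
    using h.hom_mult[of g h] DC that by (simp add: DF)
  have mem: "g \<cdot> h \<in> D" if "g \<in> D" "h \<in> D" for g h
    using that subgroup.m_closed[OF subgroup_D] by blast
  have comm: "comm_group (Dis ?F) \<longleftrightarrow>
      (\<forall>g\<in>D. \<forall>h\<in>D. \<forall>x\<in>carrier Q. ((g \<cdot> h) x, (h \<cdot> g) x) \<in> \<alpha>)"
  proof -
    have "comm_group (Dis ?F) \<longleftrightarrow> (\<forall>g\<in>D. \<forall>h\<in>D. ?f (g \<cdot> h) = ?f (h \<cdot> g))"
    proof
      assume "comm_group (Dis ?F)"
      then interpret comm_group "Dis ?F" .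
      show "\<forall>g\<in>D. \<forall>h\<in>D. ?f (g \<cdot> h) = ?f (h \<cdot> g)"
        using m_comm fmult carrier_DF by (metis imageI)
    next
      assume *: "\<forall>g\<in>D. \<forall>h\<in>D. ?f (g \<cdot> h) = ?f (h \<cdot> g)"
      show "comm_group (Dis ?F)"
        by (rule group.group_comm_groupI[OF \<open>group (Dis ?F)\<close>]) (use * fmult carrier_DF in auto)
    qed
    also have "\<dots> \<longleftrightarrow> (\<forall>g\<in>D. \<forall>h\<in>D. \<forall>x\<in>carrier Q. ((g \<cdot> h) x, (h \<cdot> g) x) \<in> \<alpha>)"
      using factor_perm_eq_iff[OF \<alpha> DC DC] mem by blast
    finally show ?thesis .
  qed
  have one: "\<one>\<^bsub>Dis ?F\<^esub> = ?f \<one>\<^bsub>Perm\<^esub>"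
    using h.hom_one by (simp add: DF)
  have f_one: "?f g = \<one>\<^bsub>Dis ?F\<^esub> \<longleftrightarrow> g \<in> Dis_kernel \<alpha>" if g: "g \<in> D" for g
  proof -
    have "?f g = ?f \<one>\<^bsub>Perm\<^esub> \<longleftrightarrow> (\<forall>x\<in>carrier Q. (g x, x) \<in> \<alpha>)"
      using factor_perm_eq_iff[OF \<alpha> DC[OF g] C.one_closed] by simp
    then show ?thesis using g c(4) unfolding one Dis_kernel_def by blast
  qed
  have one_in: "\<one>\<^bsub>Dis ?F\<^esub> \<in> carrier (Dis ?F)"
    using \<open>group (Dis ?F)\<close> by (simp add: group.is_monoid)
  have fix_iff: "?f g (\<alpha> `` {x}) = \<alpha> `` {x} \<longleftrightarrow> (x, g x) \<in> \<alpha>" if g: "g \<in> D" and x: "x \<in> carrier Q" for g x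
    using factor_perm_apply[OF \<alpha> DC[OF g] x] class_eq_iff[OF \<alpha> _ x, of "g x"] c(4) D_closed[OF g] x
    by auto
  have stab: "Dis_stab ?F (\<alpha> `` {x}) = {\<one>\<^bsub>Dis ?F\<^esub>} \<longleftrightarrow> (\<forall>g\<in>D. (x, g x) \<in> \<alpha> \<longrightarrow> g \<in> Dis_kernel \<alpha>)"
    if x: "x \<in> carrier Q" for x
  proof -
    have singleton: "S = {u} \<longleftrightarrow> (\<forall>t\<in>S. t = u)" if "u \<in> S" for S and u :: "'a set \<Rightarrow> 'a set"
      using that by blast
    have S: "Dis_stab ?F (\<alpha> `` {x}) = ?f ` {g \<in> D. (x, g x) \<in> \<alpha>}"
      unfolding Dis_stab_def stabilizer_def carrier_DF using fix_iff[OF _ x] by blast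
    have "\<one>\<^bsub>Dis ?F\<^esub> \<in> ?f ` {g \<in> D. (x, g x) \<in> \<alpha>}"
      unfolding one using subgroup.one_closed[OF subgroup_D] c(3)[OF x] x by auto
    from singleton[OF this] show ?thesis
      unfolding S by (auto simp: f_one)
  qed
  have "(\<forall>X\<in>carrier Q // \<alpha>. Dis_stab ?F X = {\<one>\<^bsub>Dis ?F\<^esub>}) \<longleftrightarrow>
      (\<forall>x\<in>carrier Q. Dis_stab ?F (\<alpha> `` {x}) = {\<one>\<^bsub>Dis ?F\<^esub>})"
    by (auto simp: quotient_def)
  also have "\<dots> \<longleftrightarrow> (\<forall>x\<in>carrier Q. \<forall>g\<in>D. (x, g x) \<in> \<alpha> \<longrightarrow> g \<in> Dis_kernel \<alpha>)"
    by (intro ball_cong refl stab)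
  also have "\<dots> \<longleftrightarrow> (\<forall>g\<in>D. \<forall>x\<in>carrier Q. (x, g x) \<in> \<alpha> \<longrightarrow> g \<in> Dis_kernel \<alpha>)"
    by blast
  finally show ?thesis
    unfolding abelian_quandle_def comm carrier_factor by simp
qed

end

section \<open>Subquandles and orbits of permutation groups\<close>

context quandle begin

lemma subquandle_iff:
  "subquandle S Q \<longleftrightarrow> S \<subseteq> carrier Q \<and> (\<forall>a\<in>S. \<forall>b\<in>S. a \<triangleright> b \<in> S \<and> \<iota> (L a) b \<in> S)"
  unfolding subquandle_def by (metis ldiv_eq subsetD)

lemma zero_cong_iff: "(a, b) \<in> zero_cong Q \<longleftrightarrow> a \<in> carrier Q \<and> a = b"
  by (auto simp: zero_cong_def)

text \<open>The substance lies in left division: in the smaller carrier it is still the division of \<open>Q\<close>,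
  since the quotient of two elements of \<open>S\<close> lies in \<open>S\<close>.\<close>

lemma subquandle_restrict:
  assumes S: "subquandle S Q" and T: "subquandle T Q" "T \<subseteq> S"
  shows "subquandle T (Q\<lparr>carrier := S\<rparr>)"
proof -
  have SQ: "S \<subseteq> carrier Q" using S by (simp add: subquandle_def)
  have "ldiv (Q\<lparr>carrier := S\<rparr>) a b = \<iota> (L a) b" if "a \<in> T" "b \<in> T" for a b
  proof -
    have Q: "a \<in> carrier Q" "b \<in> carrier Q" and aS: "a \<in> S" "b \<in> S" using that T SQ by auto
    have "\<iota> (L a) b \<in> S" using S aS by (simp add: subquandle_iff)
    moreover have "inj_on (\<lambda>x. a \<triangleright> x) S"
      using bij_left[OF Q(1)] SQ by (auto simp: bij_betw_def intro: inj_on_subset)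
    ultimately show ?thesis
      using inv_into_f_f[of "\<lambda>x. a \<triangleright> x" S "\<iota> (L a) b"] Q by (simp add: ldiv_def)
  qed
  then show ?thesis using T unfolding subquandle_iff by (simp add: subquandle_def)
qed

lemma subquandle_of_proper_subquandle:
  assumes "locally_strictly_simple Q" "proper_subquandle S Q"
    and "subquandle T Q" "T \<subseteq> S" "more_than_one T"
  shows "T = S"
proof (rule ccontr)
  assume "T \<noteq> S"
  then have "proper_subquandle T (Q\<lparr>carrier := S\<rparr>)"
    using subquandle_restrict assms unfolding proper_subquandle_def by simp
  then show False
    using assms(1,2) unfolding locally_strictly_simple_def strictly_simple_def by blast
qed

lemma finite_Perm: "finite (carrier Q) \<Longrightarrow> finite (carrier Perm)"
  by (rule finite_subset[of _ "carrier Q \<rightarrow>\<^sub>E carrier Q"])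
     (auto simp: BijGroup_def Bij_def PiE_def bij_betw_def intro!: finite_PiE[unfolded PiE_def])

lemma orbit_stabilizer_perm:
  assumes X: "subgroup X Perm" and x: "x \<in> carrier Q"
  shows "card ((\<lambda>g. g x) ` X) * card {g \<in> X. g x = x} = card X"
proof -
  have "group_hom (Perm\<lparr>carrier := X\<rparr>) Perm (\<lambda>g. g)"
    using perm.subgroup_imp_group[OF X] subgroup.subset[OF X]
    by (intro group_hom.intro group_hom_axioms.intro group_Perm) (auto simp: hom_def)
  then interpret group_action "Perm\<lparr>carrier := X\<rparr>" "carrier Q" "\<lambda>g. g"
    by (rule group_action.intro)
  have "orbit (Perm\<lparr>carrier := X\<rparr>) (\<lambda>g. g) x = (\<lambda>g. g x) ` X"
    by (auto simp: orbit_def)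
  then show ?thesis
    using orbit_stabilizer_theorem[OF x] by (simp add: stabilizer_def order_def)
qed

lemma Dis_group: "group (Dis Q)"
  unfolding Dis_def by (rule perm.subgroup_imp_group[OF subgroup_D])

lemma Dis_stab_eq: "Dis_stab Q a = {g \<in> D. g a = a}"
  by (simp add: Dis_stab_def stabilizer_def Dis_def)

lemma normal_of_conj:
  assumes "subgroup X Perm" "subgroup Y Perm" "Y \<subseteq> X"
    and conj: "\<And>x y. x \<in> X \<Longrightarrow> y \<in> Y \<Longrightarrow> x \<cdot> y \<cdot> \<iota> x \<in> Y"
  shows "Y \<lhd> Perm\<lparr>carrier := X\<rparr>"
proof (rule group.normal_invI[OF perm.subgroup_imp_group[OF assms(1)]])
  show "subgroup Y (Perm\<lparr>carrier := X\<rparr>)" by (rule perm.subgroup_incl[OF assms(2,1,3)])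
  fix y x assume "y \<in> Y" "x \<in> carrier (Perm\<lparr>carrier := X\<rparr>)"
  then show "x \<otimes>\<^bsub>Perm\<lparr>carrier := X\<rparr>\<^esub> y \<otimes>\<^bsub>Perm\<lparr>carrier := X\<rparr>\<^esub> inv\<^bsub>Perm\<lparr>carrier := X\<rparr>\<^esub> x \<in> Y"
    using conj perm.m_inv_consistent[OF assms(1)] by simp
qed

text \<open>Left translation by \<open>a \<triangleright> c\<close> is \<open>L\<^sub>a L\<^sub>c L\<^sub>a\<^sup>-\<^sup>1\<close>, and left translation by the left quotient of
  \<open>c\<close> by \<open>a\<close> is \<open>L\<^sub>a\<^sup>-\<^sup>1 L\<^sub>c L\<^sub>a\<close>; both depend on \<open>L\<^sub>a\<close> and \<open>L\<^sub>c\<close> only.\<close>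

lemma L_kernel_congruence: "congruence Q {(a, b) \<in> carrier Q \<times> carrier Q. L a = L b}" (is "congruence Q ?k")
proof -
  have "equiv (carrier Q) ?k"
    by (rule equivI) (auto simp: refl_on_def sym_def trans_def)
  moreover have "(a \<triangleright> c, b \<triangleright> d) \<in> ?k \<and> (ldiv Q a c, ldiv Q b d) \<in> ?k"
    if ab: "(a, b) \<in> ?k" and cd: "(c, d) \<in> ?k" for a b c d
  proof -
    have Q: "a \<in> carrier Q" "b \<in> carrier Q" "c \<in> carrier Q" "d \<in> carrier Q"
      and L: "L a = L b" "L c = L d" using ab cd by auto
    have "L (L a c) = L (L b d)"
      using L_Aut[OF L_in_Aut[OF Q(1)] Q(3)] L_Aut[OF L_in_Aut[OF Q(2)] Q(4)] L by (simp del: L_apply)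
    moreover have "L (\<iota> (L a) c) = L (\<iota> (L b) d)"
      using L_Aut[OF subgroup.m_inv_closed[OF subgroup_Aut L_in_Aut[OF Q(1)]] Q(3)]
        L_Aut[OF subgroup.m_inv_closed[OF subgroup_Aut L_in_Aut[OF Q(2)]] Q(4)] L
      by (simp del: L_apply)
    ultimately show ?thesis using Q by simp
  qed
  ultimately show ?thesis unfolding congruence_def by blast
qed

end

context quandle begin

lemma pow_subgroup: "subgroup X Perm \<Longrightarrow> g \<in> X \<Longrightarrow> g [^]\<^bsub>Perm\<^esub> (k::nat) \<in> X"
  by (induction k) (auto simp: subgroup.one_closed subgroup.m_closed)

lemma pow_restrict: "x [^]\<^bsub>Perm\<lparr>carrier := X\<rparr>\<^esub> (k::nat) = x [^]\<^bsub>Perm\<^esub> k"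
  by (simp add: nat_pow_def)

lemma commutator_in_D:
  assumes "g \<in> D" "h \<in> D" shows "g \<cdot> h \<cdot> \<iota> g \<cdot> \<iota> h \<in> D"
  using assms subgroup_D by (simp add: subgroup.m_closed subgroup.m_inv_closed)

lemma commute_of_commutator:
  assumes "g \<in> carrier Perm" "h \<in> carrier Perm" "g \<cdot> h \<cdot> \<iota> g \<cdot> \<iota> h = \<one>\<^bsub>Perm\<^esub>"
  shows "g \<cdot> h = h \<cdot> g"
proof -
  have "g \<cdot> h = (g \<cdot> h \<cdot> \<iota> g \<cdot> \<iota> h) \<cdot> (h \<cdot> g)" using assms(1,2) by (simp add: perm.group_normalize)
  then show ?thesis using assms by simp
qed

end

section \<open>The unique congruence and the kernel of the action on its blocks\<close>

text \<open>The hypotheses of the theorem with the definitions of the class unfolded and the unique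
  nontrivial congruence made a parameter.\<close>

locale lss_quandle = quandle Q for Q :: "'a qstruct" (structure) +
  fixes \<alpha> :: "('a \<times> 'a) set" and p q m n :: nat
  assumes fin: "finite (carrier Q)"
    and transitive: "\<And>x y. x \<in> carrier Q \<Longrightarrow> y \<in> carrier Q \<Longrightarrow> \<exists>g\<in>Dis_rel Q (carrier Q \<times> carrier Q). g x = y"
    and non_abelian: "\<not> abelian_quandle Q"
    and lss: "locally_strictly_simple Q"
    and \<alpha>: "congruence Q \<alpha>" and \<alpha>_nonzero: "\<alpha> \<noteq> zero_cong Q" and \<alpha>_not_one: "\<alpha> \<noteq> one_cong Q"
    and unique: "\<And>\<beta>. congruence Q \<beta> \<Longrightarrow> \<beta> = zero_cong Q \<or> \<beta> = \<alpha> \<or> \<beta> = one_cong Q"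
    and card_factor: "card (carrier Q // \<alpha>) = q ^ n"
    and card_block: "\<And>X. X \<in> carrier Q // \<alpha> \<Longrightarrow> card X = p ^ m"
    and p: "prime p" and q: "prime q" and pq: "p \<noteq> q" and m: "m \<ge> 1" and n: "n \<ge> 1"
    and pm: "p ^ m > 2"
    and \<sigma>: "gamma_cong Q \<subseteq> sigma_rel Q"
begin

lemmas cong = congruenceD[OF \<alpha>]

text \<open>In a commutative transitive group point stabilisers are trivial, so commutativity of \<open>D\<close>
  alone would make \<open>Q\<close> abelian.\<close>

lemma D_not_commutative: "\<not> (\<forall>g\<in>D. \<forall>h\<in>D. g \<cdot> h = h \<cdot> g)"
proof
  assume *: "\<forall>g\<in>D. \<forall>h\<in>D. g \<cdot> h = h \<cdot> g"
  have comm: "g \<cdot> h = h \<cdot> g" if "g \<in> D" "h \<in> D" for g h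
    using * that by blast
  have "comm_group (Dis Q)"
    by (rule group.group_comm_groupI[OF Dis_group]) (use comm in \<open>auto simp: Dis_def\<close>)
  moreover have "Dis_stab Q a = {\<one>\<^bsub>Dis Q\<^esub>}" if a: "a \<in> carrier Q" for a
  proof -
    have triv: "g = \<one>\<^bsub>Perm\<^esub>" if g: "g \<in> D" "g a = a" for g
    proof (rule perm_eqI)
      fix x assume x: "x \<in> carrier Q"
      obtain h where h: "h \<in> D" "h a = x" using transitive a x by blast
      have "(g \<cdot> h) a = (h \<cdot> g) a" using comm g h by simp
      then show "g x = \<one>\<^bsub>Perm\<^esub> x" using a g h x D_closed by simp
    qed (use g D_closed in auto)
    have "{g \<in> D. g a = a} = {\<one>\<^bsub>Perm\<^esub>}"
    proof (intro equalityI subsetI)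
      fix g assume "g \<in> {g \<in> D. g a = a}"
      then show "g \<in> {\<one>\<^bsub>Perm\<^esub>}" using triv by simp
    next
      fix g assume "g \<in> {\<one>\<^bsub>Perm\<^esub>}"
      then show "g \<in> {g \<in> D. g a = a}" using subgroup.one_closed[OF subgroup_D] a by simp
    qed
    then show ?thesis by (simp add: Dis_stab_eq Dis_def)
  qed
  ultimately show False using non_abelian by (auto simp: abelian_quandle_def)
qed

abbreviation K where "K \<equiv> Dis_kernel \<alpha>"

lemma K_subset_D: "K \<subseteq> D" by (auto simp: Dis_kernel_def)

lemma K_closed: "g \<in> K \<Longrightarrow> g \<in> carrier Perm" using K_subset_D D_closed by blast

lemma L_invariant_K: "L_invariant K" by (rule L_invariant_Dis_kernel[OF \<alpha>])

lemma subgroup_K: "subgroup K Perm" by (rule L_invariant_subgroup[OF L_invariant_K])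

lemma K_rel: "g \<in> K \<Longrightarrow> x \<in> carrier Q \<Longrightarrow> (x, g x) \<in> \<alpha>" by (auto simp: Dis_kernel_def)

lemma zero_factor_not_abelian: "\<not> abelian_quandle (factor Q (zero_cong Q))"
proof
  assume ab: "abelian_quandle (factor Q (zero_cong Q))"
  have "congruence Q (zero_cong Q)"
    by (auto simp: congruence_def zero_cong_def equiv_def refl_on_def sym_def trans_def)
  with ab have "\<forall>g\<in>D. \<forall>h\<in>D. \<forall>x\<in>carrier Q. ((g \<cdot> h) x, (h \<cdot> g) x) \<in> zero_cong Q"
    using abelian_factor_iff by blast
  then have "g \<cdot> h = h \<cdot> g" if "g \<in> D" "h \<in> D" for g h
    using that D_closed by (intro perm_eqI) (auto simp: zero_cong_iff)
  then show False using D_not_commutative by blast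
qed

lemma one_factor_abelian: "abelian_quandle (factor Q (one_cong Q))"
  unfolding abelian_factor_iff[OF congruence_one]
  by (auto simp: one_cong_def Dis_kernel_def D_closed)

lemma \<alpha>_subset_one: "\<alpha> \<subseteq> one_cong Q"
  using cong(1,2) by (auto simp: one_cong_def)

text \<open>The three congruences form a chain, \<open>0\<close> has the nonabelian factor \<open>Q\<close>, and \<open>1\<close> has an abelian
  factor. Which of \<open>\<alpha>\<close> and \<open>1\<close> is \<open>\<gamma>\<close> is decided only after \<open>D/K\<close> is known to be abelian.\<close>

lemma gamma_cases:
  "gamma_cong Q = \<alpha> \<and> abelian_quandle (factor Q \<alpha>) \<or> gamma_cong Q = one_cong Q \<and> \<not> abelian_quandle (factor Q \<alpha>)"
proof (cases "abelian_quandle (factor Q \<alpha>)")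
  case True
  have "gamma_cong Q = \<alpha>" unfolding gamma_cong_def
  proof (rule Least_equality)
    fix \<beta> assume \<beta>: "congruence Q \<beta> \<and> abelian_quandle (factor Q \<beta>)"
    then have "\<beta> \<noteq> zero_cong Q" using zero_factor_not_abelian by metis
    then show "\<alpha> \<subseteq> \<beta>" using unique \<beta> \<alpha>_subset_one by blast
  qed (use True \<alpha> in simp)
  with True show ?thesis by simp
next
  case False
  have "gamma_cong Q = one_cong Q" unfolding gamma_cong_def
  proof (rule Least_equality)
    fix \<beta> assume \<beta>: "congruence Q \<beta> \<and> abelian_quandle (factor Q \<beta>)"
    then have "\<beta> \<noteq> zero_cong Q" "\<beta> \<noteq> \<alpha>" using zero_factor_not_abelian False by metis+
    then show "one_cong Q \<subseteq> \<beta>" using unique \<beta> by blast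
  qed (use congruence_one one_factor_abelian in simp)
  with False show ?thesis by simp
qed

lemma \<alpha>_subset_sigma: "\<alpha> \<subseteq> sigma_rel Q"
  using gamma_cases \<alpha>_subset_one \<sigma> by auto

lemma stabilizer_fixes_block:
  assumes "g \<in> D" "g a = a" "(a, b) \<in> \<alpha>" shows "g b = b"
proof -
  have "Dis_stab Q a = Dis_stab Q b" using \<alpha>_subset_sigma assms(3) by (auto simp: sigma_rel_def)
  then show ?thesis using assms by (auto simp: Dis_stab_eq)
qed

text \<open>If \<open>\<gamma> = \<alpha>\<close>, the group acts semiregularly on the blocks. If \<open>\<gamma> = 1\<close>, all point stabilisers
  agree, so they are trivial.\<close>

lemma stabilizer_in_K:
  assumes g: "g \<in> D" and a: "a \<in> carrier Q" "g a = a" shows "g \<in> K"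
  using gamma_cases
proof
  assume "gamma_cong Q = \<alpha> \<and> abelian_quandle (factor Q \<alpha>)"
  then have "\<forall>g\<in>D. \<forall>x\<in>carrier Q. (x, g x) \<in> \<alpha> \<longrightarrow> g \<in> K"
    using abelian_factor_iff[OF \<alpha>] by blast
  then show "g \<in> K" using g a cong(3)[OF a(1)] by metis
next
  assume "gamma_cong Q = one_cong Q \<and> \<not> abelian_quandle (factor Q \<alpha>)"
  then have "(a, b) \<in> sigma_rel Q" if "b \<in> carrier Q" for b
    using \<sigma> that a by (auto simp: one_cong_def)
  then have "g b = b" if "b \<in> carrier Q" for b
    using that g a by (auto simp: sigma_rel_def Dis_stab_eq)
  then show "g \<in> K" using g cong(3) by (auto simp: Dis_kernel_def)
qed

lemma block_subquandle:
  assumes a: "a \<in> carrier Q" shows "proper_subquandle (\<alpha> `` {a}) Q"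
proof -
  have "subquandle (\<alpha> `` {a}) Q" unfolding subquandle_iff
  proof (intro conjI ballI)
    show "\<alpha> `` {a} \<subseteq> carrier Q" using cong(2) by auto
    fix b c assume "b \<in> \<alpha> `` {a}" "c \<in> \<alpha> `` {a}"
    then have bc: "(a, b) \<in> \<alpha>" "(a, c) \<in> \<alpha>" by auto
    have aa: "\<iota> (L a) a = a" using L_inv_apply(2)[OF a a] idem[OF a] by simp
    show "b \<triangleright> c \<in> \<alpha> `` {a}" using cong(6)[OF bc] idem[OF a] by simp
    show "\<iota> (L b) c \<in> \<alpha> `` {a}" using cong(7)[OF bc] aa by simp
  qed
  moreover have "more_than_one (\<alpha> `` {a})"
  proof -
    have "card (\<alpha> `` {a}) > 1" using card_block[OF quotientI[OF a, of \<alpha>]] pm by simp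
    then have "\<not> (\<exists>x. \<alpha> `` {a} \<subseteq> {x})" by (metis card_mono card.empty card_insert_disjoint finite.intros
          One_nat_def empty_iff leD)
    then show ?thesis unfolding more_than_one_def using cong(3)[OF a] by blast
  qed
  moreover have "\<alpha> `` {a} \<noteq> carrier Q"
  proof
    assume all: "\<alpha> `` {a} = carrier Q"
    have "one_cong Q \<subseteq> \<alpha>"
    proof (clarsimp simp: one_cong_def)
      fix x y assume "x \<in> carrier Q" "y \<in> carrier Q"
      then have "(a, x) \<in> \<alpha>" "(a, y) \<in> \<alpha>" using all by auto
      then show "(x, y) \<in> \<alpha>" using cong(4,5) by blast
    qed
    then show False using \<alpha>_not_one \<alpha>_subset_one by blast
  qed
  ultimately show ?thesis unfolding proper_subquandle_def by blast
qed

lemma subquandle_of_block: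
  assumes "a \<in> carrier Q" "subquandle T Q" "T \<subseteq> \<alpha> `` {a}" "more_than_one T"
  shows "T = \<alpha> `` {a}"
  using subquandle_of_proper_subquandle[OF lss block_subquandle] assms by blast

text \<open>If the kernel of \<open>L\<close> were \<open>\<alpha>\<close>, two points of a block would act alike on each other, so they
  would form a subquandle strictly inside a block of more than two points. If it were \<open>1\<close>, there would
  be no nontrivial displacement.\<close>

lemma L_inj: assumes ab: "a \<in> carrier Q" "b \<in> carrier Q" "L a = L b" shows "a = b"
proof -
  let ?k = "{(a, b) \<in> carrier Q \<times> carrier Q. L a = L b}"
  have "?k \<noteq> \<alpha>"
  proof
    assume eq: "?k = \<alpha>"
    have "card (\<alpha> `` {a}) > 2" using card_block[OF quotientI[OF ab(1), of \<alpha>]] pm by simp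
    have "more_than_one (\<alpha> `` {a})" using block_subquandle[OF ab(1)] by (simp add: proper_subquandle_def)
    then obtain x y where xy: "x \<in> \<alpha> `` {a}" "y \<in> \<alpha> `` {a}" "x \<noteq> y" by (auto simp: more_than_one_def)
    then have Q: "x \<in> carrier Q" "y \<in> carrier Q" using cong(2) by auto
    have "(x, y) \<in> \<alpha>" using xy cong(4,5) by blast
    then have "L x = L y" using eq by auto
    then have L: "L x y = L y y" "L y x = L x x" "\<iota> (L x) y = \<iota> (L y) y" "\<iota> (L y) x = \<iota> (L x) x" by auto
    have idem': "\<iota> (L u) u = u" if "u \<in> carrier Q" for u using L_inv_apply(2)[OF that that] idem[OF that] by simp
    have "subquandle {x, y} Q"
      unfolding subquandle_iff using Q L idem idem' by simp
    then have "{x, y} = \<alpha> `` {a}"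
      using subquandle_of_block[OF ab(1)] xy by (auto simp: more_than_one_def)
    then have "card (\<alpha> `` {a}) = 2" using xy(3) by (metis card_2_iff)
    with \<open>card (\<alpha> `` {a}) > 2\<close> show False by simp
  qed
  moreover have "?k \<noteq> one_cong Q"
  proof
    assume eq: "?k = one_cong Q"
    have "displacements Q (carrier Q \<times> carrier Q) \<subseteq> {\<one>\<^bsub>Perm\<^esub>}"
    proof
      fix g assume "g \<in> displacements Q (carrier Q \<times> carrier Q)"
      then obtain a b where g: "g = L a \<cdot> \<iota> (L b)" and Q: "a \<in> carrier Q" "b \<in> carrier Q"
        by (auto simp: displacements_def)
      then have "(a, b) \<in> ?k" unfolding eq by (simp add: one_cong_def)
      then have "L a = L b" by simp
      then show "g \<in> {\<one>\<^bsub>Perm\<^esub>}" using g Q by simp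
    qed
    then have "D \<subseteq> {\<one>\<^bsub>Perm\<^esub>}"
      unfolding Dis_rel_def by (rule perm.generate_subgroup_incl[OF _ perm.triv_subgroup])
    then show False using D_not_commutative by blast
  qed
  ultimately have "?k = zero_cong Q" using unique[OF L_kernel_congruence] by blast
  then have "(a, b) \<in> zero_cong Q" using ab by blast
  then show ?thesis by (simp add: zero_cong_iff)
qed

lemma orbits_trichotomy:
  assumes X: "L_invariant X" "X \<subseteq> D" and nontriv: "X \<noteq> {\<one>\<^bsub>Perm\<^esub>}"
  shows "orb_rel X = \<alpha> \<or> orb_rel X = one_cong Q"
proof -
  have "congruence Q (orb_rel X)" using congruence_orb_rel X D_subset_Aut by blast
  moreover have "orb_rel X \<noteq> zero_cong Q"
  proof
    assume eq: "orb_rel X = zero_cong Q"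
    have "g = \<one>\<^bsub>Perm\<^esub>" if g: "g \<in> X" for g
    proof (rule perm_eqI)
      fix x assume x: "x \<in> carrier Q"
      have "(x, g x) \<in> orb_rel X" using g x by (auto simp: orb_rel_def)
      then show "g x = \<one>\<^bsub>Perm\<^esub> x" unfolding eq using x by (simp add: zero_cong_iff)
    qed (use g X D_closed in auto)
    moreover have "\<one>\<^bsub>Perm\<^esub> \<in> X" by (rule subgroup.one_closed[OF L_invariant_subgroup[OF X(1)]])
    ultimately show False using nontriv by blast
  qed
  ultimately show ?thesis using unique by blast
qed

lemma orbits_in_K:
  assumes X: "L_invariant X" "X \<subseteq> K" and nontriv: "X \<noteq> {\<one>\<^bsub>Perm\<^esub>}"
  shows "orb_rel X = \<alpha>"
proof -
  have "orb_rel X \<subseteq> \<alpha>" using X(2) K_rel by (auto simp: orb_rel_def)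
  then show ?thesis using orbits_trichotomy[OF X(1) _ nontriv] X(2) K_subset_D \<alpha>_subset_one \<alpha>_not_one by blast
qed

lemma displacement_in_Dis_rel: "(a, b) \<in> \<beta> \<Longrightarrow> L a \<cdot> \<iota> (L b) \<in> Dis_rel Q \<beta>"
  unfolding Dis_rel_def by (rule generate.incl) (auto simp: displacements_def)

lemma K_nontrivial: "K \<noteq> {\<one>\<^bsub>Perm\<^esub>}"
proof
  assume triv: "K = {\<one>\<^bsub>Perm\<^esub>}"
  have "a = b" if ab: "(a, b) \<in> \<alpha>" for a b
  proof (rule L_inj)
    show Q: "a \<in> carrier Q" "b \<in> carrier Q" using ab cong by blast+
    have "L a \<cdot> \<iota> (L b) = \<one>\<^bsub>Perm\<^esub>"
      using displacement_in_Dis_rel[OF ab] Dis_rel_subset_kernel[OF \<alpha>] triv by blast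
    then show "L a = L b" using Q by (metis L_closed perm.inv_closed perm.inv_equality perm.inv_inv)
  qed
  then have "\<alpha> = zero_cong Q" using cong(1,3) unfolding zero_cong_def by auto
  then show False using \<alpha>_nonzero by simp
qed

lemma K_transitive: assumes "(a, b) \<in> \<alpha>" obtains k where "k \<in> K" "k a = b"
proof -
  have "(a, b) \<in> orb_rel K"
    using assms orbits_in_K[OF L_invariant_K subset_refl K_nontrivial] by simp
  then show thesis using that unfolding orb_rel_def by blast
qed

text \<open>Multiplying \<open>g\<close> by a suitable element of \<open>K\<close>, which is transitive on the block of \<open>x\<close>, gives
  an element of the stabiliser of \<open>x\<close>.\<close>

lemma kernel_of_related:
  assumes g: "g \<in> D" and x: "(x, g x) \<in> \<alpha>" shows "g \<in> K"
proof -
  have xQ: "x \<in> carrier Q" using x cong(1) by blast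
  obtain k where k: "k \<in> K" "k x = g x" using K_transitive[OF x] .
  have kD: "k \<in> D" using k K_subset_D by blast
  have "\<iota> k \<cdot> g \<in> D" using g kD subgroup_D by (simp add: subgroup.m_closed subgroup.m_inv_closed)
  moreover have "(\<iota> k \<cdot> g) x = x" using xQ g kD D_closed k(2)[symmetric] by simp
  ultimately have "\<iota> k \<cdot> g \<in> K" using stabilizer_in_K xQ by blast
  then have "k \<cdot> (\<iota> k \<cdot> g) \<in> K" using k subgroup_K by (simp add: subgroup.m_closed)
  then show ?thesis using g kD D_closed by (simp add: perm.cancel_left_inv)
qed

abbreviation Stab where "Stab a \<equiv> {k \<in> K. k a = a}"

lemma Stab_eq: "a \<in> carrier Q \<Longrightarrow> Stab a = {g \<in> D. g a = a}"
  using stabilizer_in_K K_subset_D by blast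

lemma block_eq: "a \<in> carrier Q \<Longrightarrow> (\<lambda>k. k a) ` K = \<alpha> `` {a}"
proof
  assume a: "a \<in> carrier Q"
  show "(\<lambda>k. k a) ` K \<subseteq> \<alpha> `` {a}" using K_rel a by blast
  show "\<alpha> `` {a} \<subseteq> (\<lambda>k. k a) ` K"
  proof
    fix b assume "b \<in> \<alpha> `` {a}"
    then have "(a, b) \<in> \<alpha>" by simp
    then obtain k where "k \<in> K" "k a = b" by (rule K_transitive)
    then show "b \<in> (\<lambda>k. k a) ` K" by blast
  qed
qed

lemma card_K: assumes a: "a \<in> carrier Q" shows "card K = p ^ m * card (Stab a)"
  using orbit_stabilizer_perm[OF subgroup_K a] block_eq[OF a] card_block[OF quotientI[OF a, of \<alpha>]] by simp

lemma card_Q: "card (carrier Q) = p ^ m * q ^ n"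
proof -
  have eq: "equiv (carrier Q) \<alpha>" using \<alpha> by (simp add: congruence_def)
  have finQ: "finite (carrier Q // \<alpha>)"
    by (rule card_ge_0_finite) (use card_factor q prime_gt_0_nat in simp)
  have "p ^ m * card (carrier Q // \<alpha>) = card (\<Union> (carrier Q // \<alpha>))"
    by (rule card_partition)
      (use fin finQ card_block quotient_disj[OF eq] Union_quotient[OF eq] in auto)
  then show ?thesis using Union_quotient[OF eq] card_factor by simp
qed

lemma nonempty: obtains a where "a \<in> carrier Q"
proof -
  have "card (carrier Q) > 0" using card_Q p q prime_gt_0_nat by simp
  then show thesis using that by (metis card.empty equals0I less_irrefl)
qed

lemma card_D: "card D = card K * q ^ n"
proof -
  obtain a where a: "a \<in> carrier Q" by (rule nonempty)
  have "(\<lambda>g. g a) ` D = carrier Q"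
  proof
    show "(\<lambda>g. g a) ` D \<subseteq> carrier Q" using a D_closed by auto
    show "carrier Q \<subseteq> (\<lambda>g. g a) ` D"
    proof
      fix x assume "x \<in> carrier Q"
      then obtain g where "g \<in> D" "g a = x" using transitive[OF a] by blast
      then show "x \<in> (\<lambda>g. g a) ` D" by blast
    qed
  qed
  then have "card D = card (carrier Q) * card (Stab a)"
    using orbit_stabilizer_perm[OF subgroup_D a] Stab_eq[OF a] by simp
  then show ?thesis using card_K[OF a] card_Q by simp
qed

lemma finite_D: "finite D"
  using finite_subset[of D "carrier Perm"] finite_Perm[OF fin] D_closed by blast

lemma card_K_pos: "card K > 0"
  unfolding card_gt_0_iff
  using finite_subset[OF K_subset_D finite_D] subgroup.one_closed[OF subgroup_K] by blast

lemma subgroup_Stab: assumes a: "a \<in> carrier Q" shows "subgroup (Stab a) Perm"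
proof (rule perm.subgroupI)
  show "Stab a \<subseteq> carrier Perm" using K_closed by blast
  have "\<one>\<^bsub>Perm\<^esub> \<in> Stab a" using a subgroup.one_closed[OF subgroup_K] by simp
  then show "Stab a \<noteq> {}" by blast
  fix g assume g: "g \<in> Stab a"
  then have "\<iota> g (g a) = a" using K_closed a by (intro perm_inv_apply) auto
  then show "\<iota> g \<in> Stab a" using g subgroup.m_inv_closed[OF subgroup_K] by simp
next
  fix g h assume "g \<in> Stab a" "h \<in> Stab a"
  then show "g \<cdot> h \<in> Stab a" using a K_closed subgroup.m_closed[OF subgroup_K] by simp
qed

lemma order_quotient:
  assumes "Y \<lhd> Perm\<lparr>carrier := X\<rparr>" "card X = card Y * k" "card Y > 0"
  shows "order (Perm\<lparr>carrier := X\<rparr> Mod Y) = k"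
proof -
  interpret normal Y "Perm\<lparr>carrier := X\<rparr>" by (rule assms)
  have "card (rcosets\<^bsub>Perm\<lparr>carrier := X\<rparr>\<^esub> Y) * card Y = card X"
    using lagrange[OF is_subgroup] by (simp add: order_def)
  then show ?thesis using assms by (simp add: order_def FactGroup_def mult.commute)
qed

text \<open>Conjugation carries the stabiliser of \<open>a\<close> to that of another point of the same block, and
  these two stabilisers coincide.\<close>

lemma Stab_normal: assumes a: "a \<in> carrier Q" shows "Stab a \<lhd> Perm\<lparr>carrier := K\<rparr>"
proof (rule normal_of_conj[OF subgroup_K subgroup_Stab[OF a]])
  fix x y assume x: "x \<in> K" and y: "y \<in> Stab a"
  have xi: "\<iota> x \<in> K" using x subgroup.m_inv_closed[OF subgroup_K] by blast
  have "y (\<iota> x a) = \<iota> x a"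
    using stabilizer_fixes_block[of y a "\<iota> x a"] y K_rel[OF xi a] K_subset_D by blast
  then have "(x \<cdot> y \<cdot> \<iota> x) a = a" using x y a K_closed by simp
  then show "x \<cdot> y \<cdot> \<iota> x \<in> Stab a" using x y xi subgroup.m_closed[OF subgroup_K] by simp
qed auto

lemma K_normal: "K \<lhd> Perm\<lparr>carrier := D\<rparr>"
  using normal_of_conj[OF subgroup_D subgroup_K K_subset_D] L_invariant_normalized[OF L_invariant_K] by blast

lemma order_K_mod_Stab: "a \<in> carrier Q \<Longrightarrow> order (Perm\<lparr>carrier := K\<rparr> Mod Stab a) = p ^ m"
  by (rule order_quotient[OF Stab_normal])
    (use card_K[of a] card_K_pos in \<open>auto simp: mult.commute intro!: Nat.gr0I\<close>)

lemma order_D_mod_K: "order (Perm\<lparr>carrier := D\<rparr> Mod K) = q ^ n"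
  using order_quotient[OF K_normal card_D card_K_pos] .

end

section \<open>The kernel is elementary abelian\<close>

context lss_quandle begin

lemma K_mult: "g \<in> K \<Longrightarrow> h \<in> K \<Longrightarrow> g \<cdot> h \<in> K" by (rule subgroup.m_closed[OF subgroup_K])
lemma K_inv: "g \<in> K \<Longrightarrow> \<iota> g \<in> K" by (rule subgroup.m_inv_closed[OF subgroup_K])
lemma D_mult: "g \<in> D \<Longrightarrow> h \<in> D \<Longrightarrow> g \<cdot> h \<in> D" by (rule subgroup.m_closed[OF subgroup_D])
lemma D_inv: "g \<in> D \<Longrightarrow> \<iota> g \<in> D" by (rule subgroup.m_inv_closed[OF subgroup_D])
lemma KD: "g \<in> K \<Longrightarrow> g \<in> D" using K_subset_D by blast
lemma L_conj_K:
  "a \<in> carrier Q \<Longrightarrow> g \<in> K \<Longrightarrow> L a \<cdot> g \<cdot> \<iota> (L a) \<in> K"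
  "a \<in> carrier Q \<Longrightarrow> g \<in> K \<Longrightarrow> \<iota> (L a) \<cdot> g \<cdot> L a \<in> K"
  using L_invariant_K by (auto simp: L_invariant_def)

lemma L_fixed: "a \<in> carrier Q \<Longrightarrow> \<iota> (L a) a = a"
  using L_inv_apply(2)[of a a] idem[of a] by simp

lemma Stab_fixes: "k \<in> Stab a \<Longrightarrow> (a, b) \<in> \<alpha> \<Longrightarrow> k b = b"
  using stabilizer_fixes_block KD by blast

text \<open>The images of \<open>a\<close> under \<open>Y\<close> form a subquandle of the block of \<open>a\<close>, since
  \<open>y a \<triangleright> z a = y (L\<^sub>a y\<^sup>-\<^sup>1 z L\<^sub>a\<^sup>-\<^sup>1) a\<close>. It has more than one point and hence is the whole block, so
  \<open>K = Y K\<^sub>a = Y\<close>.\<close>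

lemma subgroup_of_K_exhausts:
  assumes a: "a \<in> carrier Q" and Y: "subgroup Y Perm" "Y \<subseteq> K"
    and conj: "\<And>y. y \<in> Y \<Longrightarrow> L a \<cdot> y \<cdot> \<iota> (L a) \<in> Y" "\<And>y. y \<in> Y \<Longrightarrow> \<iota> (L a) \<cdot> y \<cdot> L a \<in> Y"
    and Stab: "Stab a \<subseteq> Y" and strict: "\<not> Y \<subseteq> Stab a"
  shows "Y = K"
proof -
  define T where "T = (\<lambda>y. y a) ` Y"
  have YP: "y \<in> carrier Perm" if "y \<in> Y" for y using that Y K_closed by blast
  have T_sub: "T \<subseteq> \<alpha> `` {a}" using K_rel[OF _ a] Y unfolding T_def by blast
  have "subquandle T Q" unfolding subquandle_iff
  proof (intro conjI ballI)
    show "T \<subseteq> carrier Q" using T_sub cong(2) by blast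
    fix b c assume "b \<in> T" "c \<in> T"
    then obtain y z where y: "y \<in> Y" "b = y a" and z: "z \<in> Y" "c = z a" by (auto simp: T_def)
    note P = YP[OF y(1)] YP[OF z(1)]
    have yz: "\<iota> y \<cdot> z \<in> Y" using y z Y by (simp add: subgroup.m_closed subgroup.m_inv_closed)
    have Lb: "L b = y \<cdot> L a \<cdot> \<iota> y" using L_Aut[of y a] y Y KD D_subset_Aut a by blast
    have Q: "b \<in> carrier Q" "c \<in> carrier Q" using y z P a by auto
    have "b \<triangleright> c = L b c" using Q by simp
    also have "\<dots> = (y \<cdot> (L a \<cdot> (\<iota> y \<cdot> z) \<cdot> \<iota> (L a))) a"
      unfolding Lb z(2) using P a L_fixed[OF a] by simp
    finally show "b \<triangleright> c \<in> T"
      unfolding T_def using subgroup.m_closed[OF Y(1) y(1) conj(1)[OF yz]] by blast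
    have "\<iota> (L b) c = (y \<cdot> (\<iota> (L a) \<cdot> (\<iota> y \<cdot> z) \<cdot> L a)) a"
      unfolding Lb z(2) using P a idem[OF a] by (simp add: perm.inv_mult_group)
    then show "\<iota> (L b) c \<in> T"
      unfolding T_def using subgroup.m_closed[OF Y(1) y(1) conj(2)[OF yz]] by blast
  qed
  moreover have "more_than_one T"
  proof -
    obtain y where y: "y \<in> Y" "y \<notin> Stab a" using strict by blast
    then have "y a \<noteq> a" using Y by blast
    moreover have "a \<in> T" using subgroup.one_closed[OF Y(1)] a unfolding T_def
      by (metis image_eqI perm_one_apply)
    moreover have "y a \<in> T" using y unfolding T_def by blast
    ultimately show ?thesis unfolding more_than_one_def by blast
  qed
  ultimately have T: "T = \<alpha> `` {a}" using subquandle_of_block[OF a _ T_sub] by blast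
  have "k \<in> Y" if k: "k \<in> K" for k
  proof -
    have "k a \<in> T" unfolding T using K_rel[OF k a] by simp
    then obtain y where y: "y \<in> Y" "k a = y a" by (auto simp: T_def)
    have "(\<iota> y \<cdot> k) a = a" using y(2) YP[OF y(1)] K_closed[OF k] a by simp
    moreover have "\<iota> y \<cdot> k \<in> K" using y(1) Y k K_mult K_inv by blast
    ultimately have "\<iota> y \<cdot> k \<in> Y" using Stab by blast
    then have "y \<cdot> (\<iota> y \<cdot> k) \<in> Y" using y(1) subgroup.m_closed[OF Y(1)] by blast
    then show ?thesis using YP[OF y(1)] K_closed[OF k] by (simp add: perm.cancel_left_inv)
  qed
  then show ?thesis using Y by blast
qed

text \<open>The set \<open>Y\<close> below is the preimage of the centre of \<open>K/K\<^sub>a\<close>: as \<open>K\<^sub>a\<close> fixes the block of \<open>a\<close>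
  pointwise, \<open>[k,h] \<in> K\<^sub>a\<close> amounts to \<open>k h a = h k a\<close>.\<close>

lemma K_commute_at:
  assumes a: "a \<in> carrier Q" and k: "k \<in> K" and h: "h \<in> K"
  shows "k (h a) = h (k a)"
proof -
  define Y where "Y = {k \<in> K. \<forall>h\<in>K. k (h a) = h (k a)}"
  have YK: "k \<in> K" if "k \<in> Y" for k using that by (simp add: Y_def)
  have YD: "k (h a) = h (k a)" if "k \<in> Y" "h \<in> K" for k h using that by (simp add: Y_def)
  have "subgroup Y Perm"
  proof (rule perm.subgroupI)
    show "Y \<subseteq> carrier Perm" using YK K_closed by blast
    have "\<one>\<^bsub>Perm\<^esub> \<in> Y"
      using subgroup.one_closed[OF subgroup_K] a K_closed by (simp add: Y_def)
    then show "Y \<noteq> {}" by blast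
  next
    fix k assume k: "k \<in> Y"
    note kP = K_closed[OF YK[OF k]]
    have "\<iota> k (h a) = h (\<iota> k a)" if h: "h \<in> K" for h
    proof -
      \<comment> \<open>The element of \<open>K\<close> to compare with is chosen such that its action on \<open>k a\<close> is that of \<open>h\<close> on \<open>a\<close>.\<close>
      have "k ((h \<cdot> \<iota> k) a) = (h \<cdot> \<iota> k) (k a)"
        by (rule YD[OF k K_mult[OF h K_inv[OF YK[OF k]]]])
      then have "k (h (\<iota> k a)) = h a" using kP K_closed[OF h] a by simp
      then have "\<iota> k (k (h (\<iota> k a))) = \<iota> k (h a)" by simp
      then show ?thesis using kP K_closed[OF h] a by simp
    qed
    then show "\<iota> k \<in> Y" using K_inv[OF YK[OF k]] by (simp add: Y_def)
  next
    fix k l assume k: "k \<in> Y" and l: "l \<in> Y"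
    note P = K_closed[OF YK[OF k]] K_closed[OF YK[OF l]]
    have "(k \<cdot> l) (h a) = h ((k \<cdot> l) a)" if h: "h \<in> K" for h
    proof -
      have "k ((h \<cdot> l) a) = (h \<cdot> l) (k a)" by (rule YD[OF k K_mult[OF h YK[OF l]]])
      then have "k (h (l a)) = h (l (k a))" using P K_closed[OF h] a by simp
      then show ?thesis using P K_closed[OF h] a YD[OF l h] YD[OF k YK[OF l]] by simp
    qed
    then show "k \<cdot> l \<in> Y" using K_mult[OF YK[OF k] YK[OF l]] by (simp add: Y_def)
  qed
  moreover have "L a \<cdot> k \<cdot> \<iota> (L a) \<in> Y" if k: "k \<in> Y" for k
  proof -
    note kP = K_closed[OF YK[OF k]]
    have "(L a \<cdot> k \<cdot> \<iota> (L a)) (h a) = h ((L a \<cdot> k \<cdot> \<iota> (L a)) a)" if h: "h \<in> K" for h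
    proof -
      have "k ((\<iota> (L a) \<cdot> h \<cdot> L a) a) = (\<iota> (L a) \<cdot> h \<cdot> L a) (k a)"
        by (rule YD[OF k L_conj_K(2)[OF a h]])
      then have "k (\<iota> (L a) (h a)) = \<iota> (L a) (h (a \<triangleright> k a))"
        using a kP K_closed[OF h] idem[OF a] by simp
      then show ?thesis using a kP K_closed[OF h] L_fixed[OF a] by simp
    qed
    then show ?thesis using L_conj_K(1)[OF a YK[OF k]] by (simp add: Y_def)
  qed
  moreover have "\<iota> (L a) \<cdot> k \<cdot> L a \<in> Y" if k: "k \<in> Y" for k
  proof -
    note kP = K_closed[OF YK[OF k]]
    have "(\<iota> (L a) \<cdot> k \<cdot> L a) (h a) = h ((\<iota> (L a) \<cdot> k \<cdot> L a) a)" if h: "h \<in> K" for h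
    proof -
      have "k ((L a \<cdot> h \<cdot> \<iota> (L a)) a) = (L a \<cdot> h \<cdot> \<iota> (L a)) (k a)"
        by (rule YD[OF k L_conj_K(1)[OF a h]])
      then have "k (a \<triangleright> h a) = a \<triangleright> h (\<iota> (L a) (k a))"
        using a kP K_closed[OF h] L_fixed[OF a] by simp
      then show ?thesis using a kP K_closed[OF h] idem[OF a] by simp
    qed
    then show ?thesis using L_conj_K(2)[OF a YK[OF k]] by (simp add: Y_def)
  qed
  moreover have "Stab a \<subseteq> Y"
  proof
    fix k assume k: "k \<in> Stab a"
    have "k (h a) = h (k a)" if h: "h \<in> K" for h
      using Stab_fixes[OF k K_rel[OF h a]] k by simp
    then show "k \<in> Y" using k by (simp add: Y_def)
  qed
  moreover have "\<not> Y \<subseteq> Stab a"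
  proof -
    interpret GK: group "Perm\<lparr>carrier := K\<rparr>" by (rule perm.subgroup_imp_group[OF subgroup_K])
    obtain z where z: "z \<in> K" "z \<notin> Stab a"
      and zc: "\<And>x. x \<in> K \<Longrightarrow> z \<cdot> x \<cdot> \<iota> z \<cdot> \<iota> x \<in> Stab a"
      using GK.p_quotient_has_central_element[OF Stab_normal[OF a] p order_K_mod_Stab[OF a] m]
        perm.m_inv_consistent[OF subgroup_K] by auto
    have "z (x a) = x (z a)" if x: "x \<in> K" for x
    proof -
      note P = K_closed[OF z(1)] K_closed[OF x]
      have "(z \<cdot> x \<cdot> \<iota> z \<cdot> \<iota> x) ((x \<cdot> z) a) = (x \<cdot> z) a"
        by (rule Stab_fixes[OF zc[OF x] K_rel[OF K_mult[OF x z(1)] a]])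
      then show ?thesis using P a by simp
    qed
    then have "z \<in> Y" using z by (simp add: Y_def)
    then show ?thesis using z by blast
  qed
  ultimately have "Y = K" using subgroup_of_K_exhausts[OF a] YK by blast
  then show ?thesis using YD k h by blast
qed

lemma K_commute: assumes "k \<in> K" "h \<in> K" shows "k \<cdot> h = h \<cdot> k"
  by (rule perm_eqI) (use assms K_closed K_commute_at in auto)

text \<open>The set \<open>Y\<close> below is the preimage of the subgroup of elements of order dividing \<open>p\<close> in
  the abelian group \<open>K/K\<^sub>a\<close>, and that subgroup is nontrivial.\<close>

lemma K_exponent_at:
  assumes a: "a \<in> carrier Q" and k: "k \<in> K"
  shows "k [^]\<^bsub>Perm\<^esub> p \<in> Stab a"
proof -
  define Y where "Y = {k \<in> K. k [^]\<^bsub>Perm\<^esub> p \<in> Stab a}"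
  note S = subgroup_Stab[OF a]
  have YK: "k \<in> K" and Yp: "k [^]\<^bsub>Perm\<^esub> p \<in> Stab a" if "k \<in> Y" for k using that by (simp_all add: Y_def)
  have YI: "k \<in> Y" if "k \<in> K" "k [^]\<^bsub>Perm\<^esub> p \<in> Stab a" for k using that by (simp add: Y_def)
  have "subgroup Y Perm"
  proof (rule perm.subgroupI)
    show "Y \<subseteq> carrier Perm" using YK K_closed by blast
    have "\<one>\<^bsub>Perm\<^esub> \<in> Y"
      by (rule YI) (use subgroup.one_closed[OF subgroup_K] subgroup.one_closed[OF S] in simp_all)
    then show "Y \<noteq> {}" by blast
  next
    fix k assume k: "k \<in> Y"
    have "\<iota> k [^]\<^bsub>Perm\<^esub> p = \<iota> (k [^]\<^bsub>Perm\<^esub> p)" using K_closed[OF YK[OF k]] by (rule perm.nat_pow_inv)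
    then show "\<iota> k \<in> Y" by (intro YI K_inv YK[OF k]) (simp only: subgroup.m_inv_closed[OF S Yp[OF k]])
  next
    fix k l assume k: "k \<in> Y" and l: "l \<in> Y"
    have "(k \<cdot> l) [^]\<^bsub>Perm\<^esub> p = k [^]\<^bsub>Perm\<^esub> p \<cdot> l [^]\<^bsub>Perm\<^esub> p"
      by (rule perm.pow_mult_distrib[OF K_commute[OF YK[OF k] YK[OF l]] K_closed[OF YK[OF k]] K_closed[OF YK[OF l]]])
    then show "k \<cdot> l \<in> Y"
      by (intro YI K_mult YK[OF k] YK[OF l]) (simp only: subgroup.m_closed[OF S Yp[OF k] Yp[OF l]])
  qed
  moreover have "L a \<cdot> k \<cdot> \<iota> (L a) \<in> Y" if k: "k \<in> Y" for k
  proof (rule YI[OF L_conj_K(1)[OF a YK[OF k]]])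
    have eq: "(L a \<cdot> k \<cdot> \<iota> (L a)) [^]\<^bsub>Perm\<^esub> p = L a \<cdot> k [^]\<^bsub>Perm\<^esub> p \<cdot> \<iota> (L a)"
      using a K_closed[OF YK[OF k]] by (simp add: perm.conj_pow)
    have kp: "k [^]\<^bsub>Perm\<^esub> p \<in> K" "(k [^]\<^bsub>Perm\<^esub> p) a = a" using Yp[OF k] by auto
    have "(L a \<cdot> k [^]\<^bsub>Perm\<^esub> p \<cdot> \<iota> (L a)) a = a"
      using a K_closed[OF kp(1)] L_fixed[OF a] idem[OF a] kp(2) by simp
    then show "(L a \<cdot> k \<cdot> \<iota> (L a)) [^]\<^bsub>Perm\<^esub> p \<in> Stab a"
      unfolding eq using L_conj_K(1)[OF a kp(1)] by simp
  qed
  moreover have "\<iota> (L a) \<cdot> k \<cdot> L a \<in> Y" if k: "k \<in> Y" for k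
  proof (rule YI[OF L_conj_K(2)[OF a YK[OF k]]])
    have eq: "(\<iota> (L a) \<cdot> k \<cdot> L a) [^]\<^bsub>Perm\<^esub> p = \<iota> (L a) \<cdot> k [^]\<^bsub>Perm\<^esub> p \<cdot> L a"
      using perm.conj_pow[of "\<iota> (L a)" k p] a K_closed[OF YK[OF k]] by simp
    have kp: "k [^]\<^bsub>Perm\<^esub> p \<in> K" "(k [^]\<^bsub>Perm\<^esub> p) a = a" using Yp[OF k] by auto
    have "(\<iota> (L a) \<cdot> k [^]\<^bsub>Perm\<^esub> p \<cdot> L a) a = a"
      using a K_closed[OF kp(1)] L_fixed[OF a] idem[OF a] kp(2) by simp
    then show "(\<iota> (L a) \<cdot> k \<cdot> L a) [^]\<^bsub>Perm\<^esub> p \<in> Stab a"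
      unfolding eq using L_conj_K(2)[OF a kp(1)] by simp
  qed
  moreover have "Stab a \<subseteq> Y"
    using pow_subgroup[OF S] by (intro subsetI YI) auto
  moreover have "\<not> Y \<subseteq> Stab a"
  proof -
    interpret GK: group "Perm\<lparr>carrier := K\<rparr>" by (rule perm.subgroup_imp_group[OF subgroup_K])
    obtain z where z: "z \<in> K" "z \<notin> Stab a" "z [^]\<^bsub>Perm\<^esub> p \<in> Stab a"
      using GK.p_quotient_has_element_of_prime_order[OF Stab_normal[OF a] p order_K_mod_Stab[OF a] m]
      by (auto simp: pow_restrict)
    have "z \<in> Y" by (rule YI[OF z(1,3)])
    then show ?thesis using z(2) by blast
  qed
  ultimately have "Y = K" using subgroup_of_K_exhausts[OF a] YK by blast
  then show ?thesis using Yp k by blast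
qed

lemma K_exponent: assumes k: "k \<in> K" shows "k [^]\<^bsub>Perm\<^esub> p = \<one>\<^bsub>Perm\<^esub>"
proof (rule perm_eqI)
  fix x assume x: "x \<in> carrier Q"
  have "(k [^]\<^bsub>Perm\<^esub> p) x = x" using K_exponent_at[OF x k] by blast
  then show "(k [^]\<^bsub>Perm\<^esub> p) x = \<one>\<^bsub>Perm\<^esub> x" using x by simp
qed (use k K_closed in auto)

section \<open>The group modulo the kernel is elementary abelian\<close>

text \<open>Orbits of \<open>M\<close> that are the blocks of \<open>\<alpha>\<close> would put \<open>M\<close> inside \<open>K\<close>. So \<open>M\<close> is transitive, and it
  contains the point stabilisers, because \<open>K\<close> does.\<close>

lemma L_invariant_above_K:
  assumes M: "L_invariant M" "K \<subseteq> M" "M \<subseteq> D" and strict: "\<not> M \<subseteq> K"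
  shows "orb_rel M = one_cong Q" "M = D"
proof -
  have "M \<noteq> {\<one>\<^bsub>Perm\<^esub>}"
    using strict subgroup.one_closed[OF subgroup_K] by blast
  moreover have "orb_rel M \<noteq> \<alpha>"
  proof
    assume eq: "orb_rel M = \<alpha>"
    have "M \<subseteq> K"
    proof
      fix g assume g: "g \<in> M"
      obtain x where x: "x \<in> carrier Q" by (rule nonempty)
      have "(x, g x) \<in> orb_rel M" using g x by (auto simp: orb_rel_def)
      then show "g \<in> K" unfolding eq using kernel_of_related g M(3) by blast
    qed
    with strict show False by blast
  qed
  ultimately show orb: "orb_rel M = one_cong Q" using orbits_trichotomy[OF M(1,3)] by blast
  have "g \<in> M" if g: "g \<in> D" for g
  proof -
    obtain x where x: "x \<in> carrier Q" by (rule nonempty)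
    note gP = D_closed[OF g]
    have "(x, g x) \<in> orb_rel M" unfolding orb one_cong_def using x gP by simp
    then obtain h where h: "h \<in> M" "g x = h x" by (auto simp: orb_rel_def)
    have hD: "h \<in> D" using h M by blast
    have "(\<iota> h \<cdot> g) x = x" using h(2) D_closed[OF hD] gP x by simp
    then have "\<iota> h \<cdot> g \<in> K" using stabilizer_in_K[OF D_mult[OF D_inv[OF hD] g] x] by blast
    then have "h \<cdot> (\<iota> h \<cdot> g) \<in> M"
      using h M(2) subgroup.m_closed[OF L_invariant_subgroup[OF M(1)]] by blast
    then show ?thesis using D_closed[OF hD] gP by (simp add: perm.cancel_left_inv)
  qed
  then show "M = D" using M(3) by blast
qed

lemma group_D: "group (Perm\<lparr>carrier := D\<rparr>)" by (rule perm.subgroup_imp_group[OF subgroup_D])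

lemma L_conj_D:
  "a \<in> carrier Q \<Longrightarrow> g \<in> D \<Longrightarrow> L a \<cdot> g \<cdot> \<iota> (L a) \<in> D"
  "a \<in> carrier Q \<Longrightarrow> g \<in> D \<Longrightarrow> \<iota> (L a) \<cdot> g \<cdot> L a \<in> D"
  using L_invariant_D by (auto simp: L_invariant_def)

lemma L_invariant_centre_modulo_K:
  "L_invariant {g \<in> D. \<forall>h\<in>D. g \<cdot> h \<cdot> \<iota> g \<cdot> \<iota> h \<in> K}" (is "L_invariant ?M")
proof -
  have Kconj: "d \<cdot> k \<cdot> \<iota> d \<in> K" if "d \<in> D" "k \<in> K" for d k
    using L_invariant_normalized[OF L_invariant_K that] .
  have "subgroup ?M Perm"
  proof (rule perm.subgroupI)
    show "?M \<subseteq> carrier Perm" using D_closed by blast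
    have "\<one>\<^bsub>Perm\<^esub> \<in> ?M"
      using subgroup.one_closed[OF subgroup_D] subgroup.one_closed[OF subgroup_K] D_closed by simp
    then show "?M \<noteq> {}" by blast
  next
    fix g assume g: "g \<in> ?M"
    then have gD: "g \<in> D" by simp
    have "\<iota> g \<cdot> h \<cdot> \<iota> (\<iota> g) \<cdot> \<iota> h \<in> K" if h: "h \<in> D" for h
    proof -
      have "\<iota> g \<cdot> \<iota> (g \<cdot> h \<cdot> \<iota> g \<cdot> \<iota> h) \<cdot> \<iota> (\<iota> g) \<in> K"
        using Kconj[OF D_inv[OF gD] K_inv] g h by blast
      then show ?thesis using D_closed[OF gD] D_closed[OF h] by (simp add: perm.group_normalize)
    qed
    then show "\<iota> g \<in> ?M" using D_inv[OF gD] by blast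
  next
    fix g g' assume g: "g \<in> ?M" and g': "g' \<in> ?M"
    then have gD: "g \<in> D" "g' \<in> D" by simp_all
    have "g \<cdot> g' \<cdot> h \<cdot> \<iota> (g \<cdot> g') \<cdot> \<iota> h \<in> K" if h: "h \<in> D" for h
    proof -
      have "(g \<cdot> (g' \<cdot> h \<cdot> \<iota> g' \<cdot> \<iota> h) \<cdot> \<iota> g) \<cdot> (g \<cdot> h \<cdot> \<iota> g \<cdot> \<iota> h) \<in> K"
        using Kconj[OF gD(1)] g g' h K_mult by blast
      then show ?thesis using D_closed[OF gD(1)] D_closed[OF gD(2)] D_closed[OF h]
        by (simp add: perm.group_normalize)
    qed
    then show "g \<cdot> g' \<in> ?M" using D_mult[OF gD] by blast
  qed
  moreover have "L a \<cdot> g \<cdot> \<iota> (L a) \<in> ?M \<and> \<iota> (L a) \<cdot> g \<cdot> L a \<in> ?M"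
    if a: "a \<in> carrier Q" and g: "g \<in> ?M" for a g
  proof -
    have gD: "g \<in> D" and gK: "\<And>h. h \<in> D \<Longrightarrow> g \<cdot> h \<cdot> \<iota> g \<cdot> \<iota> h \<in> K" using g by auto
    note P = D_closed[OF gD] L_closed[OF a]
    have "(L a \<cdot> g \<cdot> \<iota> (L a)) \<cdot> h \<cdot> \<iota> (L a \<cdot> g \<cdot> \<iota> (L a)) \<cdot> \<iota> h \<in> K" if h: "h \<in> D" for h
      using L_conj_K(1)[OF a gK[OF L_conj_D(2)[OF a h]]] P D_closed[OF h]
      by (simp add: perm.group_normalize)
    moreover have "(\<iota> (L a) \<cdot> g \<cdot> L a) \<cdot> h \<cdot> \<iota> (\<iota> (L a) \<cdot> g \<cdot> L a) \<cdot> \<iota> h \<in> K" if h: "h \<in> D" for h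
      using L_conj_K(2)[OF a gK[OF L_conj_D(1)[OF a h]]] P D_closed[OF h]
      by (simp add: perm.group_normalize)
    ultimately show ?thesis using L_conj_D[OF a gD] by blast
  qed
  ultimately show ?thesis unfolding L_invariant_def by blast
qed

text \<open>The preimage of the centre of the \<open>q\<close>-group \<open>D/K\<close> satisfies the hypotheses of
  \<open>L_invariant_above_K\<close> and is therefore all of \<open>D\<close>.\<close>

lemma D_commute_mod_K: assumes "g \<in> D" "h \<in> D" shows "g \<cdot> h \<cdot> \<iota> g \<cdot> \<iota> h \<in> K"
proof -
  let ?M = "{g \<in> D. \<forall>h\<in>D. g \<cdot> h \<cdot> \<iota> g \<cdot> \<iota> h \<in> K}"
  interpret GD: group "Perm\<lparr>carrier := D\<rparr>" by (rule group_D)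
  obtain z where z: "z \<in> D" "z \<notin> K"
    and zc: "\<And>x. x \<in> D \<Longrightarrow> z \<cdot> x \<cdot> \<iota> z \<cdot> \<iota> x \<in> K"
    using GD.p_quotient_has_central_element[OF K_normal q order_D_mod_K n]
      perm.m_inv_consistent[OF subgroup_D] by auto
  have "k \<in> ?M" if k: "k \<in> K" for k
  proof -
    have "k \<cdot> h \<cdot> \<iota> k \<cdot> \<iota> h \<in> K" if h: "h \<in> D" for h
    proof -
      have "k \<cdot> (h \<cdot> \<iota> k \<cdot> \<iota> h) \<in> K"
        using K_mult[OF k L_invariant_normalized[OF L_invariant_K h K_inv[OF k]]] .
      then show ?thesis using K_closed[OF k] D_closed[OF h] by (simp add: perm.m_assoc)
    qed
    then show ?thesis using KD[OF k] by blast
  qed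
  then have "K \<subseteq> ?M" by blast
  moreover have "\<not> ?M \<subseteq> K" using z zc by blast
  ultimately have "?M = D" by (intro L_invariant_above_K(2) L_invariant_centre_modulo_K) auto
  then show ?thesis using assms by blast
qed

text \<open>The elements of order dividing \<open>q\<close> in the abelian \<open>q\<close>-group \<open>D/K\<close> form a nontrivial subgroup,
  to whose preimage \<open>L_invariant_above_K\<close> applies.\<close>

lemma D_pow_q_in_K: assumes "g \<in> D" shows "g [^]\<^bsub>Perm\<^esub> q \<in> K"
proof -
  let ?M = "{g \<in> D. g [^]\<^bsub>Perm\<^esub> q \<in> K}"
  interpret GD: group "Perm\<lparr>carrier := D\<rparr>" by (rule group_D)
  have mult: "g \<cdot> h \<in> ?M" if "g \<in> ?M" "h \<in> ?M" for g h
    using GD.quotient_pow_mult_closed[OF K_normal, of g h q] that D_commute_mod_K[of g h] D_mult[of g h]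
      perm.m_inv_consistent[OF subgroup_D] by (simp add: pow_restrict)
  have "subgroup ?M Perm"
  proof (rule perm.subgroupI)
    show "?M \<subseteq> carrier Perm" using D_closed by blast
    have "\<one>\<^bsub>Perm\<^esub> \<in> ?M"
      using subgroup.one_closed[OF subgroup_D] subgroup.one_closed[OF subgroup_K] by simp
    then show "?M \<noteq> {}" by blast
    fix g assume g: "g \<in> ?M"
    then have "\<iota> g [^]\<^bsub>Perm\<^esub> q = \<iota> (g [^]\<^bsub>Perm\<^esub> q)" using D_closed by (intro perm.nat_pow_inv) auto
    then show "\<iota> g \<in> ?M" using g D_inv K_inv by simp
  qed (use mult in blast)
  moreover have "L a \<cdot> g \<cdot> \<iota> (L a) \<in> ?M \<and> \<iota> (L a) \<cdot> g \<cdot> L a \<in> ?M"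
    if a: "a \<in> carrier Q" and g: "g \<in> ?M" for a g
  proof -
    have gD: "g \<in> D" and gK: "g [^]\<^bsub>Perm\<^esub> q \<in> K" using g by auto
    have "(L a \<cdot> g \<cdot> \<iota> (L a)) [^]\<^bsub>Perm\<^esub> q = L a \<cdot> g [^]\<^bsub>Perm\<^esub> q \<cdot> \<iota> (L a)"
      "(\<iota> (L a) \<cdot> g \<cdot> L a) [^]\<^bsub>Perm\<^esub> q = \<iota> (L a) \<cdot> g [^]\<^bsub>Perm\<^esub> q \<cdot> L a"
      using perm.conj_pow[of "L a" g q] perm.conj_pow[of "\<iota> (L a)" g q] a D_closed[OF gD] by simp_all
    then show ?thesis using L_conj_D[OF a gD] L_conj_K[OF a gK] by simp
  qed
  ultimately have inv: "L_invariant ?M" unfolding L_invariant_def by blast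
  obtain z where z: "z \<in> D" "z \<notin> K" "z [^]\<^bsub>Perm\<^esub> q \<in> K"
    using GD.p_quotient_has_element_of_prime_order[OF K_normal q order_D_mod_K n]
    by (auto simp: pow_restrict)
  have "K \<subseteq> ?M" using KD pow_subgroup[OF subgroup_K] by blast
  moreover have "\<not> ?M \<subseteq> K" using z by blast
  ultimately have "?M = D" by (intro L_invariant_above_K(2)[OF inv]) auto
  then show ?thesis using assms by blast
qed

lemma gamma_eq: "gamma_cong Q = \<alpha>"
proof -
  have "((g \<cdot> h) x, (h \<cdot> g) x) \<in> \<alpha>" if g: "g \<in> D" and h: "h \<in> D" and x: "x \<in> carrier Q" for g h x
  proof -
    note P = D_closed[OF g] D_closed[OF h]
    have "((h \<cdot> g) x, (g \<cdot> h \<cdot> \<iota> g \<cdot> \<iota> h) ((h \<cdot> g) x)) \<in> \<alpha>"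
      by (rule K_rel[OF D_commute_mod_K[OF g h]]) (use P x in simp)
    then have "((h \<cdot> g) x, (g \<cdot> h) x) \<in> \<alpha>" using P x by simp
    then show ?thesis by (rule cong(4))
  qed
  then have "abelian_quandle (factor Q \<alpha>)"
    unfolding abelian_factor_iff[OF \<alpha>] using kernel_of_related by blast
  then show ?thesis using gamma_cases by blast
qed

section \<open>The order of the kernel\<close>

text \<open>The fixed points of the automorphism \<open>t\<close> form a subquandle that contains the block of \<open>a\<close>
  and also \<open>c\<close>. A proper subquandle is strictly simple and cannot properly contain a block.\<close>

lemma fixing_two_blocks_trivial:
  assumes ac: "a \<in> carrier Q" "c \<in> carrier Q" "(a, c) \<notin> \<alpha>" and t: "t \<in> K" "t a = a" "t c = c"
  shows "t = \<one>\<^bsub>Perm\<^esub>"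
proof -
  define T where "T = {x \<in> carrier Q. t x = x}"
  note tP = K_closed[OF t(1)]
  have tA: "t \<in> Aut" using KD[OF t(1)] D_subset_Aut by blast
  have block: "\<alpha> `` {a} \<subseteq> T"
    using Stab_fixes[of t a] t cong(2) by (auto simp: T_def)
  have "subquandle T Q" unfolding subquandle_iff
  proof (intro conjI ballI)
    show "T \<subseteq> carrier Q" by (auto simp: T_def)
    fix x y assume "x \<in> T" "y \<in> T"
    then have Q: "x \<in> carrier Q" "y \<in> carrier Q" and xy: "t x = x" "t y = y" by (auto simp: T_def)
    show "x \<triangleright> y \<in> T" using Aut_op[OF tA Q] Q xy by (simp add: T_def)
    have "x \<triangleright> t (\<iota> (L x) y) = y"
      using Aut_op[OF tA Q(1), of "\<iota> (L x) y"] Q xy by simp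
    then have "\<iota> (L x) (x \<triangleright> t (\<iota> (L x) y)) = \<iota> (L x) y" by simp
    then have "t (\<iota> (L x) y) = \<iota> (L x) y" using Q tP by simp
    then show "\<iota> (L x) y \<in> T" using Q by (simp add: T_def)
  qed
  moreover have "more_than_one T"
    using block block_subquandle[OF ac(1)] unfolding proper_subquandle_def more_than_one_def by blast
  moreover have "c \<in> T" using ac t by (simp add: T_def)
  then have "\<alpha> `` {a} \<noteq> T" using ac(3) by blast
  ultimately have "T = carrier Q"
    using subquandle_of_proper_subquandle[OF lss, of T "\<alpha> `` {a}"] block block_subquandle[OF ac(1)]
    unfolding proper_subquandle_def by blast
  then show ?thesis by (intro perm_eqI tP) (auto simp: T_def)
qed

text \<open>An element of \<open>K\<close> is determined by the images of one point in each of two blocks.\<close>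

lemma card_K_le: "card K \<le> p ^ (2 * m)"
proof -
  obtain a c where ac: "a \<in> carrier Q" "c \<in> carrier Q" "(a, c) \<notin> \<alpha>"
    using \<alpha>_not_one \<alpha>_subset_one by (auto simp: one_cong_def)
  have fin_blocks: "finite (\<alpha> `` {a} \<times> \<alpha> `` {c})"
    using finite_subset[OF _ fin] cong(2) by blast
  have "inj_on (\<lambda>k. (k a, k c)) K"
  proof (rule inj_onI)
    fix k l assume k: "k \<in> K" and l: "l \<in> K" and eq: "(k a, k c) = (l a, l c)"
    note P = K_closed[OF k] K_closed[OF l]
    have "\<iota> l \<cdot> k = \<one>\<^bsub>Perm\<^esub>"
      by (rule fixing_two_blocks_trivial[OF ac K_mult[OF K_inv[OF l] k]]) (use eq P ac in simp_all)
    then show "k = l" using P by (metis perm.inv_closed perm.inv_equality perm.inv_inv)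
  qed
  moreover have "(\<lambda>k. (k a, k c)) ` K \<subseteq> \<alpha> `` {a} \<times> \<alpha> `` {c}"
    using K_rel ac by auto
  ultimately have "card K \<le> card (\<alpha> `` {a} \<times> \<alpha> `` {c})" using card_inj_on_le fin_blocks by blast
  also have "\<dots> = p ^ m * p ^ m"
    using card_block[OF quotientI[OF ac(1), of \<alpha>]] card_block[OF quotientI[OF ac(2), of \<alpha>]]
    by (simp add: card_cartesian_product)
  finally show ?thesis by (simp add: mult_2 power_add)
qed

end

section \<open>A complement of the kernel\<close>

context lss_quandle begin

text \<open>A Sylow \<open>q\<close>-subgroup meets the group \<open>K\<close> of exponent \<open>p\<close> trivially and has the order of
  \<open>D/K\<close>, so the products \<open>k s\<close> exhaust \<open>D\<close> by counting.\<close>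

lemma complement:
  obtains S where "subgroup S Perm" "S \<subseteq> D" "card S = q ^ n" "K \<inter> S = {\<one>\<^bsub>Perm\<^esub>}"
    "\<And>g. g \<in> D \<Longrightarrow> \<exists>k\<in>K. \<exists>s\<in>S. g = k \<cdot> s"
proof -
  have "order (Perm\<lparr>carrier := D\<rparr>) = q ^ n * card K" using card_D by (simp add: order_def)
  then obtain S where S: "subgroup S (Perm\<lparr>carrier := D\<rparr>)" and card_S: "card S = q ^ n"
    using sylow_thm[OF q group_D] finite_D by auto
  have SP: "subgroup S Perm" by (rule perm.incl_subgroup[OF subgroup_D S])
  have SD: "S \<subseteq> D" using subgroup.subset[OF S] by simp
  have Int: "K \<inter> S = {\<one>\<^bsub>Perm\<^esub>}"
  proof -
    interpret GS: group "Perm\<lparr>carrier := S\<rparr>" by (rule perm.subgroup_imp_group[OF SP])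
    have "s = \<one>\<^bsub>Perm\<^esub>" if s: "s \<in> K" "s \<in> S" for s
    proof (rule perm.coprime_exponents_trivial[OF K_closed[OF s(1)] K_exponent[OF s(1)]])
      show "s [^]\<^bsub>Perm\<^esub> (q ^ n) = \<one>\<^bsub>Perm\<^esub>"
        using GS.pow_order_eq_1[of s] s(2) card_S by (simp add: order_def pow_restrict)
      show "coprime p (q ^ n)" using p q pq by (simp add: primes_coprime)
    qed
    then show ?thesis using subgroup.one_closed[OF subgroup_K] subgroup.one_closed[OF SP] by blast
  qed
  let ?f = "\<lambda>(k, s). k \<cdot> s"
  have "inj_on ?f (K \<times> S)"
  proof (rule inj_onI, clarify)
    fix k s l t assume k: "k \<in> K" and l: "l \<in> K" and s: "s \<in> S" and t: "t \<in> S" and eq: "k \<cdot> s = l \<cdot> t"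
    have P: "k \<in> carrier Perm" "l \<in> carrier Perm" "s \<in> carrier Perm" "t \<in> carrier Perm"
      using k l s t K_closed subgroup.subset[OF SP] by auto
    have "\<iota> l \<cdot> (k \<cdot> s) \<cdot> \<iota> s = \<iota> l \<cdot> (l \<cdot> t) \<cdot> \<iota> s" using eq by simp
    then have e: "\<iota> l \<cdot> k = t \<cdot> \<iota> s" using P by (simp add: perm.group_normalize)
    have "\<iota> l \<cdot> k \<in> K" using k l K_mult K_inv by blast
    moreover have "\<iota> l \<cdot> k \<in> S"
      unfolding e using s t subgroup.m_closed[OF SP] subgroup.m_inv_closed[OF SP] by blast
    ultimately have one: "\<iota> l \<cdot> k = \<one>\<^bsub>Perm\<^esub>" using Int by blast
    have "k = l \<cdot> (\<iota> l \<cdot> k)" using P by (simp add: perm.group_normalize)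
    then have kl: "k = l" unfolding one using P by simp
    have "t = (t \<cdot> \<iota> s) \<cdot> s" using P by (simp add: perm.group_normalize)
    then have "t = s" unfolding e[symmetric] one using P by simp
    with kl show "k = l \<and> s = t" by simp
  qed
  then have "card (?f ` (K \<times> S)) = card D"
    using card_image[of ?f "K \<times> S"] card_S card_D by (simp add: card_cartesian_product)
  moreover have "?f ` (K \<times> S) \<subseteq> D" using KD SD D_mult by auto
  ultimately have "?f ` (K \<times> S) = D" using card_subset_eq[OF finite_D] by blast
  then have "\<exists>k\<in>K. \<exists>s\<in>S. g = k \<cdot> s" if "g \<in> D" for g using that by force
  with SP SD card_S Int show thesis by (rule that)
qed

text \<open>Both \<open>q\<close>-th powers and commutators of elements of \<open>S\<close> lie in \<open>K \<inter> S\<close>.\<close>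

lemma complement_elementary_abelian:
  assumes S: "subgroup S Perm" "S \<subseteq> D" "K \<inter> S = {\<one>\<^bsub>Perm\<^esub>}" and s: "s \<in> S"
  shows "s [^]\<^bsub>Perm\<^esub> q = \<one>\<^bsub>Perm\<^esub>" "t \<in> S \<Longrightarrow> s \<cdot> t = t \<cdot> s"
proof -
  have "s [^]\<^bsub>Perm\<^esub> q \<in> K \<inter> S" using D_pow_q_in_K pow_subgroup[OF S(1) s] s S(2) by blast
  then show "s [^]\<^bsub>Perm\<^esub> q = \<one>\<^bsub>Perm\<^esub>" using S(3) by blast
  assume t: "t \<in> S"
  have st: "s \<in> D" "t \<in> D" using s t S(2) by auto
  have "s \<cdot> t \<cdot> \<iota> s \<cdot> \<iota> t \<in> S"
    by (intro subgroup.m_closed[OF S(1)] subgroup.m_inv_closed[OF S(1)] s t)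
  then have "s \<cdot> t \<cdot> \<iota> s \<cdot> \<iota> t = \<one>\<^bsub>Perm\<^esub>" using D_commute_mod_K[OF st] S(3) by blast
  then show "s \<cdot> t = t \<cdot> s" by (rule commute_of_commutator[OF D_closed[OF st(1)] D_closed[OF st(2)]])
qed

text \<open>The centraliser of \<open>K\<close> contains \<open>K\<close> and is normalised by left translations. If it were
  larger than \<open>K\<close>, it would be \<open>D\<close> by \<open>L_invariant_above_K\<close>; then \<open>D = K S\<close> with \<open>K\<close> central and \<open>S\<close>
  abelian would be commutative.\<close>

lemma self_centralizing_K:
  assumes g: "g \<in> D" and comm: "\<And>k. k \<in> K \<Longrightarrow> g \<cdot> k = k \<cdot> g"
  shows "g \<in> K"
proof -
  let ?C = "{g \<in> D. \<forall>k\<in>K. g \<cdot> k = k \<cdot> g}"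
  have "subgroup ?C Perm"
  proof (rule perm.subgroupI)
    show "?C \<subseteq> carrier Perm" using D_closed by blast
    have "\<one>\<^bsub>Perm\<^esub> \<in> ?C" using subgroup.one_closed[OF subgroup_D] K_closed by simp
    then show "?C \<noteq> {}" by blast
  next
    fix g assume g: "g \<in> ?C"
    then have gD: "g \<in> D" by simp
    have "\<iota> g \<cdot> k = k \<cdot> \<iota> g" if k: "k \<in> K" for k
    proof -
      note P = D_closed[OF gD] K_closed[OF k]
      have "\<iota> g \<cdot> (k \<cdot> g) \<cdot> \<iota> g = \<iota> g \<cdot> (g \<cdot> k) \<cdot> \<iota> g" using g k by simp
      then show ?thesis using P by (simp add: perm.group_normalize)
    qed
    then show "\<iota> g \<in> ?C" using D_inv[OF gD] by simp
  next
    fix g h assume g: "g \<in> ?C" and h: "h \<in> ?C"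
    then have D: "g \<in> D" "h \<in> D" by simp_all
    have "g \<cdot> h \<cdot> k = k \<cdot> (g \<cdot> h)" if k: "k \<in> K" for k
    proof -
      note P = D_closed[OF D(1)] D_closed[OF D(2)] K_closed[OF k]
      have "g \<cdot> h \<cdot> k = g \<cdot> (k \<cdot> h)" using h k P by (simp add: perm.m_assoc)
      also have "\<dots> = (g \<cdot> k) \<cdot> h" using P by (simp add: perm.m_assoc)
      also have "\<dots> = (k \<cdot> g) \<cdot> h" using g k by simp
      finally show ?thesis using P by (simp add: perm.m_assoc)
    qed
    then show "g \<cdot> h \<in> ?C" using D_mult[OF D] by simp
  qed
  moreover have "L a \<cdot> g \<cdot> \<iota> (L a) \<in> ?C \<and> \<iota> (L a) \<cdot> g \<cdot> L a \<in> ?C"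
    if a: "a \<in> carrier Q" and g: "g \<in> ?C" for a g
  proof -
    have gD: "g \<in> D" and gk: "\<And>k. k \<in> K \<Longrightarrow> g \<cdot> k = k \<cdot> g" using g by auto
    note P = D_closed[OF gD] L_closed[OF a]
    have "L a \<cdot> g \<cdot> \<iota> (L a) \<cdot> k = k \<cdot> (L a \<cdot> g \<cdot> \<iota> (L a))" if k: "k \<in> K" for k
    proof -
      have "L a \<cdot> (g \<cdot> (\<iota> (L a) \<cdot> k \<cdot> L a)) \<cdot> \<iota> (L a) = L a \<cdot> ((\<iota> (L a) \<cdot> k \<cdot> L a) \<cdot> g) \<cdot> \<iota> (L a)"
        using gk[OF L_conj_K(2)[OF a k]] by simp
      then show ?thesis using P K_closed[OF k] by (simp add: perm.group_normalize)
    qed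
    moreover have "\<iota> (L a) \<cdot> g \<cdot> L a \<cdot> k = k \<cdot> (\<iota> (L a) \<cdot> g \<cdot> L a)" if k: "k \<in> K" for k
    proof -
      have "\<iota> (L a) \<cdot> (g \<cdot> (L a \<cdot> k \<cdot> \<iota> (L a))) \<cdot> L a = \<iota> (L a) \<cdot> ((L a \<cdot> k \<cdot> \<iota> (L a)) \<cdot> g) \<cdot> L a"
        using gk[OF L_conj_K(1)[OF a k]] by simp
      then show ?thesis using P K_closed[OF k] by (simp add: perm.group_normalize)
    qed
    ultimately show ?thesis using L_conj_D[OF a gD] by blast
  qed
  ultimately have inv: "L_invariant ?C" unfolding L_invariant_def by blast
  have KC: "K \<subseteq> ?C" using KD K_commute by blast
  have "?C \<subseteq> K"
  proof (rule ccontr)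
    assume "\<not> ?C \<subseteq> K"
    then have C: "?C = D" by (intro L_invariant_above_K(2)[OF inv KC]) auto
    obtain S where S: "subgroup S Perm" "S \<subseteq> D" "K \<inter> S = {\<one>\<^bsub>Perm\<^esub>}"
      and KS: "\<And>g. g \<in> D \<Longrightarrow> \<exists>k\<in>K. \<exists>s\<in>S. g = k \<cdot> s" by (rule complement) blast
    have "g \<cdot> h = h \<cdot> g" if g: "g \<in> D" and h: "h \<in> D" for g h
    proof -
      obtain k s where k: "k \<in> K" and s: "s \<in> S" and gks: "g = k \<cdot> s" using KS[OF g] by blast
      obtain l t where l: "l \<in> K" and t: "t \<in> S" and hlt: "h = l \<cdot> t" using KS[OF h] by blast
      have sD: "s \<in> D" "t \<in> D" using s t S(2) by auto
      note P = D_closed[OF sD(1)] D_closed[OF sD(2)] K_closed[OF k] K_closed[OF l]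
      have central: "x \<cdot> y = y \<cdot> x" if "x \<in> D" "y \<in> K" for x y using C that by blast
      have st: "s \<cdot> t = t \<cdot> s" by (rule complement_elementary_abelian(2)[OF S s t])
      have "k \<cdot> s \<cdot> h = k \<cdot> (s \<cdot> l) \<cdot> t" unfolding hlt using P by (simp add: perm.m_assoc)
      also have "s \<cdot> l = l \<cdot> s" by (rule central[OF sD(1) l])
      also have "k \<cdot> (l \<cdot> s) \<cdot> t = (k \<cdot> l) \<cdot> (s \<cdot> t)" using P by (simp add: perm.m_assoc)
      also have "\<dots> = (l \<cdot> k) \<cdot> (t \<cdot> s)" using K_commute[OF k l] st by simp
      also have "\<dots> = l \<cdot> (k \<cdot> t) \<cdot> s" using P by (simp add: perm.m_assoc)
      also have "k \<cdot> t = t \<cdot> k" by (rule central[OF sD(2) k, symmetric])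
      also have "l \<cdot> (t \<cdot> k) \<cdot> s = h \<cdot> (k \<cdot> s)" unfolding hlt using P by (simp add: perm.m_assoc)
      finally show ?thesis unfolding gks .
    qed
    then show False using D_not_commutative by blast
  qed
  then show ?thesis using g comm by blast
qed

end

section \<open>The lower central series\<close>

context quandle begin

text \<open>The subgroup \<open>[D,X]\<close>, taken in the group of all permutations, where invariance under left
  translations can be expressed.\<close>

definition D_commutators where
  "D_commutators X = generate Perm (\<Union>h\<in>D. \<Union>k\<in>X. {h \<cdot> k \<cdot> \<iota> h \<cdot> \<iota> k})"

lemma commutator_subgroup_Dis:
  assumes X: "X \<subseteq> D"
  shows "commutator_subgroup (Dis Q) (carrier (Dis Q)) X = D_commutators X"
proof -
  have inv: "inv\<^bsub>Perm\<lparr>carrier := D\<rparr>\<^esub> g = \<iota> g" if "g \<in> D" for g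
    using perm.m_inv_consistent[OF subgroup_D that] .
  have "(\<Union>h\<in>D. \<Union>k\<in>X. {h \<cdot> k \<cdot> inv\<^bsub>Perm\<lparr>carrier := D\<rparr>\<^esub> h \<cdot> inv\<^bsub>Perm\<lparr>carrier := D\<rparr>\<^esub> k}) =
      (\<Union>h\<in>D. \<Union>k\<in>X. {h \<cdot> k \<cdot> \<iota> h \<cdot> \<iota> k})"
    using inv X by (intro SUP_cong refl) auto
  moreover have "generate (Perm\<lparr>carrier := D\<rparr>) (\<Union>h\<in>D. \<Union>k\<in>X. {h \<cdot> k \<cdot> \<iota> h \<cdot> \<iota> k}) = D_commutators X"
    unfolding D_commutators_def
    by (rule perm.generate_consistent[OF _ subgroup_D]) (use X commutator_in_D in blast)
  ultimately show ?thesis by (simp add: commutator_subgroup_def Dis_def)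
qed

lemma commutator_in_D_commutators:
  "h \<in> D \<Longrightarrow> k \<in> X \<Longrightarrow> h \<cdot> k \<cdot> \<iota> h \<cdot> \<iota> k \<in> D_commutators X"
  unfolding D_commutators_def by (rule generate.incl) blast

lemma D_commutators_subset:
  assumes "subgroup Y Perm" "\<And>h k. h \<in> D \<Longrightarrow> k \<in> X \<Longrightarrow> h \<cdot> k \<cdot> \<iota> h \<cdot> \<iota> k \<in> Y"
  shows "D_commutators X \<subseteq> Y"
  unfolding D_commutators_def by (rule perm.generate_subgroup_incl[OF _ assms(1)]) (use assms(2) in blast)

lemma L_invariant_D_commutators:
  assumes X: "L_invariant X" "X \<subseteq> D"
  shows "L_invariant (D_commutators X)"
  unfolding D_commutators_def
proof (rule L_invariant_generate)
  show "(\<Union>h\<in>D. \<Union>k\<in>X. {h \<cdot> k \<cdot> \<iota> h \<cdot> \<iota> k}) \<subseteq> carrier Perm"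
    using commutator_in_D X D_closed by blast
  fix a g assume a: "a \<in> carrier Q" and "g \<in> (\<Union>h\<in>D. \<Union>k\<in>X. {h \<cdot> k \<cdot> \<iota> h \<cdot> \<iota> k})"
  then obtain h k where h: "h \<in> D" and k: "k \<in> X" and g: "g = h \<cdot> k \<cdot> \<iota> h \<cdot> \<iota> k" by blast
  have P: "h \<in> carrier Perm" "k \<in> carrier Perm" "L a \<in> carrier Perm" using h k X a D_closed by auto
  have 1: "L a \<cdot> h \<cdot> \<iota> (L a) \<in> D" "L a \<cdot> k \<cdot> \<iota> (L a) \<in> X"
    and 2: "\<iota> (L a) \<cdot> h \<cdot> L a \<in> D" "\<iota> (L a) \<cdot> k \<cdot> L a \<in> X"
    using L_invariant_D X a h k by (simp_all add: L_invariant_def)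
  have "L a \<cdot> g \<cdot> \<iota> (L a) = (L a \<cdot> h \<cdot> \<iota> (L a)) \<cdot> (L a \<cdot> k \<cdot> \<iota> (L a)) \<cdot>
      \<iota> (L a \<cdot> h \<cdot> \<iota> (L a)) \<cdot> \<iota> (L a \<cdot> k \<cdot> \<iota> (L a))"
    unfolding g using P by (simp add: perm.group_normalize)
  with 1 show "L a \<cdot> g \<cdot> \<iota> (L a) \<in> (\<Union>h\<in>D. \<Union>k\<in>X. {h \<cdot> k \<cdot> \<iota> h \<cdot> \<iota> k})" by blast
  have "\<iota> (L a) \<cdot> g \<cdot> L a = (\<iota> (L a) \<cdot> h \<cdot> L a) \<cdot> (\<iota> (L a) \<cdot> k \<cdot> L a) \<cdot>
      \<iota> (\<iota> (L a) \<cdot> h \<cdot> L a) \<cdot> \<iota> (\<iota> (L a) \<cdot> k \<cdot> L a)"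
    unfolding g using P by (simp add: perm.group_normalize)
  with 2 show "\<iota> (L a) \<cdot> g \<cdot> L a \<in> (\<Union>h\<in>D. \<Union>k\<in>X. {h \<cdot> k \<cdot> \<iota> h \<cdot> \<iota> k})" by blast
qed

lemma commutator_swap_mem:
  assumes N: "subgroup N Perm" and xy: "x \<in> carrier Perm" "y \<in> carrier Perm"
    and "x \<cdot> y \<cdot> \<iota> x \<cdot> \<iota> y \<in> N"
  shows "y \<cdot> x \<cdot> \<iota> y \<cdot> \<iota> x \<in> N"
  using subgroup.m_inv_closed[OF N assms(4)] xy by (simp add: perm.group_normalize)

lemma commutator_mult_mem:
  assumes N: "L_invariant N" and x: "x \<in> D" and y: "y \<in> D" and z: "z \<in> D"
    and "x \<cdot> y \<cdot> \<iota> x \<cdot> \<iota> y \<in> N" "x \<cdot> z \<cdot> \<iota> x \<cdot> \<iota> z \<in> N"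
  shows "x \<cdot> (y \<cdot> z) \<cdot> \<iota> x \<cdot> \<iota> (y \<cdot> z) \<in> N"
proof -
  have "(x \<cdot> y \<cdot> \<iota> x \<cdot> \<iota> y) \<cdot> (y \<cdot> (x \<cdot> z \<cdot> \<iota> x \<cdot> \<iota> z) \<cdot> \<iota> y) \<in> N"
    using assms(5) L_invariant_normalized[OF N y assms(6)]
    by (rule subgroup.m_closed[OF L_invariant_subgroup[OF N]])
  then show ?thesis using x y z D_closed by (simp add: perm.group_normalize)
qed

end

context lss_quandle begin

abbreviation \<Gamma>1 where "\<Gamma>1 \<equiv> D_commutators D"
abbreviation \<Gamma>2 where "\<Gamma>2 \<equiv> D_commutators \<Gamma>1"

lemma L_invariant_\<Gamma>1: "L_invariant \<Gamma>1" by (rule L_invariant_D_commutators[OF L_invariant_D subset_refl])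

lemma \<Gamma>1_subset_K: "\<Gamma>1 \<subseteq> K" by (rule D_commutators_subset[OF subgroup_K D_commute_mod_K])

lemma \<Gamma>1_subset_D: "\<Gamma>1 \<subseteq> D" using \<Gamma>1_subset_K K_subset_D by blast

lemma L_invariant_\<Gamma>2: "L_invariant \<Gamma>2"
  by (rule L_invariant_D_commutators[OF L_invariant_\<Gamma>1 \<Gamma>1_subset_D])

lemma orb_rel_\<Gamma>1: "orb_rel \<Gamma>1 = \<alpha>"
proof (rule orbits_in_K[OF L_invariant_\<Gamma>1 \<Gamma>1_subset_K], rule notI)
  assume triv: "\<Gamma>1 = {\<one>\<^bsub>Perm\<^esub>}"
  have "g \<cdot> h = h \<cdot> g" if "g \<in> D" "h \<in> D" for g h
  proof (rule commute_of_commutator[OF D_closed[OF that(1)] D_closed[OF that(2)]])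
    show "g \<cdot> h \<cdot> \<iota> g \<cdot> \<iota> h = \<one>\<^bsub>Perm\<^esub>" using commutator_in_D_commutators[OF that] triv by blast
  qed
  then show False using D_not_commutative by blast
qed

text \<open>If \<open>a\<close> and \<open>b\<close> are related by \<open>\<alpha>\<close>, then \<open>b = g a\<close> with \<open>g\<close> in the derived subgroup, and
  \<open>L\<^sub>a L\<^sub>b\<^sup>-\<^sup>1 = (L\<^sub>a g L\<^sub>a\<^sup>-\<^sup>1) g\<^sup>-\<^sup>1\<close>.\<close>

lemma Dis_\<alpha>_subset_\<Gamma>1: "Dis_rel Q \<alpha> \<subseteq> \<Gamma>1"
proof -
  have "displacements Q \<alpha> \<subseteq> \<Gamma>1"
  proof
    fix t assume "t \<in> displacements Q \<alpha>"
    then obtain a b where t: "t = L a \<cdot> \<iota> (L b)" and ab: "(a, b) \<in> \<alpha>" unfolding displacements_def by blast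
    have aQ: "a \<in> carrier Q" using ab cong(1) by blast
    obtain g where g: "g \<in> \<Gamma>1" "b = g a" using ab orb_rel_\<Gamma>1 unfolding orb_rel_def by blast
    have gA: "g \<in> Aut" using g \<Gamma>1_subset_D D_subset_Aut by blast
    have "t = (L a \<cdot> g \<cdot> \<iota> (L a)) \<cdot> \<iota> g"
      unfolding t g(2) L_Aut[OF gA aQ] using Aut_closed[OF gA] aQ by (simp add: perm.group_normalize)
    moreover have "L a \<cdot> g \<cdot> \<iota> (L a) \<in> \<Gamma>1" using L_invariant_\<Gamma>1 aQ g(1) by (simp add: L_invariant_def)
    ultimately show "t \<in> \<Gamma>1"
      using g(1) L_invariant_subgroup[OF L_invariant_\<Gamma>1] by (simp add: subgroup.m_closed subgroup.m_inv_closed)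
  qed
  then show ?thesis
    unfolding Dis_rel_def[of Q \<alpha>]
    by (rule perm.generate_subgroup_incl) (rule L_invariant_subgroup[OF L_invariant_\<Gamma>1])
qed

text \<open>Conversely \<open>[L\<^sub>a,d] = L\<^sub>a L\<^bsub>d a\<^esub>\<^sup>-\<^sup>1\<close> lies in \<open>Dis\<^sub>\<alpha>\<close> for \<open>d\<close> in the derived subgroup, so each
  \<open>L\<^sub>a\<close> commutes with \<open>d\<close> modulo \<open>Dis\<^sub>\<alpha>\<close>. The permutations that normalise \<open>Dis\<^sub>\<alpha>\<close> and have this
  property form a group, which contains \<open>D\<close> because it contains all left translations.\<close>

lemma \<Gamma>2_subset_Dis_\<alpha>: "\<Gamma>2 \<subseteq> Dis_rel Q \<alpha>"
proof -
  let ?N = "Dis_rel Q \<alpha>"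
  have inv: "L_invariant ?N" by (rule L_invariant_Dis_rel[OF \<alpha>])
  note N = L_invariant_subgroup[OF inv]
  have NP: "x \<in> carrier Perm" if "x \<in> ?N" for x using that subgroup.subset[OF N] by blast
  have \<Gamma>P: "x \<in> carrier Perm" if "x \<in> \<Gamma>1" for x using that \<Gamma>1_subset_D D_closed by blast
  define H where "H = {h \<in> carrier Perm. (\<forall>x\<in>?N. h \<cdot> x \<cdot> \<iota> h \<in> ?N \<and> \<iota> h \<cdot> x \<cdot> h \<in> ?N) \<and>
      (\<forall>d\<in>\<Gamma>1. h \<cdot> d \<cdot> \<iota> h \<cdot> \<iota> d \<in> ?N)}"
  have HP: "h \<in> carrier Perm" and Hn: "\<And>x. x \<in> ?N \<Longrightarrow> h \<cdot> x \<cdot> \<iota> h \<in> ?N" "\<And>x. x \<in> ?N \<Longrightarrow> \<iota> h \<cdot> x \<cdot> h \<in> ?N"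
    and Hc: "\<And>d. d \<in> \<Gamma>1 \<Longrightarrow> h \<cdot> d \<cdot> \<iota> h \<cdot> \<iota> d \<in> ?N" if "h \<in> H" for h
    using that unfolding H_def by blast+
  have HI: "h \<in> H" if "h \<in> carrier Perm" "\<And>x. x \<in> ?N \<Longrightarrow> h \<cdot> x \<cdot> \<iota> h \<in> ?N"
    "\<And>x. x \<in> ?N \<Longrightarrow> \<iota> h \<cdot> x \<cdot> h \<in> ?N" "\<And>d. d \<in> \<Gamma>1 \<Longrightarrow> h \<cdot> d \<cdot> \<iota> h \<cdot> \<iota> d \<in> ?N" for h
    using that unfolding H_def by blast
  have "subgroup H Perm"
  proof (rule perm.subgroupI)
    show "H \<subseteq> carrier Perm" using HP by blast
    have "\<one>\<^bsub>Perm\<^esub> \<in> H" by (rule HI) (use NP \<Gamma>P subgroup.one_closed[OF N] in simp_all)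
    then show "H \<noteq> {}" by blast
  next
    fix h assume h: "h \<in> H"
    show "\<iota> h \<in> H"
    proof (rule HI)
      show "\<iota> h \<cdot> x \<cdot> \<iota> (\<iota> h) \<in> ?N" "\<iota> (\<iota> h) \<cdot> x \<cdot> \<iota> h \<in> ?N" if "x \<in> ?N" for x
        using Hn[OF h that] HP[OF h] by simp_all
      show "\<iota> h \<cdot> d \<cdot> \<iota> (\<iota> h) \<cdot> \<iota> d \<in> ?N" if d: "d \<in> \<Gamma>1" for d
        using Hn(2)[OF h subgroup.m_inv_closed[OF N Hc[OF h d]]] HP[OF h] \<Gamma>P[OF d]
        by (simp add: perm.group_normalize)
    qed (use HP[OF h] in simp)
  next
    fix g h assume g: "g \<in> H" and h: "h \<in> H"
    note P = HP[OF g] HP[OF h]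
    show "g \<cdot> h \<in> H"
    proof (rule HI)
      show "g \<cdot> h \<cdot> x \<cdot> \<iota> (g \<cdot> h) \<in> ?N" "\<iota> (g \<cdot> h) \<cdot> x \<cdot> (g \<cdot> h) \<in> ?N" if x: "x \<in> ?N" for x
        using Hn(1)[OF g Hn(1)[OF h x]] Hn(2)[OF h Hn(2)[OF g x]] P NP[OF x]
        by (simp_all add: perm.group_normalize)
      show "g \<cdot> h \<cdot> d \<cdot> \<iota> (g \<cdot> h) \<cdot> \<iota> d \<in> ?N" if d: "d \<in> \<Gamma>1" for d
        using subgroup.m_closed[OF N Hn(1)[OF g Hc[OF h d]] Hc[OF g d]] P \<Gamma>P[OF d]
        by (simp add: perm.group_normalize)
    qed (use P in simp)
  qed
  moreover have "L a \<in> H" if a: "a \<in> carrier Q" for a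
  proof (rule HI[OF L_closed[OF a]])
    show "L a \<cdot> x \<cdot> \<iota> (L a) \<in> ?N" "\<iota> (L a) \<cdot> x \<cdot> L a \<in> ?N" if "x \<in> ?N" for x
      using inv a that by (simp_all add: L_invariant_def)
    show "L a \<cdot> d \<cdot> \<iota> (L a) \<cdot> \<iota> d \<in> ?N" if d: "d \<in> \<Gamma>1" for d
    proof -
      have "(a, d a) \<in> \<alpha>" using K_rel[OF _ a] d \<Gamma>1_subset_K by blast
      then have "L a \<cdot> \<iota> (L (d a)) \<in> ?N" by (rule displacement_in_Dis_rel)
      moreover have "d \<in> Aut" using d \<Gamma>1_subset_D D_subset_Aut by blast
      ultimately show ?thesis using a \<Gamma>P[OF d] by (simp add: L_Aut perm.group_normalize)
    qed
  qed
  ultimately have "D \<subseteq> H" by (intro Dis_rel_subset) auto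
  then show ?thesis using Hc by (intro D_commutators_subset[OF N]) blast
qed

text \<open>By coprimality, elements of \<open>K\<close> and of the complement commute modulo \<open>\<Gamma>2\<close>
  (\<open>coprime_commutator_mem\<close>). As both groups are abelian and generate \<open>D\<close>, the quotient by \<open>\<Gamma>2\<close> is
  abelian.\<close>

lemma \<Gamma>1_subset_\<Gamma>2: "\<Gamma>1 \<subseteq> \<Gamma>2"
proof -
  obtain S where S: "subgroup S Perm" "S \<subseteq> D" "K \<inter> S = {\<one>\<^bsub>Perm\<^esub>}"
    and KS: "\<And>g. g \<in> D \<Longrightarrow> \<exists>k\<in>K. \<exists>s\<in>S. g = k \<cdot> s" by (rule complement) blast
  note N = L_invariant_subgroup[OF L_invariant_\<Gamma>2]
  have "\<Gamma>2 \<subseteq> \<Gamma>1" using \<Gamma>2_subset_Dis_\<alpha> Dis_\<alpha>_subset_\<Gamma>1 by blast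
  then have \<Gamma>2_normal: "\<Gamma>2 \<lhd> Perm\<lparr>carrier := D\<rparr>"
    using normal_of_conj[OF subgroup_D N] L_invariant_normalized[OF L_invariant_\<Gamma>2] \<Gamma>1_subset_D by blast
  interpret GD: group "Perm\<lparr>carrier := D\<rparr>" by (rule group_D)
  have trivial: "x \<cdot> y \<cdot> \<iota> x \<cdot> \<iota> y \<in> \<Gamma>2" if "x \<cdot> y = y \<cdot> x" "x \<in> D" "y \<in> D" for x y
  proof -
    have "x \<cdot> y \<cdot> \<iota> x \<cdot> \<iota> y = \<one>\<^bsub>Perm\<^esub>"
      unfolding that(1) using that(2,3) D_closed by (simp add: perm.group_normalize)
    then show ?thesis using subgroup.one_closed[OF N] by simp
  qed
  have ks: "k \<cdot> s \<cdot> \<iota> k \<cdot> \<iota> s \<in> \<Gamma>2" if k: "k \<in> K" and s: "s \<in> S" for k s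
  proof -
    have sD: "s \<in> D" using s S(2) by blast
    let ?c = "k \<cdot> s \<cdot> \<iota> k \<cdot> \<iota> s"
    have c\<Gamma>: "?c \<in> \<Gamma>1" by (rule commutator_in_D_commutators[OF KD[OF k] sD])
    then have cK: "?c \<in> K" using \<Gamma>1_subset_K by blast
    have inv: "inv\<^bsub>Perm\<lparr>carrier := D\<rparr>\<^esub> g = \<iota> g" if "g \<in> D" for g
      by (rule perm.m_inv_consistent[OF subgroup_D that])
    show ?thesis
    proof (rule GD.coprime_commutator_mem[OF \<Gamma>2_normal, of k s ?c p q])
      show "s \<otimes>\<^bsub>Perm\<lparr>carrier := D\<rparr>\<^esub> ?c \<otimes>\<^bsub>Perm\<lparr>carrier := D\<rparr>\<^esub> inv\<^bsub>Perm\<lparr>carrier := D\<rparr>\<^esub> s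
          \<otimes>\<^bsub>Perm\<lparr>carrier := D\<rparr>\<^esub> inv\<^bsub>Perm\<lparr>carrier := D\<rparr>\<^esub> ?c \<in> \<Gamma>2"
        using commutator_in_D_commutators[OF sD c\<Gamma>] inv[OF sD] inv[OF KD[OF cK]] by simp
      show "?c [^]\<^bsub>Perm\<lparr>carrier := D\<rparr>\<^esub> p = \<one>\<^bsub>Perm\<lparr>carrier := D\<rparr>\<^esub>"
        using K_exponent[OF cK] by (simp add: pow_restrict)
      show "s [^]\<^bsub>Perm\<lparr>carrier := D\<rparr>\<^esub> q = \<one>\<^bsub>Perm\<lparr>carrier := D\<rparr>\<^esub>"
        using complement_elementary_abelian(1)[OF S s] by (simp add: pow_restrict)
      show "coprime p q" using p q pq by (simp add: primes_coprime)
    qed (use KD[OF k] sD inv in simp_all)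
  qed
  have sk: "s \<cdot> k \<cdot> \<iota> s \<cdot> \<iota> k \<in> \<Gamma>2" if "k \<in> K" "s \<in> S" for k s
    using commutator_swap_mem[OF N _ _ ks[OF that]] that K_closed D_closed S(2) by blast
  have SD: "s \<in> D" if "s \<in> S" for s using that S(2) by blast
  have kg: "k \<cdot> g \<cdot> \<iota> k \<cdot> \<iota> g \<in> \<Gamma>2" if k: "k \<in> K" and g: "g \<in> D" for k g
  proof -
    obtain l t where l: "l \<in> K" and t: "t \<in> S" and gg: "g = l \<cdot> t" using KS[OF g] by blast
    show ?thesis unfolding gg
      by (rule commutator_mult_mem[OF L_invariant_\<Gamma>2 KD[OF k] KD[OF l] SD[OF t]
            trivial[OF K_commute[OF k l] KD[OF k] KD[OF l]] ks[OF k t]])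
  qed
  have sg: "s \<cdot> g \<cdot> \<iota> s \<cdot> \<iota> g \<in> \<Gamma>2" if s: "s \<in> S" and g: "g \<in> D" for s g
  proof -
    obtain l t where l: "l \<in> K" and t: "t \<in> S" and gg: "g = l \<cdot> t" using KS[OF g] by blast
    show ?thesis unfolding gg
      by (rule commutator_mult_mem[OF L_invariant_\<Gamma>2 SD[OF s] KD[OF l] SD[OF t] sk[OF l s]
            trivial[OF complement_elementary_abelian(2)[OF S s t] SD[OF s] SD[OF t]]])
  qed
  have "g \<cdot> h \<cdot> \<iota> g \<cdot> \<iota> h \<in> \<Gamma>2" if g: "g \<in> D" and h: "h \<in> D" for g h
  proof -
    obtain l t where l: "l \<in> K" and t: "t \<in> S" and hh: "h = l \<cdot> t" using KS[OF h] by blast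
    show ?thesis unfolding hh
      by (rule commutator_mult_mem[OF L_invariant_\<Gamma>2 g KD[OF l] SD[OF t]
            commutator_swap_mem[OF N K_closed[OF l] D_closed[OF g] kg[OF l g]]
            commutator_swap_mem[OF N D_closed[OF SD[OF t]] D_closed[OF g] sg[OF t g]]])
  qed
  then show ?thesis by (rule D_commutators_subset[OF N])
qed

lemma lower_central_series:
  "lower_central (Dis Q) 1 = Dis_rel Q \<alpha>" "lower_central (Dis Q) 2 = Dis_rel Q \<alpha>"
proof -
  have 1: "lower_central (Dis Q) 1 = \<Gamma>1"
    using commutator_subgroup_Dis[OF subset_refl] by (simp add: Dis_def)
  have 2: "lower_central (Dis Q) 2 = \<Gamma>2"
    using commutator_subgroup_Dis[OF \<Gamma>1_subset_D] 1 by (simp add: numeral_2_eq_2)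
  show "lower_central (Dis Q) 1 = Dis_rel Q \<alpha>" "lower_central (Dis Q) 2 = Dis_rel Q \<alpha>"
    unfolding 1 2 using \<Gamma>1_subset_\<Gamma>2 \<Gamma>2_subset_Dis_\<alpha> Dis_\<alpha>_subset_\<Gamma>1 by blast+
qed

section \<open>The structure of the displacement group\<close>

text \<open>The rank of \<open>K\<close> lies between \<open>m\<close> and \<open>2 m\<close>: the order of \<open>K\<close> is a multiple of the block size
  \<open>p\<^sup>m\<close> and is at most \<open>p\<^sup>2\<^sup>m\<close>.\<close>

lemma semidirect_structure:
  "\<exists>k \<rho>. k \<le> m \<and>
      faithful_aut_action (elementary_abelian p (m + k)) (elementary_abelian q n) \<rho> \<and>
      Dis Q \<cong> semidirect_product (elementary_abelian p (m + k)) (elementary_abelian q n) \<rho>"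
proof -
  have p1: "p > 1" and q1: "q > 1" using p q prime_gt_1_nat by auto
  obtain S where S: "subgroup S Perm" "S \<subseteq> D" and card_S: "card S = q ^ n"
    and Int: "K \<inter> S = {\<one>\<^bsub>Perm\<^esub>}"
    and KS: "\<And>g. g \<in> D \<Longrightarrow> \<exists>k\<in>K. \<exists>s\<in>S. g = k \<cdot> s" by (rule complement) blast
  have "comm_group (Perm\<lparr>carrier := K\<rparr>)"
    by (rule group.group_comm_groupI[OF perm.subgroup_imp_group[OF subgroup_K]]) (simp add: K_commute)
  then obtain r \<phi> where r: "order (Perm\<lparr>carrier := K\<rparr>) = p ^ r"
    and \<phi>: "\<phi> \<in> iso (elementary_abelian p r) (Perm\<lparr>carrier := K\<rparr>)"
    by (rule comm_group.elementary_abelian_classification[OF _ p])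
      (use K_exponent finite_subset[OF K_subset_D finite_D] in \<open>auto simp: pow_restrict\<close>)
  have "comm_group (Perm\<lparr>carrier := S\<rparr>)"
    by (rule group.group_comm_groupI[OF perm.subgroup_imp_group[OF S(1)]])
      (simp add: complement_elementary_abelian(2)[OF S Int])
  then obtain r' \<psi> where r': "order (Perm\<lparr>carrier := S\<rparr>) = q ^ r'"
    and \<psi>: "\<psi> \<in> iso (elementary_abelian q r') (Perm\<lparr>carrier := S\<rparr>)"
    by (rule comm_group.elementary_abelian_classification[OF _ q])
      (use complement_elementary_abelian(1)[OF S Int] finite_subset[OF S(2) finite_D]
        in \<open>auto simp: pow_restrict\<close>)
  have "q ^ r' = q ^ n" using r' card_S by (simp add: order_def)
  then have "r' = n" using q1 by simp
  have card_K_eq: "card K = p ^ r" using r by (simp add: order_def)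
  obtain a where a: "a \<in> carrier Q" by (rule nonempty)
  have "p ^ m dvd p ^ r" using card_K[OF a] card_K_eq by simp
  then have "m \<le> r" using p1 by (simp add: power_dvd_imp_le)
  moreover have "r \<le> 2 * m" using card_K_le card_K_eq p1 by simp
  ultimately obtain k where k: "k \<le> m" "r = m + k" by (metis add_le_cancel_left le_Suc_ex mult_2)
  have "\<exists>\<rho>. faithful_aut_action (elementary_abelian p r) (elementary_abelian q n) \<rho> \<and>
      Perm\<lparr>carrier := D\<rparr> \<cong> semidirect_product (elementary_abelian p r) (elementary_abelian q n) \<rho>"
  proof (rule group.internal_semidirect_product[OF group_D group_elementary_abelian
        group_elementary_abelian K_normal perm.subgroup_incl[OF S(1) subgroup_D S(2)]])
    show "\<phi> \<in> iso (elementary_abelian p r) (Perm\<lparr>carrier := D, carrier := K\<rparr>)" using \<phi> by simp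
    show "\<psi> \<in> iso (elementary_abelian q n) (Perm\<lparr>carrier := D, carrier := S\<rparr>)"
      using \<psi> \<open>r' = n\<close> by simp
    show "K \<inter> S = {\<one>\<^bsub>Perm\<lparr>carrier := D\<rparr>\<^esub>}" using Int by simp
    show "\<exists>k\<in>K. \<exists>s\<in>S. g = k \<otimes>\<^bsub>Perm\<lparr>carrier := D\<rparr>\<^esub> s" if "g \<in> carrier (Perm\<lparr>carrier := D\<rparr>)" for g
      using KS that by simp
    show "s = \<one>\<^bsub>Perm\<lparr>carrier := D\<rparr>\<^esub>"
      if s: "s \<in> S" and comm: "\<And>k. k \<in> K \<Longrightarrow> s \<otimes>\<^bsub>Perm\<lparr>carrier := D\<rparr>\<^esub> k = k \<otimes>\<^bsub>Perm\<lparr>carrier := D\<rparr>\<^esub> s" for s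
    proof -
      have "s \<in> K" by (rule self_centralizing_K) (use s S(2) comm in auto)
      then show ?thesis using s Int by auto
    qed
  qed
  then show ?thesis using k unfolding Dis_def by blast
qed

end

theorem theorem3p12:
  fixes Q :: "'a qstruct" and p q m n :: nat
  assumes "prime p" and "prime q" and "p \<noteq> q"
    and "m \<ge> 1" and "n \<ge> 1" and "p ^ m > 2"
    and "Q \<in> LSS_class (p ^ m) (q ^ n) (sigma_rel Q)"
    and "gamma_cong Q \<subseteq> sigma_rel Q"
  shows "(\<exists>k \<rho>. k \<le> m \<and>
            faithful_aut_action (elementary_abelian p (m + k)) (elementary_abelian q n) \<rho> \<and>
            Dis Q \<cong> semidirect_product (elementary_abelian p (m + k)) (elementary_abelian q n) \<rho>) \<and>
         lower_central (Dis Q) 1 = lower_central (Dis Q) 2 \<and>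
         lower_central (Dis Q) 2 = Dis_rel Q (gamma_cong Q)"
proof -
  from assms(7) obtain \<alpha> where Q: "quandle Q" "finite (carrier Q)" "connected_quandle Q"
      "\<not> abelian_quandle Q" "locally_strictly_simple Q"
    and unique: "{\<beta>. congruence Q \<beta> \<and> \<beta> \<noteq> zero_cong Q \<and> \<beta> \<noteq> one_cong Q} = {\<alpha>}"
    and cards: "card (carrier (factor Q \<alpha>)) = q ^ n" "\<forall>X\<in>carrier Q // \<alpha>. card X = p ^ m"
    unfolding LSS_class_def by blast
  have "lss_quandle Q \<alpha> p q m n"
  proof (intro lss_quandle.intro lss_quandle_axioms.intro)
    fix x y assume "x \<in> carrier Q" "y \<in> carrier Q"
    moreover have "transitive_action (Dis Q) (carrier Q) (\<lambda>g. g)"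
      using Q(3) by (simp add: connected_quandle_def)
    ultimately have "\<exists>g\<in>carrier (Dis Q). g x = y" by (rule transitive_action.unique_orbit[rotated])
    then show "\<exists>g\<in>Dis_rel Q (carrier Q \<times> carrier Q). g x = y" by (simp add: Dis_def)
  next
    show "congruence Q \<alpha>" "\<alpha> \<noteq> zero_cong Q" "\<alpha> \<noteq> one_cong Q" using unique by blast+
    show "\<beta> = zero_cong Q \<or> \<beta> = \<alpha> \<or> \<beta> = one_cong Q" if "congruence Q \<beta>" for \<beta>
      using unique that by blast
    show "card (carrier Q // \<alpha>) = q ^ n" using cards(1) by (simp add: factor_def)
    show "card X = p ^ m" if "X \<in> carrier Q // \<alpha>" for X using cards(2) that by blast
  qed (use Q assms in blast)+
  then interpret lss_quandle Q \<alpha> p q m n .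
  show ?thesis using semidirect_structure lower_central_series gamma_eq by simp
qed

end
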